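(* Let $(\mathfrak{M}, \tau)$ be a tracial von Neumann algebra, let $T \in \mathfrak{M}$, and let $C \in \mathfrak{M}_{\mathrm{sa}}$. Then $V_C(T)$ is a compact set.
   Context: A tracial von Neumann algebra is a pair $(\mathfrak{M},\tau)$ with $\mathfrak{M}$ a von Neumann algebra and $\tau$ a normal, faithful, tracial state on $\mathfrak{M}$. $\mathfrak{M}_{\mathrm{sa}}$ is the set of self-adjoint elements of $\mathfrak{M}$. For a normal operator $N$ and a Borel set $B\subseteq\mathbb{C}$, $1_B(N)$ is the spectral projection of $N$ for $B$. For $T\in\mathfrak{M}_{\mathrm{sa}}$ the eigenvalue function of $T$ is $\lambda_T(s) = \inf\{t\in\mathbb{R} \mid \tau(1_{(t,\infty)}(T))\le s\}$ for $s\in[0,1)$. For real-valued $f,g\in L^\infty[0,1]$, write $g\prec f$ ($f$ majorizes $g$) if $\int_0^t g(x)\,dx\le\int_0^t f(x)\,dx$ for all $t\in[0,1]$ and $\int_0^1 g(x)\,dx=\int_0^1 f(x)\,dx$. For $C\in\mathfrak{M}_{\mathrm{sa}}$ and $T\in\mathfrak{M}$, the $C$-numerical range of $T$ is $V_C(T)=\{\tau(TX)\mid X\in\mathfrak{M}_{\mathrm{sa}},\ \lambda_X\prec\lambda_C\}\subseteq\mathbb{C}$. *)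

theory Defs
  imports "HOL-Analysis.Analysis"
begin

text \<open>
  Complex Hilbert spaces. The norm, metric and topology are those of the underlying real Hilbert
  space, whose inner product is the real part of the complex one. The complex inner product is
  linear in its first argument.
\<close>

class complex_hilbert_space = real_inner + complete_space +
  fixes scaleC :: "complex \<Rightarrow> 'a \<Rightarrow> 'a"  (infixr \<open>*\<^sub>C\<close> 75)
    and cinner :: "'a \<Rightarrow> 'a \<Rightarrow> complex"
  assumes scaleC_add_right: "a *\<^sub>C (x + y) = a *\<^sub>C x + a *\<^sub>C y"
    and scaleC_add_left: "(a + b) *\<^sub>C x = a *\<^sub>C x + b *\<^sub>C x"
    and scaleC_scaleC: "a *\<^sub>C b *\<^sub>C x = (a * b) *\<^sub>C x"
    and scaleC_of_real: "complex_of_real r *\<^sub>C x = r *\<^sub>R x"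
    and cinner_commute: "cinner x y = cnj (cinner y x)"
    and cinner_add_left: "cinner (x + y) z = cinner x z + cinner y z"
    and cinner_scaleC_left: "cinner (a *\<^sub>C x) y = a * cinner x y"
    and Re_cinner: "Re (cinner x y) = inner x y"

text \<open>
  The library type \<^typ>\<open>'h \<Rightarrow>\<^sub>L 'h\<close> consists of the bounded real-linear operators; the algebra
  of all bounded operators on the complex Hilbert space is the following subset of it.
\<close>

definition bounded_ops :: "('h::complex_hilbert_space \<Rightarrow>\<^sub>L 'h) set" where
  "bounded_ops = {A. \<forall>c x. blinfun_apply A (c *\<^sub>C x) = c *\<^sub>C blinfun_apply A x}"

definition scaleC_op :: "complex \<Rightarrow> ('h::complex_hilbert_space \<Rightarrow>\<^sub>L 'h) \<Rightarrow> ('h \<Rightarrow>\<^sub>L 'h)" where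
  "scaleC_op c A = Blinfun (\<lambda>x. c *\<^sub>C blinfun_apply A x)"

definition adj :: "('h::complex_hilbert_space \<Rightarrow>\<^sub>L 'h) \<Rightarrow> ('h \<Rightarrow>\<^sub>L 'h)" where
  "adj A = (THE B. \<forall>x y. cinner (blinfun_apply A x) y = cinner x (blinfun_apply B y))"

definition positive_op :: "('h::complex_hilbert_space \<Rightarrow>\<^sub>L 'h) \<Rightarrow> bool" where
  "positive_op A \<longleftrightarrow> A \<in> bounded_ops \<and> (\<forall>x. cinner (blinfun_apply A x) x \<in> \<real>\<^sub>\<ge>\<^sub>0)"

definition op_le :: "('h::complex_hilbert_space \<Rightarrow>\<^sub>L 'h) \<Rightarrow> ('h \<Rightarrow>\<^sub>L 'h) \<Rightarrow> bool" where
  "op_le A B \<longleftrightarrow> positive_op (B - A)"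

definition projection_op :: "('h::complex_hilbert_space \<Rightarrow>\<^sub>L 'h) \<Rightarrow> bool" where
  "projection_op P \<longleftrightarrow> P \<in> bounded_ops \<and> P o\<^sub>L P = P \<and> adj P = P"

definition commutant :: "('h::complex_hilbert_space \<Rightarrow>\<^sub>L 'h) set \<Rightarrow> ('h \<Rightarrow>\<^sub>L 'h) set" where
  "commutant S = {A \<in> bounded_ops. \<forall>B\<in>S. A o\<^sub>L B = B o\<^sub>L A}"

text \<open>
  A double commutant is automatically a subalgebra containing the identity, so only closure under
  adjoints has to be required in addition.
\<close>

definition von_neumann_algebra :: "('h::complex_hilbert_space \<Rightarrow>\<^sub>L 'h) set \<Rightarrow> bool" where
  "von_neumann_algebra M \<longleftrightarrow>
     M \<subseteq> bounded_ops \<and> (\<forall>A\<in>M. adj A \<in> M) \<and> commutant (commutant M) = M"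

definition selfadjoints :: "('h::complex_hilbert_space \<Rightarrow>\<^sub>L 'h) set \<Rightarrow> ('h \<Rightarrow>\<^sub>L 'h) set" where
  "selfadjoints M = {A \<in> M. adj A = A}"

definition is_lub_in ::
  "('h::complex_hilbert_space \<Rightarrow>\<^sub>L 'h) set \<Rightarrow> ('h \<Rightarrow>\<^sub>L 'h) set \<Rightarrow> ('h \<Rightarrow>\<^sub>L 'h) \<Rightarrow> bool" where
  "is_lub_in M D S \<longleftrightarrow> S \<in> selfadjoints M \<and> (\<forall>A\<in>D. op_le A S) \<and>
     (\<forall>B\<in>selfadjoints M. (\<forall>A\<in>D. op_le A B) \<longrightarrow> op_le S B)"

text \<open>Normality: suprema of bounded increasing nets (rendered as directed sets) are preserved.\<close>

definition normal_functional ::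
  "('h::complex_hilbert_space \<Rightarrow>\<^sub>L 'h) set \<Rightarrow> (('h \<Rightarrow>\<^sub>L 'h) \<Rightarrow> complex) \<Rightarrow> bool" where
  "normal_functional M \<phi> \<longleftrightarrow>
     (\<forall>D S. D \<subseteq> selfadjoints M \<longrightarrow> D \<noteq> {} \<longrightarrow>
        (\<forall>A\<in>D. \<forall>B\<in>D. \<exists>C\<in>D. op_le A C \<and> op_le B C) \<longrightarrow>
        is_lub_in M D S \<longrightarrow> Re (\<phi> S) = (SUP A\<in>D. Re (\<phi> A)))"

text \<open>The functional is a total function on operators; only its values on \<open>M\<close> matter.\<close>

locale tracial_von_neumann_algebra =
  fixes M :: "('h::complex_hilbert_space \<Rightarrow>\<^sub>L 'h) set"
    and \<tau> :: "('h \<Rightarrow>\<^sub>L 'h) \<Rightarrow> complex"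
  assumes vN: "von_neumann_algebra M"
    and add: "A \<in> M \<Longrightarrow> B \<in> M \<Longrightarrow> \<tau> (A + B) = \<tau> A + \<tau> B"
    and scaleC: "A \<in> M \<Longrightarrow> \<tau> (scaleC_op c A) = c * \<tau> A"
    and positive: "A \<in> M \<Longrightarrow> positive_op A \<Longrightarrow> \<tau> A \<in> \<real>\<^sub>\<ge>\<^sub>0"
    and unital: "\<tau> id_blinfun = 1"
    and faithful: "A \<in> M \<Longrightarrow> \<tau> (adj A o\<^sub>L A) = 0 \<Longrightarrow> A = 0"
    and tracial: "A \<in> M \<Longrightarrow> B \<in> M \<Longrightarrow> \<tau> (A o\<^sub>L B) = \<tau> (B o\<^sub>L A)"
    and normal: "normal_functional M \<tau>"

text \<open>Projection-valued measures on the Borel sets of the complex plane.\<close>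

definition projection_valued_measure ::
  "(complex set \<Rightarrow> ('h::complex_hilbert_space \<Rightarrow>\<^sub>L 'h)) \<Rightarrow> bool" where
  "projection_valued_measure E \<longleftrightarrow>
     (\<forall>B\<in>sets borel. projection_op (E B)) \<and>
     E {} = 0 \<and> E UNIV = id_blinfun \<and>
     (\<forall>A\<in>sets borel. \<forall>B\<in>sets borel. E (A \<inter> B) = E A o\<^sub>L E B) \<and>
     (\<forall>F :: nat \<Rightarrow> complex set. range F \<subseteq> sets borel \<longrightarrow> disjoint_family F \<longrightarrow>
        (\<forall>x. (\<lambda>n. blinfun_apply (E (F n)) x) sums blinfun_apply (E (\<Union>n. F n)) x))"

definition scalar_measure ::
  "(complex set \<Rightarrow> ('h::complex_hilbert_space \<Rightarrow>\<^sub>L 'h)) \<Rightarrow> 'h \<Rightarrow> complex measure" where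
  "scalar_measure E x =
     measure_of UNIV (sets borel) (\<lambda>B. ennreal (Re (cinner (blinfun_apply (E B) x) x)))"

text \<open>
  \<open>E\<close> is the spectral measure of \<open>N\<close> if it has bounded support and \<open>N = \<integral> z dE(z)\<close> weakly; by
  polarization it suffices to integrate against the measures \<open>\<langle>E(\<cdot>)x, x\<rangle>\<close>.
\<close>

definition is_spectral_measure ::
  "('h::complex_hilbert_space \<Rightarrow>\<^sub>L 'h) \<Rightarrow> (complex set \<Rightarrow> ('h \<Rightarrow>\<^sub>L 'h)) \<Rightarrow> bool" where
  "is_spectral_measure N E \<longleftrightarrow> projection_valued_measure E \<and>
     (\<exists>r. E (cball 0 r) = id_blinfun) \<and>
     (\<forall>x. has_bochner_integral (scalar_measure E x) (\<lambda>z. z) (cinner (blinfun_apply N x) x))"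

text \<open>
  By the spectral theorem a normal operator has a spectral measure, and it is unique on the Borel
  sets; since it is unconstrained on other sets, it is selected by \<open>SOME\<close> rather than \<open>THE\<close>.
\<close>

definition spectral_projection ::
  "complex set \<Rightarrow> ('h::complex_hilbert_space \<Rightarrow>\<^sub>L 'h) \<Rightarrow> ('h \<Rightarrow>\<^sub>L 'h)" where
  "spectral_projection B N = (SOME E. is_spectral_measure N E) B"

text \<open>
  Meaningful for \<open>s \<in> {0..<1}\<close>: the set is then nonempty and bounded below. At \<open>s = 1\<close> it is all of
  \<open>\<real>\<close>, so the value there is unspecified; it is irrelevant for the integrals below.
\<close>

definition eigenvalue_function ::
  "(('h::complex_hilbert_space \<Rightarrow>\<^sub>L 'h) \<Rightarrow> complex) \<Rightarrow> ('h \<Rightarrow>\<^sub>L 'h) \<Rightarrow> real \<Rightarrow> real" where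
  "eigenvalue_function \<tau> T s =
     Inf {t::real. Re (\<tau> (spectral_projection (complex_of_real ` {t<..}) T)) \<le> s}"

text \<open>\<open>majorized_by g f\<close> is \<open>g \<prec> f\<close>, for functions that are essentially bounded on \<open>[0,1]\<close>.\<close>

definition majorized_by :: "(real \<Rightarrow> real) \<Rightarrow> (real \<Rightarrow> real) \<Rightarrow> bool" where
  "majorized_by g f \<longleftrightarrow>
     (\<forall>t\<in>{0..1}. (LINT x:{0..t}|lebesgue. g x) \<le> (LINT x:{0..t}|lebesgue. f x)) \<and>
     (LINT x:{0..1}|lebesgue. g x) = (LINT x:{0..1}|lebesgue. f x)"

definition C_numerical_range ::
  "('h::complex_hilbert_space \<Rightarrow>\<^sub>L 'h) set \<Rightarrow> (('h \<Rightarrow>\<^sub>L 'h) \<Rightarrow> complex) \<Rightarrow>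
     ('h \<Rightarrow>\<^sub>L 'h) \<Rightarrow> ('h \<Rightarrow>\<^sub>L 'h) \<Rightarrow> complex set" where
  "C_numerical_range M \<tau> C T =
     {\<tau> (T o\<^sub>L X) | X. X \<in> selfadjoints M \<and>
        majorized_by (eigenvalue_function \<tau> X) (eigenvalue_function \<tau> C)}"

end

theory Submission
  imports Defs
begin

text \<open>
  For a self-adjoint \<open>X\<close> in \<open>M\<close> and a real number \<open>a\<close> let \<open>g\<^sub>X a = \<tau> ((X - a)\<^sub>+)\<close>. By the classical argument
  of Hardy, Littlewood and Polya, the eigenvalue function of \<open>X\<close> is majorized by that of \<open>C\<close> exactly
  when \<open>X\<close> and \<open>C\<close> have the same trace and \<open>g\<^sub>X \<le> g\<^sub>C\<close> pointwise (\<open>majorized_by_iff_excess\<close>). Moreover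
  \<open>g\<^sub>X a\<close> is the maximum of \<open>\<tau> ((X - a) A)\<close> over the projections \<open>A\<close> of \<open>M\<close>
  (\<open>excess_trace_variational\<close>, \<open>excess_trace_attained\<close>). So the admissible \<open>X\<close> are cut out by conditions
  that are affine in \<open>X\<close> and involve \<open>X\<close> only through numbers \<open>\<tau> (A X)\<close>: they form a convex set, they are
  uniformly bounded in operator norm, and they are stable under every limit that these numbers respect.
  The numerical range is the image of this set under \<open>X \<mapsto> \<tau> (T X)\<close>; it is bounded, and it remains to see
  that it is closed.

  Let \<open>z\<close> be in the closure. The admissible \<open>X\<close> with \<open>\<tau> (T X)\<close> within \<open>1 / (n + 1)\<close> of \<open>z\<close> form decreasing
  nonempty convex sets. Elements with almost minimal \<open>\<tau> (X\<^sup>2)\<close> in these sets form a Cauchy sequence for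
  the trace 2-norm, by the parallelogram law. The key point is that a sequence which is bounded in operator
  norm and fast Cauchy in the trace 2-norm converges strongly to an element of \<open>M\<close>, and that its traces converge
  (\<open>bounded_Cauchy_limit\<close>). This is where normality of \<open>\<tau>\<close> enters. If \<open>Z\<^sub>k\<close> are the increments, the operators
  \<open>(1 + \<epsilon> \<Sum>\<^sub>k 2\<^sup>k Z\<^sub>k\<^sup>2)\<^bsup>-1\<^esup>\<close> of the partial sums decrease to some \<open>R\<close>, and \<open>|Z\<^sub>k R|\<close> decays geometrically, so
  there is convergence on the range of \<open>R\<close>; normality gives \<open>\<tau> (1 - R) \<le> 2 \<epsilon>\<close>, and as \<open>\<epsilon>\<close> tends to \<open>0\<close>
  faithfulness shows that these ranges are total.

  The eigenvalue function refers to the spectral measure, so the spectral theorem has to be proved. For each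
  \<open>t\<close> there is exactly one projection that commutes with \<open>N\<close> and separates the part where \<open>N > t\<close> from the
  part where \<open>N \<le> t\<close> (\<open>spectral_cut\<close>). Its kernel is found, after scaling to a positive operator \<open>C\<close> and to
  \<open>t = 1\<close>, as the set of vectors with bounded orbit under the powers of \<open>C\<close>; that the complement lies in the
  part where \<open>C \<ge> 1\<close> follows again from the regularizing operator \<open>R\<close>. These projections yield a spectral
  measure through Stieltjes measures, and every spectral measure takes them as its values on half-lines.

  All integrals over the spectrum are evaluated by one principle: if
  \<open>(b - a) p(b) \<le> \<phi>(a) - \<phi>(b) \<le> (b - a) p(a)\<close> for all \<open>a \<le> b\<close>, then \<open>p\<close> determines the increments of \<open>\<phi>\<close>
  (\<open>sandwich_increment_unique\<close>). It applies to \<open>\<langle>(N - a)\<^sub>+ x, x\<rangle>\<close>, to \<open>\<tau> ((N - a)\<^sub>+)\<close> and to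
  \<open>\<integral> (f - a)\<^sub>+\<close>, and so identifies operator quantities with integrals.
\<close>


section \<open>Hilbert space geometry\<close>

lemma nonneg_quadratic_discriminant:
  fixes a b c :: real
  assumes "\<And>t. 0 \<le> a + 2 * t * b + t\<^sup>2 * c"
  shows "b\<^sup>2 \<le> a * c"
proof (cases "c = 0")
  case True
  have "b = 0"
  proof (rule ccontr)
    assume "b \<noteq> 0"
    then show False
      using assms[of "- (a + 1) / (2 * b)"] True by (simp add: field_simps)
  qed
  then show ?thesis using True by simp
next
  case False
  have "c > 0"
  proof (rule ccontr)
    assume "\<not> c > 0"
    with False have c: "c < 0" by simp
    \<comment> \<open>large enough for the term \<open>t\<^sup>2 c\<close> to dominate the others\<close>
    define t where "t = (\<bar>a\<bar> + 2 * \<bar>b\<bar> + 1) / \<bar>c\<bar> + 1"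
    have t1: "t \<ge> 1" unfolding t_def by simp
    have tc: "t * \<bar>c\<bar> = \<bar>a\<bar> + 2 * \<bar>b\<bar> + 1 + \<bar>c\<bar>"
      unfolding t_def using c by (simp add: field_simps)
    have "t\<^sup>2 * c = - (t * (t * \<bar>c\<bar>))" using c by (simp add: power2_eq_square)
    also have "\<dots> = - (t * (\<bar>a\<bar> + 2 * \<bar>b\<bar> + 1 + \<bar>c\<bar>))" unfolding tc ..
    finally have e: "t\<^sup>2 * c = - (t * \<bar>a\<bar>) - 2 * t * \<bar>b\<bar> - t - t * \<bar>c\<bar>"
      by (simp add: algebra_simps)
    have "2 * t * b \<le> 2 * t * \<bar>b\<bar>" using t1 by (intro mult_left_mono) auto
    moreover have "\<bar>a\<bar> \<le> t * \<bar>a\<bar>" using t1 mult_right_mono[of 1 t "\<bar>a\<bar>"] by simp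
    moreover have "0 \<le> t * \<bar>c\<bar>" using t1 by simp
    ultimately have "a + 2 * t * b + t\<^sup>2 * c < 0"
      using e t1 abs_ge_self[of a] by linarith
    with assms[of t] show False by simp
  qed
  then show ?thesis
    using assms[of "- b / c"] by (simp add: field_simps power2_eq_square)
qed

text \<open>
  The infima of \<open>q\<close> over the sets increase to a limit. Two almost minimal elements have their midpoint in the
  larger of the two sets, so \<open>q\<close> at the midpoint is not much below the infimum, and the parallelogram law makes
  \<open>q\<close> of the difference small. With constant sets this is the projection theorem; with decreasing sets it will
  give approximants that converge in the trace 2-norm.
\<close>

lemma minimizing_sequence_Cauchy:
  fixes q :: "'a::real_vector \<Rightarrow> real" and S :: "nat \<Rightarrow> 'a set"
  assumes dec: "\<And>m n. m \<le> n \<Longrightarrow> S n \<subseteq> S m"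
    and mid: "\<And>n x y. x \<in> S n \<Longrightarrow> y \<in> S n \<Longrightarrow> (1/2) *\<^sub>R (x + y) \<in> S n"
    and nonneg: "\<And>n x. x \<in> S n \<Longrightarrow> 0 \<le> q x"
    and bnd: "\<And>n. \<exists>x\<in>S n. q x \<le> b"
    and par: "\<And>x y. x \<in> S 0 \<Longrightarrow> y \<in> S 0 \<Longrightarrow>
                q (x - y) + 4 * q ((1/2) *\<^sub>R (x + y)) = 2 * q x + 2 * q y"
  obtains y where "\<And>n. y n \<in> S n" and "\<And>n w. w \<in> S n \<Longrightarrow> q (y n) \<le> q w + 1 / Suc n"
    and "\<And>e. e > 0 \<Longrightarrow> \<exists>N. \<forall>m\<ge>N. \<forall>n\<ge>N. q (y m - y n) < e"
proof -
  define d where "d n = Inf (q ` S n)" for n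
  have bdd: "bdd_below (q ` S n)" for n
    using nonneg by (auto intro!: bdd_belowI[where m=0])
  have ne: "q ` S n \<noteq> {}" for n
    using bnd[of n] by auto
  have dle: "d n \<le> q x" if "x \<in> S n" for n x
    unfolding d_def using that bdd by (auto intro: cInf_lower)
  have "\<exists>y. y \<in> S n \<and> q y < d n + 1 / Suc n" for n
    using cInf_less_iff[OF ne bdd, of n "d n + 1 / Suc n"] by (auto simp: d_def)
  then obtain y where y: "\<And>n. y n \<in> S n" and yd: "\<And>n. q (y n) < d n + 1 / Suc n"
    by metis
  have mono: "d m \<le> d n" if "m \<le> n" for m n
    unfolding d_def by (rule cInf_superset_mono[OF ne bdd]) (use dec that in auto)
  have db: "d n \<le> b" for n
    using bnd[of n] dle by force
  have "convergent d"
  proof (rule Bseq_mono_convergent)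
    have "norm (d n) \<le> \<bar>b\<bar> + \<bar>d 0\<bar>" for n
      using db[of n] mono[of 0 n] by auto
    then show "Bseq d" by (rule BseqI')
  qed (use mono in auto)
  then have dC: "Cauchy d" by (rule convergent_Cauchy)
  have key: "q (y m - y n) \<le> 2 * (d m - d n) + 2 / Suc m + 2 / Suc n" if "n \<le> m" for m n
  proof -
    have "y m \<in> S n" using y[of m] dec[OF that] by auto
    then have "d n \<le> q ((1/2) *\<^sub>R (y m + y n))"
      using dle[OF mid] y[of n] by simp
    moreover have "q (y m - y n) + 4 * q ((1/2) *\<^sub>R (y m + y n)) = 2 * q (y m) + 2 * q (y n)"
      using par y dec[of 0] by (meson subsetD zero_le)
    ultimately show ?thesis using yd[of m] yd[of n] by simp
  qed
  have par': "q (x - w) = q (w - x)" if "x \<in> S 0" "w \<in> S 0" for x w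
    using par[OF that] par[OF that(2,1)] by (simp add: add.commute)
  show ?thesis
  proof (rule that)
    show "y n \<in> S n" for n by (rule y)
    show "q (y n) \<le> q w + 1 / Suc n" if "w \<in> S n" for n w
      using yd[of n] dle[OF that] by simp
    fix e :: real assume e: "e > 0"
    obtain N1 where N1: "\<And>m n. m \<ge> N1 \<Longrightarrow> n \<ge> N1 \<Longrightarrow> \<bar>d m - d n\<bar> < e / 4"
      using CauchyD[OF dC, of "e/4"] e by (auto simp: real_norm_def)
    obtain N2 where N2: "1 / Suc N2 < e / 8"
      using reals_Archimedean[of "e/8"] e by (auto simp: field_simps)
    have small: "1 / Suc n < e / 8" if "n \<ge> N2" for n
      using N2 that by (smt (verit) frac_le of_nat_0_less_iff of_nat_mono Suc_le_mono zero_less_Suc)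
    have "q (y m - y n) < e" if "m \<ge> max N1 N2" "n \<ge> max N1 N2" "n \<le> m" for m n
      using key[OF that(3)] N1[of m n] small[of m] small[of n] that
      unfolding abs_less_iff by (simp only: max.bounded_iff) argo
    moreover have "y n \<in> S 0" for n using y dec[of 0] by auto
    ultimately have "q (y m - y n) < e" if "m \<ge> max N1 N2" "n \<ge> max N1 N2" for m n
      using that par'[of "y m" "y n"] by (metis linear)
    then show "\<exists>N. \<forall>m\<ge>N. \<forall>n\<ge>N. q (y m - y n) < e" by blast
  qed
qed

text \<open>
  The component in \<open>S\<close> is obtained by minimizing the norm over the translate \<open>x - S\<close>.
\<close>

lemma orthogonal_decomposition:
  fixes S :: "'a::{real_inner,complete_space} set"
  assumes "subspace S" "closed S"
  obtains y where "y \<in> S" "\<And>w. w \<in> S \<Longrightarrow> (x - y) \<bullet> w = 0"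
proof -
  define T where "T = (\<lambda>w. x - w) ` S"
  have Tmid: "(1/2) *\<^sub>R (u + v) \<in> T" if "u \<in> T" "v \<in> T" for u v
  proof -
    obtain a b where ab: "u = x - a" "v = x - b" "a \<in> S" "b \<in> S" using \<open>u \<in> T\<close> \<open>v \<in> T\<close> T_def by auto
    have "(1/2) *\<^sub>R (u + v) = x - (1/2) *\<^sub>R (a + b)"
      unfolding ab by (simp add: scaleR_diff_right scaleR_add_right flip: scaleR_add_left)
    moreover have "(1/2) *\<^sub>R (a + b) \<in> S"
      using assms(1) ab by (intro subspace_scale subspace_add)
    ultimately show ?thesis unfolding T_def by auto
  qed
  have x: "x \<in> T" unfolding T_def using subspace_0[OF assms(1)] by force
  obtain y where y: "\<And>n::nat. y n \<in> T"
    and ymin: "\<And>n w. w \<in> T \<Longrightarrow> (norm (y n))\<^sup>2 \<le> (norm w)\<^sup>2 + 1 / Suc n"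
    and yC: "\<And>e. e > 0 \<Longrightarrow> \<exists>N. \<forall>m\<ge>N. \<forall>n\<ge>N. (norm (y m - y n))\<^sup>2 < e"
  proof (rule minimizing_sequence_Cauchy[of "\<lambda>_. T" "\<lambda>v. (norm v)\<^sup>2" "(norm x)\<^sup>2"])
    show "\<exists>v\<in>T. (norm v)\<^sup>2 \<le> (norm x)\<^sup>2" using x by auto
    show "(norm (u - v))\<^sup>2 + 4 * (norm ((1 / 2) *\<^sub>R (u + v)))\<^sup>2 = 2 * (norm u)\<^sup>2 + 2 * (norm v)\<^sup>2"
      for u v :: 'a
      by (simp add: power_divide add_divide_distrib power2_norm_eq_inner inner_diff_left inner_diff_right inner_add_left
          inner_add_right inner_commute)
  qed (use Tmid in auto)
  have "Cauchy y"
  proof (rule CauchyI)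
    fix e :: real assume "e > 0"
    then obtain N where "\<forall>m\<ge>N. \<forall>n\<ge>N. (norm (y m - y n))\<^sup>2 < e\<^sup>2" using yC[of "e\<^sup>2"] by auto
    then show "\<exists>M. \<forall>m\<ge>M. \<forall>n\<ge>M. norm (y m - y n) < e"
      using \<open>e > 0\<close> by (metis less_imp_le norm_ge_zero power2_less_imp_less)
  qed
  then obtain z where z: "y \<longlonglongrightarrow> z" using Cauchy_convergent_iff convergent_def by blast
  have "T = (\<lambda>w. x - w) -` S"
    unfolding T_def by (auto simp: image_iff) (metis add_diff_cancel_left' diff_add_cancel)
  moreover have "closed ((\<lambda>w. x - w) -` S)"
    by (rule closed_vimage[OF assms(2)]) (intro continuous_intros)
  ultimately have zT: "z \<in> T"
    using closed_sequentially[of T y z] y z by auto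
  have zmin: "(norm z)\<^sup>2 \<le> (norm w)\<^sup>2" if "w \<in> T" for w
  proof (rule LIMSEQ_le)
    show "(\<lambda>n. (norm (y n))\<^sup>2) \<longlonglongrightarrow> (norm z)\<^sup>2" by (intro tendsto_intros z)
    show "(\<lambda>n. (norm w)\<^sup>2 + 1 / Suc n) \<longlonglongrightarrow> (norm w)\<^sup>2"
      using tendsto_add[OF tendsto_const LIMSEQ_inverse_real_of_nat, of "(norm w)\<^sup>2"]
      by (simp add: inverse_eq_divide)
    show "\<exists>N. \<forall>n\<ge>N. (norm (y n))\<^sup>2 \<le> (norm w)\<^sup>2 + 1 / Suc n" using ymin that by auto
  qed
  obtain s where s: "s \<in> S" "z = x - s" using zT T_def by auto
  show ?thesis
  proof (rule that[of s])
    fix w assume w: "w \<in> S"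
    have "0 \<le> 0 + 2 * t * (- (z \<bullet> w)) + t\<^sup>2 * (w \<bullet> w)" for t
    proof -
      have "x - (s + t *\<^sub>R w) \<in> T"
        unfolding T_def using assms(1) s w by (auto intro!: imageI subspace_add subspace_scale)
      then have "(norm z)\<^sup>2 \<le> (norm (z - t *\<^sub>R w))\<^sup>2"
        using zmin by (simp add: s(2) diff_diff_eq)
      then show ?thesis
        unfolding power2_norm_eq_inner
        by (simp add: inner_diff_left inner_diff_right inner_commute power2_eq_square algebra_simps)
    qed
    then have "(- (z \<bullet> w))\<^sup>2 \<le> 0 * (w \<bullet> w)" by (rule nonneg_quadratic_discriminant)
    then show "(x - s) \<bullet> w = 0" using s by simp
  qed (use s in auto)
qed

text \<open>
  The representing vector is the multiple of a vector orthogonal to the kernel on which \<open>f\<close> has the right value.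
\<close>

lemma riesz_representation:
  fixes f :: "'a::{real_inner,complete_space} \<Rightarrow> real"
  assumes "bounded_linear f"
  obtains y where "\<And>x. f x = x \<bullet> y"
proof (cases "\<forall>x. f x = 0")
  case True
  then show ?thesis using that[of 0] by simp
next
  case False
  interpret bounded_linear f by fact
  obtain x0 where x0: "f x0 \<noteq> 0" using False by blast
  define S where "S = {x. f x = 0}"
  have "subspace S" unfolding S_def subspace_def by (auto simp: zero add scaleR)
  moreover have "closed S"
    unfolding S_def by (intro closed_Collect_eq continuous_intros continuous_on)
  ultimately obtain s where s: "s \<in> S" "\<And>w. w \<in> S \<Longrightarrow> (x0 - s) \<bullet> w = 0"
    using orthogonal_decomposition by blast
  define z where "z = x0 - s"
  have fz: "f z \<noteq> 0" using x0 s(1) by (simp add: z_def S_def diff)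
  then have zz: "z \<bullet> z \<noteq> 0" using zero by auto
  show ?thesis
  proof (rule that[of "(f z / (z \<bullet> z)) *\<^sub>R z"])
    fix x
    have "x - (f x / f z) *\<^sub>R z \<in> S" unfolding S_def using fz by (simp add: diff scaleR)
    then have "z \<bullet> x = (f x / f z) * (z \<bullet> z)"
      using s(2)[of "x - (f x / f z) *\<^sub>R z"] by (simp add: z_def[symmetric] inner_diff_right)
    then show "f x = x \<bullet> (f z / (z \<bullet> z)) *\<^sub>R z"
      using fz zz by (simp add: inner_commute field_simps)
  qed
qed

lemma blinfun_real_adjoint:
  fixes A :: "'a::{real_inner,complete_space} \<Rightarrow>\<^sub>L 'a"
  obtains B :: "'a \<Rightarrow>\<^sub>L 'a" where "\<And>x y. A x \<bullet> y = x \<bullet> B y"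
proof -
  have "\<exists>z. \<forall>x. A x \<bullet> y = x \<bullet> z" for y
  proof -
    have "bounded_linear (\<lambda>x. A x \<bullet> y)"
      by (intro bounded_linear_inner_left_comp blinfun.bounded_linear_right)
    then show ?thesis by (rule riesz_representation) blast
  qed
  then obtain g where g: "\<And>x y. A x \<bullet> y = x \<bullet> g y" by metis
  have "bounded_linear g"
  proof (rule bounded_linear_intro[where K="norm A"])
    show "g (x + y) = g x + g y" for x y
      by (subst vector_eq_ldot[symmetric]) (simp add: g[symmetric] inner_add_right)
    show "g (r *\<^sub>R x) = r *\<^sub>R g x" for r x
      by (subst vector_eq_ldot[symmetric]) (simp add: g[symmetric])
    show "norm (g x) \<le> norm x * norm A" for x
    proof (cases "g x = 0")
      case False
      have "(norm (g x))\<^sup>2 = A (g x) \<bullet> x" by (simp add: g power2_norm_eq_inner)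
      also have "\<dots> \<le> norm (A (g x)) * norm x" by (rule norm_cauchy_schwarz)
      also have "\<dots> \<le> (norm A * norm (g x)) * norm x"
        by (intro mult_right_mono norm_blinfun) simp
      finally show ?thesis using False by (simp add: power2_eq_square field_simps)
    qed simp
  qed
  then show ?thesis using that[of "Blinfun g"] g by (simp add: bounded_linear_Blinfun_apply)
qed

section \<open>Hermitian operators\<close>

text \<open>
  The complex inner product is determined by the real one. This is why everything below can be done with the
  real inner product, complex linearity being a side condition.
\<close>

lemma Im_cinner: "Im (cinner x y) = x \<bullet> (\<i> *\<^sub>C y)"
proof -
  have "cinner x (\<i> *\<^sub>C y) = - \<i> * cinner x y"
    unfolding cinner_commute[of x] cinner_scaleC_left by simp
  then have "Re (cinner x (\<i> *\<^sub>C y)) = Im (cinner x y)" by simp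
  then show ?thesis by (simp only: Re_cinner)
qed

lemma cinner_eq_Complex: "cinner x y = Complex (x \<bullet> y) (x \<bullet> (\<i> *\<^sub>C y))"
  by (simp add: complex_eq_iff Im_cinner Re_cinner)

lemma inner_i_scaleC: "(\<i> *\<^sub>C x) \<bullet> y = - (x \<bullet> (\<i> *\<^sub>C y))"
proof -
  have "(\<i> *\<^sub>C x) \<bullet> y = Re (\<i> * cinner x y)"
    by (simp only: cinner_scaleC_left flip: Re_cinner)
  then show ?thesis by (simp add: Im_cinner)
qed

lemma scaleC_Complex: "c *\<^sub>C x = Re c *\<^sub>R x + Im c *\<^sub>R (\<i> *\<^sub>C x)"
proof -
  have "c *\<^sub>C x = (complex_of_real (Re c) + complex_of_real (Im c) * \<i>) *\<^sub>C x"
    by (simp add: complex_eq mult.commute flip: complex_eq)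
  then show ?thesis by (simp add: scaleC_add_left scaleC_of_real flip: scaleC_scaleC)
qed

lemma norm_i_scaleC [simp]: "norm (\<i> *\<^sub>C x) = norm x" for x :: "'h::complex_hilbert_space"
proof -
  have "\<i> *\<^sub>C \<i> *\<^sub>C x = (-1) *\<^sub>R x"
    using scaleC_of_real[of "-1" x] by (simp add: scaleC_scaleC)
  then have "(\<i> *\<^sub>C x) \<bullet> (\<i> *\<^sub>C x) = x \<bullet> x" by (simp add: inner_i_scaleC)
  then show ?thesis by (simp add: norm_eq_sqrt_inner)
qed

lemma bounded_linear_scaleC: "bounded_linear (\<lambda>x::'h::complex_hilbert_space. c *\<^sub>C x)"
proof (rule bounded_linear_intro[where K="\<bar>Re c\<bar> + \<bar>Im c\<bar>"])
  show "c *\<^sub>C (x + y) = c *\<^sub>C x + c *\<^sub>C y" for x y :: 'h by (rule scaleC_add_right)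
  show "c *\<^sub>C r *\<^sub>R x = r *\<^sub>R c *\<^sub>C x" for r and x :: 'h
    by (simp add: scaleC_scaleC mult.commute flip: scaleC_of_real)
  show "norm (c *\<^sub>C x) \<le> norm x * (\<bar>Re c\<bar> + \<bar>Im c\<bar>)" for x :: 'h
    unfolding scaleC_Complex[of c]
    by (rule order_trans[OF norm_triangle_ineq]) (simp add: algebra_simps)
qed

lemma bounded_ops_iff: "A \<in> bounded_ops \<longleftrightarrow> (\<forall>x. A (\<i> *\<^sub>C x) = \<i> *\<^sub>C A x)"
proof
  assume *: "\<forall>x. A (\<i> *\<^sub>C x) = \<i> *\<^sub>C A x"
  show "A \<in> bounded_ops"
    unfolding bounded_ops_def mem_Collect_eq
  proof (intro allI)
    fix c x
    show "A (c *\<^sub>C x) = c *\<^sub>C A x"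
      using * by (simp add: scaleC_Complex[of c] blinfun.bilinear_simps)
  qed
qed (simp add: bounded_ops_def)

lemma scaleC_linear_simps:
  "c *\<^sub>C (x - y) = c *\<^sub>C x - c *\<^sub>C y" "c *\<^sub>C (- x) = - (c *\<^sub>C x)" "c *\<^sub>C (0::'h) = 0"
  "c *\<^sub>C (r *\<^sub>R x) = r *\<^sub>R (c *\<^sub>C x)" for x :: "'h::complex_hilbert_space"
  using bounded_linear_scaleC[where 'h='h, of c, THEN bounded_linear.linear]
  by (simp_all add: linear_diff linear_neg linear_0 linear_scale)

lemma bounded_ops_intros [intro]:
  "0 \<in> bounded_ops" "id_blinfun \<in> bounded_ops"
  "A \<in> bounded_ops \<Longrightarrow> B \<in> bounded_ops \<Longrightarrow> A + B \<in> bounded_ops"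
  "A \<in> bounded_ops \<Longrightarrow> B \<in> bounded_ops \<Longrightarrow> A - B \<in> bounded_ops"
  "A \<in> bounded_ops \<Longrightarrow> r *\<^sub>R A \<in> bounded_ops"
  "A \<in> bounded_ops \<Longrightarrow> B \<in> bounded_ops \<Longrightarrow> A o\<^sub>L B \<in> bounded_ops"
  by (auto simp: bounded_ops_iff blinfun.bilinear_simps scaleC_linear_simps scaleC_add_right)

lemma bounded_ops_adjoint:
  fixes A B :: "'h::complex_hilbert_space \<Rightarrow>\<^sub>L 'h"
  assumes A: "A \<in> bounded_ops" and adj: "\<And>x y. A x \<bullet> y = x \<bullet> B y"
  shows "B \<in> bounded_ops"
  unfolding bounded_ops_iff
proof
  fix y
  show "B (\<i> *\<^sub>C y) = \<i> *\<^sub>C B y"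
  proof (subst vector_eq_ldot[symmetric], intro allI)
    fix x
    have "x \<bullet> B (\<i> *\<^sub>C y) = - (A (\<i> *\<^sub>C x) \<bullet> y)"
      using A by (simp add: bounded_ops_iff inner_i_scaleC flip: adj)
    also have "\<dots> = x \<bullet> (\<i> *\<^sub>C B y)" by (simp add: adj inner_i_scaleC)
    finally show "x \<bullet> B (\<i> *\<^sub>C y) = x \<bullet> (\<i> *\<^sub>C B y)" .
  qed
qed

lemma adj_eqI:
  fixes A B :: "'h::complex_hilbert_space \<Rightarrow>\<^sub>L 'h"
  assumes A: "A \<in> bounded_ops" and *: "\<And>x y. A x \<bullet> y = x \<bullet> B y"
  shows "adj A = B"
  unfolding adj_def
proof (rule the_equality)
  have "B \<in> bounded_ops" using bounded_ops_adjoint[OF assms] .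
  then show "\<forall>x y. cinner (A x) y = cinner x (B y)"
    using * by (simp add: cinner_eq_Complex bounded_ops_iff)
next
  fix C :: "'h \<Rightarrow>\<^sub>L 'h" assume C: "\<forall>x y. cinner (A x) y = cinner x (C y)"
  show "C = B"
  proof (rule blinfun_eqI)
    fix y
    show "C y = B y"
      using C by (subst vector_eq_ldot[symmetric]) (metis * Re_cinner)
  qed
qed

lemma adj_inner:
  fixes A :: "'h::complex_hilbert_space \<Rightarrow>\<^sub>L 'h"
  assumes A: "A \<in> bounded_ops"
  shows "A x \<bullet> y = x \<bullet> adj A y" and "adj A \<in> bounded_ops"
proof -
  obtain B :: "'h \<Rightarrow>\<^sub>L 'h" where B: "\<And>x y. A x \<bullet> y = x \<bullet> B y"
    using blinfun_real_adjoint by blast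
  have "adj A = B" using adj_eqI[OF A B] .
  then show "A x \<bullet> y = x \<bullet> adj A y" "adj A \<in> bounded_ops"
    using B bounded_ops_adjoint[OF A B] by auto
qed

definition hermitian :: "('h::complex_hilbert_space \<Rightarrow>\<^sub>L 'h) \<Rightarrow> bool" where
  "hermitian A \<longleftrightarrow> A \<in> bounded_ops \<and> (\<forall>x y. A x \<bullet> y = x \<bullet> A y)"

lemma hermitian_iff_adj: "hermitian A \<longleftrightarrow> A \<in> bounded_ops \<and> adj A = A"
  using adj_eqI[of A A] adj_inner[of A] by (auto simp: hermitian_def)

lemma hermitianD: "hermitian A \<Longrightarrow> A x \<bullet> y = x \<bullet> A y"
  and hermitian_bounded_ops [dest]: "hermitian A \<Longrightarrow> A \<in> bounded_ops"
  by (auto simp: hermitian_def)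

lemma hermitian_intros [intro]:
  "hermitian 0" "hermitian id_blinfun"
  "hermitian A \<Longrightarrow> hermitian B \<Longrightarrow> hermitian (A + B)"
  "hermitian A \<Longrightarrow> hermitian B \<Longrightarrow> hermitian (A - B)"
  "hermitian A \<Longrightarrow> hermitian (r *\<^sub>R A)"
  "hermitian A \<Longrightarrow> hermitian (A o\<^sub>L A)"
  by (auto simp: hermitian_def blinfun.bilinear_simps inner_add_left inner_add_right
      inner_diff_left inner_diff_right)

lemma hermitian_compose: 
  assumes "hermitian A" "hermitian B" "A o\<^sub>L B = B o\<^sub>L A"
  shows "hermitian (A o\<^sub>L B)"
proof -
  have "A (B x) = B (A x)" for x using assms(3) by (metis blinfun_apply_blinfun_compose)
  then show ?thesis using assms by (auto simp: hermitian_def)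
qed

lemma hermitian_sum: "(\<And>i. i \<in> I \<Longrightarrow> hermitian (A i)) \<Longrightarrow> hermitian (sum A I)"
  by (induction I rule: infinite_finite_induct) auto

lemma hermitian_cinner_real:
  assumes "hermitian A"
  shows "cinner (A x) x = complex_of_real (A x \<bullet> x)"
proof -
  have "A x \<bullet> (\<i> *\<^sub>C x) = - (A x \<bullet> (\<i> *\<^sub>C x))"
    using assms by (metis bounded_ops_iff hermitian_def inner_commute inner_i_scaleC)
  then show ?thesis by (simp add: cinner_eq_Complex complex_eq_iff)
qed

lemma positive_op_hermitian:
  assumes "hermitian A" "\<And>x. 0 \<le> A x \<bullet> x"
  shows "positive_op A"
  using assms unfolding positive_op_def
  by (auto simp: hermitian_cinner_real nonneg_Reals_of_real_iff)

lemma op_le_inner: "op_le A B \<Longrightarrow> A x \<bullet> x \<le> B x \<bullet> x"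
  unfolding op_le_def positive_op_def
  by (metis Re_cinner blinfun.diff_left complex_nonneg_Reals_iff diff_ge_0_iff_ge inner_diff_left)

lemma op_le_hermitian:
  assumes "hermitian A" "hermitian B" "\<And>x. A x \<bullet> x \<le> B x \<bullet> x"
  shows "op_le A B"
  unfolding op_le_def by (rule positive_op_hermitian)
    (use assms in \<open>auto simp: blinfun.diff_left inner_diff_left\<close>)

text \<open>
  Polarization: a symmetric operator is determined by its quadratic form.
\<close>

lemma hermitian_eqI:
  assumes A: "hermitian A" and B: "hermitian B" and *: "\<And>x. A x \<bullet> x = B x \<bullet> x"
  shows "A = B"
proof (rule blinfun_eqI)
  fix y
  define D where "D = A - B"
  have D: "hermitian D" unfolding D_def using A B by auto
  have 0: "D x \<bullet> x = 0" for x unfolding D_def using * by (simp add: blinfun.diff_left inner_diff_left)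
  have "D (y + D y) \<bullet> (y + D y) = 2 * (D y \<bullet> D y)"
    using 0[of y] 0[of "D y"] hermitianD[OF D, of y "D y"] hermitianD[OF D, of "D y" y]
    by (simp add: blinfun.add_right inner_add_left inner_add_right inner_commute)
  then have "D y = 0" using 0[of "y + D y"] by simp
  then show "A y = B y" by (simp add: D_def blinfun.diff_left)
qed

lemma positive_Cauchy_Schwarz:
  assumes "hermitian A" "\<And>x. 0 \<le> A x \<bullet> x"
  shows "(A x \<bullet> y)\<^sup>2 \<le> (A x \<bullet> x) * (A y \<bullet> y)"
proof (rule nonneg_quadratic_discriminant)
  fix t :: real
  have "A y \<bullet> x = A x \<bullet> y" using hermitianD[OF assms(1)] by (simp add: inner_commute)
  then show "0 \<le> A x \<bullet> x + 2 * t * (A x \<bullet> y) + t\<^sup>2 * (A y \<bullet> y)"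
    using assms(2)[of "x + t *\<^sub>R y"]
    by (simp add: blinfun.bilinear_simps inner_add_left inner_add_right power2_eq_square algebra_simps)
qed

text \<open>
  Cauchy-Schwarz for the form \<open>\<langle>A x, y\<rangle>\<close> at \<open>y = A x\<close>. In operator terms \<open>0 \<le> A \<le> c\<close> implies
  \<open>A\<^sup>2 \<le> c A\<close>; it converts convergence of quadratic forms into strong convergence.
\<close>

lemma positive_norm_bound:
  assumes "hermitian A" "\<And>x. 0 \<le> A x \<bullet> x" "\<And>x. A x \<bullet> x \<le> c * (norm x)\<^sup>2" "c \<ge> 0"
  shows "(norm (A x))\<^sup>2 \<le> c * (A x \<bullet> x)"
proof (cases "A x = 0")
  case False
  have "((norm (A x))\<^sup>2)\<^sup>2 \<le> (A x \<bullet> x) * (A (A x) \<bullet> A x)"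
    using positive_Cauchy_Schwarz[OF assms(1,2), of x "A x"] by (simp add: power2_norm_eq_inner)
  also have "\<dots> \<le> (A x \<bullet> x) * (c * (norm (A x))\<^sup>2)"
    using assms by (intro mult_left_mono) auto
  finally have "(norm (A x))\<^sup>2 * (norm (A x))\<^sup>2 \<le> (c * (A x \<bullet> x)) * (norm (A x))\<^sup>2"
    by (simp add: power2_eq_square algebra_simps)
  then show ?thesis using False by (meson mult_right_le_imp_le zero_less_norm_iff zero_less_power)
qed (use assms in auto)

lemma inner_le_norm_blinfun: "\<bar>A x \<bullet> x\<bar> \<le> norm A * (norm x)\<^sup>2"
  for A :: "'a::real_inner \<Rightarrow>\<^sub>L 'a"
proof -
  have "\<bar>A x \<bullet> x\<bar> \<le> norm (A x) * norm x" by (rule Cauchy_Schwarz_ineq2)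
  also have "\<dots> \<le> (norm A * norm x) * norm x" by (intro mult_right_mono norm_blinfun) simp
  finally show ?thesis by (simp add: power2_eq_square)
qed

section \<open>Orthogonal projections\<close>

lemma closed_complex_subspace_projection:
  fixes S :: "'h::complex_hilbert_space set"
  assumes S: "subspace S" "closed S" and i: "\<And>x. x \<in> S \<Longrightarrow> \<i> *\<^sub>C x \<in> S"
  obtains P where "projection_op P" "\<And>x. P x = x \<longleftrightarrow> x \<in> S"
proof -
  have "\<exists>y. y \<in> S \<and> (\<forall>w\<in>S. (x - y) \<bullet> w = 0)" for x
    by (rule orthogonal_decomposition[OF S, of x]) blast
  then have "\<exists>p. \<forall>x. p x \<in> S \<and> (\<forall>w\<in>S. (x - p x) \<bullet> w = 0)"
    by (intro choice allI)
  then obtain p where pS: "\<And>x. p x \<in> S" and orth: "\<And>x w. w \<in> S \<Longrightarrow> (x - p x) \<bullet> w = 0"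
    by blast
  have uniq: "p x = y" if "y \<in> S" "\<And>w. w \<in> S \<Longrightarrow> (x - y) \<bullet> w = 0" for x y
  proof -
    have "p x - y \<in> S" using pS that S(1) by (simp add: subspace_diff)
    from that(2)[OF this] orth[OF this, of x] have "(p x - y) \<bullet> (p x - y) = 0"
      by (simp add: inner_diff_left)
    then show ?thesis by simp
  qed
  have sym: "p x \<bullet> y = x \<bullet> p y" for x y
    using orth[OF pS[of y], of x] orth[OF pS[of x], of y]
    by (simp add: inner_diff_left inner_commute[of y] inner_commute[of "p y"])
  have bl: "bounded_linear p"
  proof (rule bounded_linear_intro[where K=1])
    show "p (x + y) = p x + p y" for x y
      by (subst vector_eq_ldot[symmetric]) (simp add: sym[symmetric] inner_add_right)
    show "p (r *\<^sub>R x) = r *\<^sub>R p x" for r x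
      by (subst vector_eq_ldot[symmetric]) (simp add: sym[symmetric])
    show "norm (p x) \<le> norm x * 1" for x
    proof (cases "p x = 0")
      case False
      have "norm (p x) * norm (p x) = p x \<bullet> p x"
        by (metis power2_norm_eq_inner power2_eq_square)
      also have "\<dots> = x \<bullet> p x" using orth[OF pS[of x], of x] by (simp add: inner_diff_left)
      also have "\<dots> \<le> norm x * norm (p x)" by (rule norm_cauchy_schwarz)
      finally show ?thesis using False by simp
    qed simp
  qed
  define P where "P = Blinfun p"
  have P: "P x = p x" for x by (simp add: P_def bounded_linear_Blinfun_apply bl)
  have "P \<in> bounded_ops"
    unfolding bounded_ops_iff P
  proof
    fix x
    show "p (\<i> *\<^sub>C x) = \<i> *\<^sub>C p x"
    proof (rule uniq)
      fix w assume "w \<in> S"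
      then show "(\<i> *\<^sub>C x - \<i> *\<^sub>C p x) \<bullet> w = 0"
        using orth[OF i, of w x] by (simp add: inner_i_scaleC flip: scaleC_linear_simps)
    qed (simp add: pS i)
  qed
  then have h: "hermitian P" by (simp add: hermitian_def P sym)
  have pfix: "p x = x \<longleftrightarrow> x \<in> S" for x
    using uniq[of x x] pS[of x] by auto
  have "P o\<^sub>L P = P"
    by (rule blinfun_eqI) (simp add: P pfix pS)
  then have "projection_op P"
    using h by (simp add: projection_op_def hermitian_iff_adj)
  then show ?thesis by (rule that) (simp add: P pfix)
qed

lemma projection_op_hermitian: "projection_op P \<Longrightarrow> hermitian P"
  and projection_op_bounded_ops [dest]: "projection_op P \<Longrightarrow> P \<in> bounded_ops"
  by (simp_all add: projection_op_def hermitian_iff_adj)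

lemma projection_op_idem: "projection_op P \<Longrightarrow> P (P x) = P x"
  unfolding projection_op_def by (metis blinfun_apply_blinfun_compose)

lemma projection_opI: "hermitian P \<Longrightarrow> (\<And>x. P (P x) = P x) \<Longrightarrow> projection_op P"
  by (auto simp: projection_op_def hermitian_iff_adj intro: blinfun_eqI)

lemma projection_op_inner: "projection_op P \<Longrightarrow> P x \<bullet> x = (norm (P x))\<^sup>2"
  by (metis hermitianD power2_norm_eq_inner projection_op_hermitian projection_op_idem inner_commute)

lemma projection_op_pythagoras:
  assumes "projection_op P"
  shows "(norm (P x))\<^sup>2 + (norm (x - P x))\<^sup>2 = (norm x)\<^sup>2"
proof -
  have "P x \<bullet> P x = P x \<bullet> x" using projection_op_inner[OF assms] by (simp add: power2_norm_eq_inner)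
  then show ?thesis
    by (simp add: power2_norm_eq_inner inner_diff_left inner_diff_right inner_commute)
qed

lemma projection_op_norm_le: "projection_op P \<Longrightarrow> norm (P x) \<le> norm x"
  using projection_op_pythagoras[of P x] by (metis le_add_same_cancel1 norm_ge_zero power2_le_imp_le zero_le_power2)

lemma projection_op_complement: "projection_op P \<Longrightarrow> projection_op (id_blinfun - P)"
  by (rule projection_opI)
     (auto simp: blinfun.bilinear_simps projection_op_idem intro: projection_op_hermitian)

lemma projection_op_trivial: "projection_op 0" "projection_op id_blinfun"
  by (auto intro!: projection_opI)

text \<open>
  Invariance of the range under \<open>B\<close> gives \<open>P B P = B P\<close>, and invariance under the adjoint gives
  \<open>P B P = P B\<close>.
\<close>

lemma projection_commutes:
  assumes P: "projection_op P" and B: "B \<in> bounded_ops"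
    and inv: "\<And>x. P x = x \<Longrightarrow> P (B x) = B x" "\<And>x. P x = x \<Longrightarrow> P (adj B x) = adj B x"
  shows "P o\<^sub>L B = B o\<^sub>L P"
proof (rule blinfun_eqI)
  fix x
  note h = hermitianD[OF projection_op_hermitian[OF P]] and id = projection_op_idem[OF P]
  show "(P o\<^sub>L B) x = (B o\<^sub>L P) x"
  proof (subst vector_eq_rdot[symmetric], intro allI)
    fix y
    have "P (B x) \<bullet> y = x \<bullet> adj B (P y)" by (simp add: h adj_inner[OF B])
    also have "\<dots> = x \<bullet> P (adj B (P y))" using inv(2)[of "P y"] by (simp add: id)
    also have "\<dots> = P (B (P x)) \<bullet> y" by (simp add: h adj_inner[OF B])
    also have "\<dots> = B (P x) \<bullet> y" using inv(1)[of "P x"] by (simp add: id)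
    finally show "(P o\<^sub>L B) x \<bullet> y = (B o\<^sub>L P) x \<bullet> y" by simp
  qed
qed

section \<open>Inverses, strong limits and regularization\<close>

text \<open>
  \<open>B\<close> is bounded below, so its range is closed, and the orthogonal complement of the range is trivial because
  \<open>\<langle>B z, z\<rangle>\<close> dominates \<open>|z|\<^sup>2\<close>.
\<close>

lemma inverse_of_ge_id:
  fixes B :: "'h::complex_hilbert_space \<Rightarrow>\<^sub>L 'h"
  assumes B: "hermitian B" and ge: "\<And>x. (norm x)\<^sup>2 \<le> B x \<bullet> x"
  obtains R where "hermitian R" "\<And>x. B (R x) = x" "\<And>x. R (B x) = x"
    "\<And>x. 0 \<le> R x \<bullet> x" "\<And>x. R x \<bullet> x \<le> (norm x)\<^sup>2"
proof -
  have le: "norm x \<le> norm (B x)" for x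
  proof (cases "x = 0")
    case False
    have "(norm x)\<^sup>2 \<le> norm (B x) * norm x"
      using ge[of x] norm_cauchy_schwarz[of "B x" x] by linarith
    then show ?thesis using False by (simp add: power2_eq_square)
  qed simp
  have inj: "x = y" if "B x = B y" for x y
    using le[of "x - y"] that by (simp add: blinfun.bilinear_simps)
  have "complete (range B)"
    by (rule complete_isometric_image[where e=1])
       (auto intro: le blinfun.bounded_linear_right simp: complete_UNIV)
  then have cl: "closed (range B)" by (rule complete_imp_closed)
  have sub: "subspace (range B)"
    by (intro linear_subspace_image bounded_linear.linear blinfun.bounded_linear_right subspace_UNIV)
  have "\<exists>x. B x = y" for y
  proof -
    obtain z where z: "z \<in> range B" "\<And>w. w \<in> range B \<Longrightarrow> (y - z) \<bullet> w = 0"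
      by (rule orthogonal_decomposition[OF sub cl, of y]) blast
    have "(y - z) \<bullet> B (y - z) = 0" using z(2) by blast
    then have "y - z = 0" using ge[of "y - z"] by (simp add: inner_commute)
    then show ?thesis using z(1) by auto
  qed
  then obtain r where r: "\<And>y. B (r y) = y" by metis
  have rB: "r (B x) = x" for x by (rule inj) (simp add: r)
  have bl: "bounded_linear r"
  proof (rule bounded_linear_intro[where K=1])
    show "r (x + y) = r x + r y" for x y by (rule inj) (simp add: r blinfun.bilinear_simps)
    show "r (a *\<^sub>R x) = a *\<^sub>R r x" for a x by (rule inj) (simp add: r blinfun.bilinear_simps)
    show "norm (r x) \<le> norm x * 1" for x using le[of "r x"] by (simp add: r)
  qed
  define R where "R = Blinfun r"
  have R: "R x = r x" for x by (simp add: R_def bounded_linear_Blinfun_apply bl)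
  have "R \<in> bounded_ops"
    unfolding bounded_ops_iff R
  proof
    show "r (\<i> *\<^sub>C x) = \<i> *\<^sub>C r x" for x
      by (rule inj) (use B in \<open>simp add: r hermitian_def bounded_ops_iff\<close>)
  qed
  moreover have "r x \<bullet> y = x \<bullet> r y" for x y
    using hermitianD[OF B, of "r x" "r y"] by (simp add: r)
  ultimately have h: "hermitian R" by (simp add: hermitian_def R)
  have "(norm (r x))\<^sup>2 \<le> r x \<bullet> x" for x
    using ge[of "r x"] by (simp add: r inner_commute)
  moreover have "r x \<bullet> x \<le> (norm x)\<^sup>2" for x
  proof -
    have "norm (r x) * norm x \<le> norm x * norm x" using le[of "r x"] by (intro mult_right_mono) (auto simp: r)
    then show ?thesis using norm_cauchy_schwarz[of "r x" x] by (simp add: power2_eq_square)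
  qed
  ultimately show ?thesis
    using that[OF h] by (simp add: R r rB) (meson order_trans zero_le_power2)
qed

lemma pointwise_limit_operator:
  fixes A :: "nat \<Rightarrow> 'h::complex_hilbert_space \<Rightarrow>\<^sub>L 'h"
  assumes A: "\<And>n. A n \<in> bounded_ops" and bnd: "\<And>n. norm (A n) \<le> c"
    and conv: "\<And>x. convergent (\<lambda>n. A n x)"
  obtains L where "L \<in> bounded_ops" "norm L \<le> c" "\<And>x. (\<lambda>n. A n x) \<longlonglongrightarrow> L x"
proof -
  obtain l where l: "\<And>x. (\<lambda>n. A n x) \<longlonglongrightarrow> l x" using conv unfolding convergent_def by metis
  have c0: "0 \<le> c" using bnd[of 0] norm_ge_zero order_trans by blast
  have le: "norm (l x) \<le> c * norm x" for x
  proof (rule LIMSEQ_le_const2[OF tendsto_norm[OF l]])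
    show "\<exists>N. \<forall>n\<ge>N. norm (A n x) \<le> c * norm x"
      using norm_blinfun[of "A _" x] bnd by (meson mult_right_mono norm_ge_zero order_trans)
  qed
  have bl: "bounded_linear l"
  proof (rule bounded_linear_intro[where K=c])
    show "l (x + y) = l x + l y" for x y
      by (rule LIMSEQ_unique[OF l]) (simp add: blinfun.bilinear_simps tendsto_add l)
    show "l (r *\<^sub>R x) = r *\<^sub>R l x" for r x
      by (rule LIMSEQ_unique[OF l]) (simp add: blinfun.bilinear_simps tendsto_scaleR l)
    show "norm (l x) \<le> norm x * c" for x using le[of x] by (simp add: mult.commute)
  qed
  define L where "L = Blinfun l"
  have L: "L x = l x" for x by (simp add: L_def bounded_linear_Blinfun_apply bl)
  have "L \<in> bounded_ops"
    unfolding bounded_ops_iff L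
  proof
    fix x
    show "l (\<i> *\<^sub>C x) = \<i> *\<^sub>C l x"
    proof (rule LIMSEQ_unique[OF l])
      show "(\<lambda>n. A n (\<i> *\<^sub>C x)) \<longlonglongrightarrow> \<i> *\<^sub>C l x"
        using A bounded_linear.tendsto[OF bounded_linear_scaleC l] by (simp add: bounded_ops_iff)
    qed
  qed
  moreover have "norm L \<le> c" by (rule norm_blinfun_bound[OF c0]) (simp add: L le)
  ultimately show ?thesis using that l L by simp
qed

lemma hermitian_limit:
  assumes "\<And>n. hermitian (A n)" "L \<in> bounded_ops" "\<And>x. (\<lambda>n. blinfun_apply (A n) x) \<longlonglongrightarrow> L x"
  shows "hermitian L"
  unfolding hermitian_def
proof (intro conjI allI assms)
  fix x y
  have "(\<lambda>n. A n x \<bullet> y) \<longlonglongrightarrow> L x \<bullet> y" "(\<lambda>n. x \<bullet> A n y) \<longlonglongrightarrow> x \<bullet> L y"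
    by (intro tendsto_intros assms)+
  then show "L x \<bullet> y = x \<bullet> L y"
    using hermitianD[OF assms(1)] LIMSEQ_unique by simp
qed

lemma projection_op_limit:
  assumes P: "\<And>n. projection_op (P n)" and L: "L \<in> bounded_ops"
    and lim: "\<And>x. (\<lambda>n. blinfun_apply (P n) x) \<longlonglongrightarrow> L x"
  shows "projection_op L"
proof (rule projection_opI)
  show h: "hermitian L"
    by (rule hermitian_limit[OF projection_op_hermitian[OF P] L lim])
  have "L o\<^sub>L L = L"
  proof (rule hermitian_eqI)
    fix x
    have "(\<lambda>n. P n x \<bullet> P n x) \<longlonglongrightarrow> L x \<bullet> L x" by (intro tendsto_inner lim)
    moreover have "(\<lambda>n. P n x \<bullet> x) \<longlonglongrightarrow> L x \<bullet> x" by (intro tendsto_intros lim)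
    moreover have "P n x \<bullet> P n x = P n x \<bullet> x" for n
      by (simp add: projection_op_inner[OF P] power2_norm_eq_inner)
    ultimately have "L x \<bullet> L x = L x \<bullet> x" using LIMSEQ_unique by simp
    then show "(L o\<^sub>L L) x \<bullet> x = L x \<bullet> x" by (simp add: hermitianD[OF h, of "L x"])
  qed (use h in auto)
  then show "L (L x) = L x" for x by (metis blinfun_apply_blinfun_compose)
qed

lemma commute_limit:
  assumes "\<And>n. A n o\<^sub>L B = B o\<^sub>L A n" "\<And>x. (\<lambda>n. blinfun_apply (A n) x) \<longlonglongrightarrow> blinfun_apply L x"
  shows "L o\<^sub>L B = B o\<^sub>L L"
proof (rule blinfun_eqI)
  fix x
  have "A n (B x) = B (A n x)" for n using assms(1) by (metis blinfun_apply_blinfun_compose)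
  then have "(\<lambda>n. B (A n x)) \<longlonglongrightarrow> L (B x)" using assms(2)[of "B x"] by simp
  moreover have "(\<lambda>n. B (A n x)) \<longlonglongrightarrow> B (L x)" by (intro blinfun.tendsto tendsto_const assms)
  ultimately show "(L o\<^sub>L B) x = (B o\<^sub>L L) x" using LIMSEQ_unique by simp
qed

text \<open>
  The quadratic forms converge, being monotone and bounded; the differences lie between \<open>0\<close> and \<open>1\<close>, so
  \<open>|(A\<^sub>m - A\<^sub>n) x|\<^sup>2\<close> is at most the increment of the form at \<open>x\<close>.
\<close>

lemma increasing_operator_limit:
  fixes A :: "nat \<Rightarrow> 'h::complex_hilbert_space \<Rightarrow>\<^sub>L 'h"
  assumes A: "\<And>n. hermitian (A n)" and nonneg: "\<And>n x. 0 \<le> A n x \<bullet> x"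
    and le1: "\<And>n x. A n x \<bullet> x \<le> (norm x)\<^sup>2"
    and mono: "\<And>m n x. m \<le> n \<Longrightarrow> A m x \<bullet> x \<le> A n x \<bullet> x"
  obtains L where "hermitian L" "\<And>x. (\<lambda>n. A n x) \<longlonglongrightarrow> L x"
    "\<And>x. (\<lambda>n. A n x \<bullet> x) \<longlonglongrightarrow> L x \<bullet> x" "\<And>n x. A n x \<bullet> x \<le> L x \<bullet> x"
    "\<And>x. L x \<bullet> x \<le> (norm x)\<^sup>2"
proof -
  have inner_conv: "convergent (\<lambda>n. A n x \<bullet> x)" for x
  proof (rule Bseq_mono_convergent)
    show "Bseq (\<lambda>n. A n x \<bullet> x)"
      by (rule BseqI'[where K="(norm x)\<^sup>2"]) (simp add: nonneg le1)
    show "\<forall>m. \<forall>n\<ge>m. A m x \<bullet> x \<le> A n x \<bullet> x"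
      by (intro allI impI mono)
  qed
  have diff: "(norm (A m x - A n x))\<^sup>2 \<le> A m x \<bullet> x - A n x \<bullet> x" if "n \<le> m" for m n x
  proof -
    have "(norm ((A m - A n) x))\<^sup>2 \<le> 1 * ((A m - A n) x \<bullet> x)"
    proof (rule positive_norm_bound)
      show "hermitian (A m - A n)" using A by auto
      show "0 \<le> (A m - A n) y \<bullet> y" for y
        using mono[OF that] by (simp add: blinfun.diff_left inner_diff_left)
      show "(A m - A n) y \<bullet> y \<le> 1 * (norm y)\<^sup>2" for y
        using nonneg[of n y] le1[of m y] by (simp add: blinfun.diff_left inner_diff_left)
    qed simp
    then show ?thesis by (simp add: blinfun.diff_left inner_diff_left)
  qed
  have conv: "convergent (\<lambda>n. A n x)" for x
  proof (rule Cauchy_convergent, rule CauchyI)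
    fix e :: real assume e: "e > 0"
    have "0 < e\<^sup>2" using e by simp
    from CauchyD[OF convergent_Cauchy[OF inner_conv[of x]] this]
    obtain N where N: "\<forall>m\<ge>N. \<forall>n\<ge>N. norm (A m x \<bullet> x - A n x \<bullet> x) < e\<^sup>2" ..
    have *: "norm (A m x - A n x) < e" if "m \<ge> N" "n \<ge> N" "n \<le> m" for m n
    proof -
      have "(norm (A m x - A n x))\<^sup>2 < e\<^sup>2" 
        using diff[OF that(3), of x] N[rule_format, OF that(1,2)] unfolding real_norm_def by linarith
      then show ?thesis by (rule power2_less_imp_less) (use e in simp)
    qed
    have "norm (A m x - A n x) < e" if "m \<ge> N" "n \<ge> N" for m n
    proof (cases "n \<le> m")
      case False
      then have "norm (A n x - A m x) < e" using *[of n m] that by simp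
      then show ?thesis by (simp add: norm_minus_commute)
    qed (use *[of m n] that in simp)
    then show "\<exists>N. \<forall>m\<ge>N. \<forall>n\<ge>N. norm (A m x - A n x) < e" by blast
  qed
  have norm1: "norm (A n) \<le> 1" for n
  proof (rule norm_blinfun_bound)
    fix x
    have "(norm (A n x))\<^sup>2 \<le> 1 * (A n x \<bullet> x)"
      by (rule positive_norm_bound) (simp_all add: A nonneg le1)
    then have "(norm (A n x))\<^sup>2 \<le> (norm x)\<^sup>2" using le1[of n x] by linarith
    then have "norm (A n x) \<le> norm x" by (rule power2_le_imp_le) simp
    then show "norm (A n x) \<le> 1 * norm x" by simp
  qed simp
  have b: "A n \<in> bounded_ops" for n using A by auto
  obtain L where L: "L \<in> bounded_ops" "\<And>x. (\<lambda>n. A n x) \<longlonglongrightarrow> L x"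
    by (rule pointwise_limit_operator[of A 1, OF b norm1 conv]) blast
  have lim: "(\<lambda>n. A n x \<bullet> x) \<longlonglongrightarrow> L x \<bullet> x" for x by (intro tendsto_intros L)
  show ?thesis
  proof (rule that[OF hermitian_limit[OF A L] L(2) lim])
    show "A n x \<bullet> x \<le> L x \<bullet> x" for n x
      by (rule LIMSEQ_le_const[OF lim]) (intro exI[of _ n] allI impI mono)
    show "L x \<bullet> x \<le> (norm x)\<^sup>2" for x
      by (rule LIMSEQ_le_const2[OF lim]) (intro exI allI impI le1)
  qed
qed

text \<open>
  Let \<open>r\<^sub>n\<close> be the inverse of \<open>1 + S\<^sub>n\<close> with \<open>S\<^sub>n = \<Sum>k<n. Z\<^sub>k\<^sup>2\<close>. Inversion reverses the order, so \<open>r\<^sub>n\<close>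
  decreases to an operator \<open>R\<close>. Since \<open>\<langle>S\<^sub>n r\<^sub>n x, r\<^sub>n x\<rangle> \<le> \<langle>x, r\<^sub>n x\<rangle> \<le> |x|\<^sup>2\<close>, all \<open>Z\<^sub>k\<close> are uniformly bounded
  on the range of \<open>R\<close>: \<open>R\<close> selects the vectors on which the whole sequence is under control. The last two
  conclusions say \<open>1 - r\<^sub>n \<le> S\<^sub>n\<close> and that \<open>r\<^sub>n\<close> commutes with whatever commutes with all \<open>Z\<^sub>k\<close>. The operator
  is used twice, with powers of a fixed operator and with the increments of a Cauchy sequence.
\<close>

lemma regularizing_operator:
  fixes Z :: "nat \<Rightarrow> 'h::complex_hilbert_space \<Rightarrow>\<^sub>L 'h"
  assumes Z: "\<And>k. hermitian (Z k)"
  obtains R r where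
    "hermitian R" "\<And>n. hermitian (r n)" "\<And>x. (\<lambda>n. r n x) \<longlonglongrightarrow> R x"
    "\<And>n x. r n x + (\<Sum>k<n. Z k (Z k (r n x))) = x"
    "\<And>n x. 0 \<le> r n x \<bullet> x" "\<And>n x. r n x \<bullet> x \<le> (norm x)\<^sup>2"
    "\<And>m n x. m \<le> n \<Longrightarrow> r n x \<bullet> x \<le> r m x \<bullet> x"
    "\<And>k x. norm (Z k (R x)) \<le> norm x"
    "\<And>n x. (norm x)\<^sup>2 - (\<Sum>k<n. (norm (Z k x))\<^sup>2) \<le> r n x \<bullet> x"
    "\<And>B n. (\<And>k. Z k o\<^sub>L B = B o\<^sub>L Z k) \<Longrightarrow> r n o\<^sub>L B = B o\<^sub>L r n"
proof -
  define S where "S n = (\<Sum>k<n. Z k o\<^sub>L Z k)" for n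
  define B where "B n = id_blinfun + S n" for n
  have Sh: "hermitian (S n)" for n unfolding S_def using Z by (intro hermitian_sum) auto
  then have Bh: "hermitian (B n)" for n unfolding B_def by auto
  have Sx: "S n x = (\<Sum>k<n. Z k (Z k x))" for n x by (simp add: S_def blinfun.sum_left)
  have Sin: "S n x \<bullet> x = (\<Sum>k<n. (norm (Z k x))\<^sup>2)" for n x
    by (simp add: Sx inner_sum_left hermitianD[OF Z] power2_norm_eq_inner)
  have Bge: "(norm x)\<^sup>2 \<le> B n x \<bullet> x" for n x
    unfolding B_def by (simp add: blinfun.bilinear_simps inner_add_left Sin power2_norm_eq_inner sum_nonneg)
  have "\<exists>R. hermitian R \<and> (\<forall>x. B n (R x) = x) \<and> (\<forall>x. R (B n x) = x) \<and> (\<forall>x. 0 \<le> R x \<bullet> x) \<and>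
    (\<forall>x. R x \<bullet> x \<le> (norm x)\<^sup>2)" for n
    by (rule inverse_of_ge_id[OF Bh[of n] Bge]) blast
  then obtain r where rh: "\<And>n. hermitian (r n)" and Br: "\<And>n x. B n (r n x) = x"
    and rB: "\<And>n x. r n (B n x) = x" and r0: "\<And>n x. 0 \<le> r n x \<bullet> x"
    and r1: "\<And>n x. r n x \<bullet> x \<le> (norm x)\<^sup>2" by metis
  have BS: "B n x = x + S n x" for n x by (simp add: B_def blinfun.add_left)
  have Smono: "S m x \<bullet> x \<le> S n x \<bullet> x" if "m \<le> n" for m n x
    unfolding Sin using that by (intro sum_mono2) auto
  have rmono: "r n x \<bullet> x \<le> r m x \<bullet> x" if "m \<le> n" for m n x
  proof -
    \<comment> \<open>inversion reverses the order: Cauchy-Schwarz for the form of \<open>1 + S\<^sub>m\<close>\<close>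
    have "(r n x \<bullet> x)\<^sup>2 = (B m (r m x) \<bullet> r n x)\<^sup>2" by (simp add: Br inner_commute)
    also have "\<dots> \<le> (B m (r m x) \<bullet> r m x) * (B m (r n x) \<bullet> r n x)"
      by (rule positive_Cauchy_Schwarz[OF Bh]) (meson Bge order_trans zero_le_power2)
    also have "\<dots> \<le> (B m (r m x) \<bullet> r m x) * (B n (r n x) \<bullet> r n x)"
    proof (rule mult_left_mono)
      show "B m (r n x) \<bullet> r n x \<le> B n (r n x) \<bullet> r n x"
        using Smono[OF that] by (simp add: BS inner_add_left)
    qed (metis Br r0 inner_commute)
    also have "\<dots> = (r m x \<bullet> x) * (r n x \<bullet> x)" by (simp add: Br inner_commute)
    finally have "(r n x \<bullet> x) * (r n x \<bullet> x) \<le> (r m x \<bullet> x) * (r n x \<bullet> x)"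
      by (simp add: power2_eq_square)
    then show ?thesis using r0[of n x] r0[of m x]
      by (cases "r n x \<bullet> x = 0") (auto simp: mult_le_cancel_right)
  qed
  obtain L where L: "hermitian L" "\<And>x. (\<lambda>n. (id_blinfun - r n) x) \<longlonglongrightarrow> L x"
  proof (rule increasing_operator_limit[of "\<lambda>n. id_blinfun - r n"])
    show "hermitian (id_blinfun - r n)" for n using rh by auto
  qed (use r0 r1 rmono in \<open>auto simp: blinfun.diff_left inner_diff_left power2_norm_eq_inner\<close>)
  define R where "R = id_blinfun - L"
  have lim: "(\<lambda>n. r n x) \<longlonglongrightarrow> R x" for x
    using tendsto_diff[OF tendsto_const[of x] L(2)[of x]] by (simp add: R_def blinfun.diff_left)
  have Zr: "norm (Z k (r n x)) \<le> norm x" if "k < n" for k n x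
  proof -
    have "(norm (Z k (r n x)))\<^sup>2 \<le> S n (r n x) \<bullet> r n x"
      unfolding Sin using that by (intro member_le_sum) auto
    also have "\<dots> \<le> B n (r n x) \<bullet> r n x" by (simp add: BS inner_add_left)
    also have "\<dots> \<le> (norm x)\<^sup>2" using r1[of n x] by (simp add: Br inner_commute)
    finally show ?thesis by (rule power2_le_imp_le) simp
  qed
  show ?thesis
  proof (rule that)
    show "hermitian R" unfolding R_def using L by auto
    show "norm (Z k (R x)) \<le> norm x" for k x
    proof (rule LIMSEQ_le_const2)
      show "(\<lambda>n. norm (Z k (r n x))) \<longlonglongrightarrow> norm (Z k (R x))"
        by (intro tendsto_norm blinfun.tendsto tendsto_const lim)
      show "\<exists>N. \<forall>n\<ge>N. norm (Z k (r n x)) \<le> norm x" using Zr by (metis Suc_le_lessD)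
    qed
    show "(norm x)\<^sup>2 - (\<Sum>k<n. (norm (Z k x))\<^sup>2) \<le> r n x \<bullet> x" for n x
    proof -
      define y where "y = r n x"
      have x: "x = y + S n y" using Br[of n x] by (simp add: y_def BS)
      have "S n x \<bullet> x = S n y \<bullet> x + S n (S n y) \<bullet> x" by (subst x) (simp add: blinfun.add_right inner_add_left)
      also have "S n (S n y) \<bullet> x = S n y \<bullet> S n y + S n (S n y) \<bullet> S n y"
      proof -
        have "S n (S n y) \<bullet> (y + S n y) = S n y \<bullet> S n y + S n (S n y) \<bullet> S n y"
          using hermitianD[OF Sh, of n "S n y" y] by (simp add: inner_add_right)
        then show ?thesis by (simp only: x[symmetric])
      qed
      finally have "S n x \<bullet> x \<ge> S n y \<bullet> x" by (simp add: Sin sum_nonneg)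
      moreover have "x \<bullet> x = y \<bullet> x + S n y \<bullet> x" by (subst (1) x) (simp add: inner_add_left)
      ultimately show ?thesis
        unfolding Sin[symmetric] power2_norm_eq_inner[of x] by (simp add: y_def)
    qed
    show "r n o\<^sub>L C = C o\<^sub>L r n" if "\<And>k. Z k o\<^sub>L C = C o\<^sub>L Z k" for C n
    proof (rule blinfun_eqI)
      fix x
      have c: "Z k (C y) = C (Z k y)" for k y using that by (metis blinfun_apply_blinfun_compose)
      have "B n (C y) = C (B n y)" for y by (simp add: BS Sx c blinfun.bilinear_simps)
      then have "r n (C x) = C (r n x)" by (metis Br rB)
      then show "(r n o\<^sub>L C) x = (C o\<^sub>L r n) x" by simp
    qed
    show "r n x + (\<Sum>k<n. Z k (Z k (r n x))) = x" for n x using Br[of n x] by (simp add: BS Sx)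
  qed (use rh lim r0 r1 rmono in auto)
qed

section \<open>Half-line projections: existence and uniqueness\<close>

text \<open>
  In a log-convex sequence the ratio of successive terms increases, so a ratio above \<open>1\<close> forces exponential
  growth.
\<close>

lemma log_convex_growth:
  fixes a :: "nat \<Rightarrow> real"
  assumes nonneg: "\<And>n. 0 \<le> a n" and conv: "\<And>n. (a (Suc n))\<^sup>2 \<le> a n * a (Suc (Suc n))"
    and bnd: "\<And>n. a n \<le> K"
  shows "a (Suc 0) \<le> a 0"
proof (rule ccontr)
  assume "\<not> a (Suc 0) \<le> a 0"
  then have less: "a 0 < a (Suc 0)" by simp
  have "a 0 \<noteq> 0"
  proof
    assume "a 0 = 0"
    then have "(a (Suc 0))\<^sup>2 \<le> 0" using conv[of 0] by simp
    then show False using less \<open>a 0 = 0\<close> by simp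
  qed
  then have a0: "0 < a 0" using nonneg[of 0] by simp
  define \<rho> where "\<rho> = a (Suc 0) / a 0"
  have \<rho>: "1 < \<rho>" using less a0 by (simp add: \<rho>_def)
  have step: "0 < a n \<and> \<rho> * a n \<le> a (Suc n)" for n
  proof (induction n)
    case 0
    then show ?case using a0 by (simp add: \<rho>_def)
  next
    case (Suc n)
    have pos: "0 < a (Suc n)"
      using Suc \<rho> by (meson less_le_trans mult_pos_pos zero_less_one order.strict_trans)
    have "(\<rho> * a n) * a (Suc n) \<le> a (Suc n) * a (Suc n)"
      using Suc pos by (intro mult_right_mono) auto
    also have "\<dots> \<le> a n * a (Suc (Suc n))" using conv[of n] by (simp add: power2_eq_square)
    finally have "a n * (\<rho> * a (Suc n)) \<le> a n * a (Suc (Suc n))" by (simp add: algebra_simps)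
    then show ?case using Suc pos by simp
  qed
  have grow: "\<rho> ^ n * a 0 \<le> a n" for n
  proof (induction n)
    case (Suc n)
    have "\<rho> ^ Suc n * a 0 = \<rho> * (\<rho> ^ n * a 0)" by simp
    also have "\<dots> \<le> \<rho> * a n" using Suc \<rho> by (intro mult_left_mono) auto
    also have "\<dots> \<le> a (Suc n)" using step by blast
    finally show ?case .
  qed simp
  obtain n where "K / a 0 < \<rho> ^ n" using real_arch_pow[OF \<rho>] by blast
  then have "K < \<rho> ^ n * a 0" using a0 by (simp add: field_simps)
  then show False using grow[of n] bnd[of n] by simp
qed

primrec op_power :: "('h::complex_hilbert_space \<Rightarrow>\<^sub>L 'h) \<Rightarrow> nat \<Rightarrow> 'h \<Rightarrow>\<^sub>L 'h" where
  "op_power A 0 = id_blinfun"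
| "op_power A (Suc n) = A o\<^sub>L op_power A n"

lemma op_power_add: "op_power A (m + n) x = op_power A m (op_power A n x)"
  by (induction m) auto

lemma op_power_commute:
  assumes "A o\<^sub>L B = B o\<^sub>L A"
  shows "op_power A n o\<^sub>L B = B o\<^sub>L op_power A n"
proof (rule blinfun_eqI)
  fix x
  have AB: "A (B y) = B (A y)" for y using assms by (metis blinfun_apply_blinfun_compose)
  have "op_power A n (B y) = B (op_power A n y)" for y by (induction n) (simp_all add: AB)
  then show "(op_power A n o\<^sub>L B) x = (B o\<^sub>L op_power A n) x" by simp
qed

lemma hermitian_op_power: "hermitian A \<Longrightarrow> hermitian (op_power A n)"
  by (induction n) (auto intro: hermitian_compose op_power_commute[symmetric])

text \<open>
  The norms \<open>|A\<^sup>n x|\<close> are log-convex because \<open>|A y|\<^sup>2 = \<langle>y, A\<^sup>2 y\<rangle>\<close>. So a bounded orbit is automatically bounded by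
  the norm of its starting vector. This makes the set of vectors with bounded orbit both a subspace (bounds
  may be any constant) and closed (the bound may be taken to be \<open>|x|\<close>).
\<close>

lemma op_power_log_convex:
  assumes "hermitian A" "\<And>n. norm (op_power A n x) \<le> K"
  shows "norm (op_power A n x) \<le> norm x"
proof (induction n)
  case (Suc n)
  have "norm (op_power A (Suc 0 + n) x) \<le> norm (op_power A (0 + n) x)"
  proof (rule log_convex_growth[of "\<lambda>k. norm (op_power A (k + n) x)"])
    fix k
    let ?y = "op_power A (k + n) x"
    have "(norm (A ?y))\<^sup>2 = ?y \<bullet> A (A ?y)"
      using hermitianD[OF assms(1), of ?y "A ?y"] by (simp add: power2_norm_eq_inner)
    also have "\<dots> \<le> norm ?y * norm (A (A ?y))" by (rule norm_cauchy_schwarz)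
    finally show "(norm (op_power A (Suc k + n) x))\<^sup>2
      \<le> norm (op_power A (k + n) x) * norm (op_power A (Suc (Suc k) + n) x)" by simp
  qed (use assms in auto)
  then show ?case using Suc by simp
qed simp

text \<open>
  If the infimum \<open>m\<close> of the quadratic form over unit vectors were below \<open>1\<close>, almost minimizing vectors \<open>y\<close>
  would be approximate eigenvectors, \<open>C y \<approx> m y\<close>, contradicting \<open>|C y| \<ge> 1\<close>.
\<close>

lemma expanding_imp_ge_id:
  fixes C :: "'h::complex_hilbert_space \<Rightarrow>\<^sub>L 'h"
  assumes C: "hermitian C" "\<And>x. 0 \<le> C x \<bullet> x" and ex: "\<And>x. norm x \<le> norm (C x)"
  shows "(norm x)\<^sup>2 \<le> C x \<bullet> x"
proof (rule ccontr)
  assume neg: "\<not> (norm x)\<^sup>2 \<le> C x \<bullet> x"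
  define V where "V = (\<lambda>y. C y \<bullet> y) ` {y. norm y = 1}"
  define m where "m = Inf V"
  have unit: "C y \<bullet> y = (norm y)\<^sup>2 * (C (y /\<^sub>R norm y) \<bullet> (y /\<^sub>R norm y))" if "y \<noteq> 0" for y
    using that by (simp add: blinfun.scaleR_right field_simps power2_eq_square)
  have inV: "C (y /\<^sub>R norm y) \<bullet> (y /\<^sub>R norm y) \<in> V" if "y \<noteq> 0" for y
    using that unfolding V_def by (intro imageI) simp
  have x0: "x \<noteq> 0" using neg by auto
  have ne: "V \<noteq> {}" using inV[OF x0] by blast
  have bdd: "bdd_below V" by (rule bdd_belowI[of _ 0]) (use C in \<open>auto simp: V_def\<close>)
  have m0: "0 \<le> m" unfolding m_def by (rule cInf_greatest[OF ne]) (use C in \<open>auto simp: V_def\<close>)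
  have mle: "m \<le> v" if "v \<in> V" for v unfolding m_def by (rule cInf_lower[OF that bdd])
  have mx: "m * (norm y)\<^sup>2 \<le> C y \<bullet> y" for y
  proof (cases "y = 0")
    case False
    then show ?thesis using mle[OF inV[OF False]] unit[OF False]
      by (metis mult.commute mult_left_mono zero_le_power2)
  qed simp
  have m1: "m < 1"
  proof -
    have "m * (norm x)\<^sup>2 < 1 * (norm x)\<^sup>2" using mx[of x] neg by simp
    then show ?thesis using x0 by (simp add: mult_less_cancel_right)
  qed
  define b where "b = norm C + m"
  \<comment> \<open>so that \<open>b e < (1 - m)\<^sup>2\<close>, also when \<open>b = 0\<close>\<close>
  define e where "e = (1 - m)\<^sup>2 / (b + 1)"
  have b0: "0 \<le> b" using m0 by (simp add: b_def)
  have e0: "0 < e" using b0 m1 by (simp add: e_def)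
  obtain v where "v \<in> V" "v < m + e"
    using cInf_lessD[OF ne, of "m + e"] e0 unfolding m_def by auto
  then obtain y where y: "norm y = 1" "C y \<bullet> y < m + e" by (auto simp: V_def)
  define D where "D = C - m *\<^sub>R id_blinfun"
  have Dy: "D z = C z - m *\<^sub>R z" for z by (simp add: D_def blinfun.bilinear_simps)
  have "(norm (D y))\<^sup>2 \<le> b * (D y \<bullet> y)"
  proof (rule positive_norm_bound[OF _ _ _ b0])
    show "hermitian D" unfolding D_def using C by auto
    show "0 \<le> D z \<bullet> z" for z using mx[of z] by (simp add: Dy inner_diff_left power2_norm_eq_inner)
    show "D z \<bullet> z \<le> b * (norm z)\<^sup>2" for z
    proof -
      have "0 \<le> m * (norm z)\<^sup>2" using m0 by simp
      moreover have "D z \<bullet> z = C z \<bullet> z - m * (norm z)\<^sup>2"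
        by (simp add: Dy inner_diff_left power2_norm_eq_inner)
      ultimately show ?thesis
        using inner_le_norm_blinfun[of C z] unfolding b_def distrib_right by linarith
    qed
  qed
  also have "\<dots> \<le> b * e"
    using y b0 by (intro mult_left_mono) (auto simp: Dy inner_diff_left simp flip: power2_norm_eq_inner)
  also have "\<dots> < (b + 1) * e" using e0 by simp
  also have "\<dots> = (1 - m)\<^sup>2" using b0 by (simp add: e_def)
  finally have "norm (D y) < 1 - m" by (rule power2_less_imp_less) (use m1 in simp)
  moreover have "norm (C y) \<le> norm (D y) + norm (m *\<^sub>R y)"
    using norm_triangle_ineq[of "D y" "m *\<^sub>R y"] by (simp add: Dy)
  ultimately show False using ex[of y] y m0 by simp
qed

text \<open>
  \<open>P\<close> is the spectral projection of \<open>N\<close> for the open half-line above \<open>t\<close>, described through the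
  quadratic form of \<open>N\<close> alone. The strict inequality on the range assigns a possible eigenspace for \<open>t\<close> to the kernel, which makes
  \<open>P\<close> unique.
\<close>

definition spectral_cut ::
  "('h::complex_hilbert_space \<Rightarrow>\<^sub>L 'h) \<Rightarrow> real \<Rightarrow> ('h \<Rightarrow>\<^sub>L 'h) \<Rightarrow> bool" where
  "spectral_cut N t P \<longleftrightarrow> projection_op P \<and> P o\<^sub>L N = N o\<^sub>L P \<and>
     (\<forall>x. P x = 0 \<longrightarrow> N x \<bullet> x \<le> t * (norm x)\<^sup>2) \<and>
     (\<forall>x. P x = x \<longrightarrow> x \<noteq> 0 \<longrightarrow> t * (norm x)\<^sup>2 < N x \<bullet> x)"

text \<open>
  A vector in the range of \<open>P\<close> and in the kernel of \<open>Q\<close> would satisfy \<open>t |y|\<^sup>2 < \<langle>N y, y\<rangle> \<le> s |y|\<^sup>2\<close>.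
\<close>

lemma spectral_cut_mono:
  assumes P: "spectral_cut N t P" and Q: "spectral_cut N s Q" and "s \<le> t"
    and comm: "P o\<^sub>L Q = Q o\<^sub>L P"
  shows "Q (P x) = P x"
proof (rule ccontr)
  assume ne: "Q (P x) \<noteq> P x"
  define y where "y = P x - Q (P x)"
  have c: "P (Q z) = Q (P z)" for z using comm by (metis blinfun_apply_blinfun_compose)
  have iP: "P (P z) = P z" and iQ: "Q (Q z) = Q z" for z
    using P Q by (auto simp: spectral_cut_def projection_op_idem)
  have "P y = y" "Q y = 0" "y \<noteq> 0" using ne by (auto simp: y_def blinfun.diff_right c iP iQ)
  then have "t * (norm y)\<^sup>2 < N y \<bullet> y" "N y \<bullet> y \<le> s * (norm y)\<^sup>2"
    using P Q unfolding spectral_cut_def by blast+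
  then show False using mult_right_mono[OF \<open>s \<le> t\<close>, of "(norm y)\<^sup>2"] by simp
qed

text \<open>
  Let \<open>H\<close> be the closed subspace of vectors with bounded orbit under the powers of \<open>C\<close>. On \<open>H\<close> the operator
  is contracting. On the orthogonal complement of \<open>H\<close> the regularizing operator for the powers of \<open>C\<close> vanishes,
  because its range lies in \<open>H\<close>; the telescoping identity for the partial sums of the even powers then turns
  this into \<open>|x| \<le> |C x|\<close>. As \<open>H\<close> is invariant under everything that commutes with \<open>C\<close>, so is the projection.
\<close>

lemma contraction_cut:
  fixes C :: "'h::complex_hilbert_space \<Rightarrow>\<^sub>L 'h"
  assumes C: "hermitian C" "\<And>x. 0 \<le> C x \<bullet> x"
  obtains P where "spectral_cut C 1 P"
    "\<And>B. B \<in> bounded_ops \<Longrightarrow> C o\<^sub>L B = B o\<^sub>L C \<Longrightarrow> C o\<^sub>L adj B = adj B o\<^sub>L C \<Longrightarrow> P o\<^sub>L B = B o\<^sub>L P"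
proof -
  define H where "H = {x. \<forall>n. norm (op_power C n x) \<le> norm x}"
  have HI: "x \<in> H" if "\<And>n. norm (op_power C n x) \<le> K" for x K
    unfolding H_def using op_power_log_convex[OF C(1) that] by simp
  have HD: "norm (op_power C n x) \<le> norm x" if "x \<in> H" for x n
    using that unfolding H_def by simp
  have closedH: "closed H"
    unfolding H_def Collect_all_eq
    by (intro closed_INT ballI closed_Collect_le continuous_intros)
  have sub: "subspace H"
  proof (rule subspaceI)
    show "0 \<in> H" by (simp add: H_def)
  next
    fix x y assume xy: "x \<in> H" "y \<in> H"
    show "x + y \<in> H"
    proof (rule HI)
      fix n
      have "norm (op_power C n (x + y)) \<le> norm (op_power C n x) + norm (op_power C n y)"
        by (simp add: blinfun.add_right norm_triangle_ineq)
      then show "norm (op_power C n (x + y)) \<le> norm x + norm y"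
        using HD[OF xy(1), of n] HD[OF xy(2), of n] by linarith
    qed
  next
    fix c x assume "x \<in> H"
    then show "c *\<^sub>R x \<in> H" by (simp add: H_def blinfun.scaleR_right mult_left_mono)
  qed
  have pb: "op_power C n \<in> bounded_ops" for n using hermitian_op_power[OF C(1)] by auto
  have iH: "\<i> *\<^sub>C x \<in> H" if "x \<in> H" for x
    using that pb by (simp add: H_def bounded_ops_iff)
  obtain Q where Q: "projection_op Q" and QH: "\<And>x. Q x = x \<longleftrightarrow> x \<in> H"
    by (rule closed_complex_subspace_projection[OF sub closedH]) (erule iH, rule that, auto)
  have invH: "B x \<in> H" if "C o\<^sub>L B = B o\<^sub>L C" "x \<in> H" for B x
  proof (rule HI)
    fix n
    have "op_power C n (B x) = B (op_power C n x)"
      using op_power_commute[OF that(1), of n] by (metis blinfun_apply_blinfun_compose)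
    then have "norm (op_power C n (B x)) \<le> norm B * norm (op_power C n x)"
      by (simp add: norm_blinfun)
    also have "\<dots> \<le> norm B * norm x" using HD[OF that(2)] by (intro mult_left_mono) auto
    finally show "norm (op_power C n (B x)) \<le> norm B * norm x" .
  qed
  have Qcomm: "Q o\<^sub>L B = B o\<^sub>L Q"
    if "B \<in> bounded_ops" "C o\<^sub>L B = B o\<^sub>L C" "C o\<^sub>L adj B = adj B o\<^sub>L C" for B
    by (rule projection_commutes[OF Q that(1)]) (auto simp: QH intro: invH that)
  have adjC: "adj C = C" and Cb: "C \<in> bounded_ops" using C by (auto simp: hermitian_iff_adj)
  have QC: "Q o\<^sub>L C = C o\<^sub>L Q" by (rule Qcomm) (auto simp: adjC Cb)
  have QCx: "Q (C x) = C (Q x)" for x using QC by (metis blinfun_apply_blinfun_compose)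
  have Qh: "hermitian Q" by (rule projection_op_hermitian[OF Q])
  have Qi: "Q (Q x) = Q x" for x by (rule projection_op_idem[OF Q])
  define P where "P = id_blinfun - Q"
  have Px: "P x = x - Q x" for x by (simp add: P_def blinfun.diff_left)
  have P: "projection_op P" unfolding P_def by (rule projection_op_complement[OF Q])
  have expand: "norm x \<le> norm (C x)" if "Q x = 0" for x
  proof -
    \<comment> \<open>the identity is supplied by the \<open>1\<close> in \<open>1 + \<Sum>k<n. Z\<^sub>k\<^sup>2\<close>, which becomes the sum of all even powers of \<open>C\<close> up to \<open>2 n\<close>\<close>
    define Z where "Z k = op_power C (Suc k)" for k
    have Zh: "hermitian (Z k)" for k unfolding Z_def by (rule hermitian_op_power[OF C(1)])
    obtain R :: "'h \<Rightarrow>\<^sub>L 'h" and r where rh: "\<And>n. hermitian (r n)" and lim: "\<And>x. (\<lambda>n. r n x) \<longlonglongrightarrow> R x"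
      and req: "\<And>n x. r n x + (\<Sum>k<n. Z k (Z k (r n x))) = x"
      and ZR: "\<And>k x. norm (Z k (R x)) \<le> norm x"
      and rcomm: "\<And>B n. (\<And>k. Z k o\<^sub>L B = B o\<^sub>L Z k) \<Longrightarrow> r n o\<^sub>L B = B o\<^sub>L r n"
      by (rule regularizing_operator[of Z, OF Zh]) blast
    have "R x \<in> H"
    proof (rule HI)
      show "norm (op_power C n (R x)) \<le> max (norm (R x)) (norm x)" for n
        using ZR[of "n - 1" x] by (cases n) (auto simp: Z_def)
    qed
    moreover have "Q (R x) = 0"
    proof -
      have "r n o\<^sub>L Q = Q o\<^sub>L r n" for n
        by (rule rcomm) (simp only: Z_def op_power_commute QC)
      then have "R o\<^sub>L Q = Q o\<^sub>L R" using lim by (rule commute_limit)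
      then have "Q (R x) = R (Q x)" by (metis blinfun_apply_blinfun_compose)
      then show ?thesis using that by simp
    qed
    ultimately have "R x = 0" using QH by metis
    then have lim0: "(\<lambda>n. r n x \<bullet> x) \<longlonglongrightarrow> 0"
      using tendsto_inner[OF lim[of x] tendsto_const[of x]] by simp
    have ineq: "(norm x)\<^sup>2 - (norm (C x))\<^sup>2 \<le> r n x \<bullet> x" for n
    proof -
      define y where "y = r n x"
      define p where "p k = op_power C k" for k
      have padd: "p j (p k z) = p (j + k) z" for j k z by (simp add: p_def op_power_add)
      have ph: "p k u \<bullet> v = u \<bullet> p k v" for k u v
        unfolding p_def by (rule hermitianD[OF hermitian_op_power[OF C(1)]])
      have x: "x = (\<Sum>k<Suc n. p (2 * k) y)"
      proof -
        have "x = y + (\<Sum>k<n. p (2 * Suc k) y)"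
        proof -
          have "Z k (Z k u) = p (2 * Suc k) u" for k u
            by (simp only: Z_def padd mult_2 flip: p_def)
          then show ?thesis using req[of n x] by (simp only: y_def)
        qed
        then show ?thesis by (subst sum.lessThan_Suc_shift) (simp add: p_def)
      qed
      have C2: "C (C x) = x - y + p (2 * Suc n) y"
      proof -
        have "C (C x) = p 2 x" by (simp add: p_def numeral_2_eq_2)
        also have "\<dots> = (\<Sum>k<Suc n. p (2 * Suc k) y)"
          by (subst x) (simp add: blinfun.sum_right padd del: sum.lessThan_Suc)
        also have "\<dots> = (\<Sum>k<Suc (Suc n). p (2 * k) y) - y"
          by (subst (2) sum.lessThan_Suc_shift) (simp add: p_def del: sum.lessThan_Suc)
        also have "\<dots> = x + p (2 * Suc n) y - y" by (simp only: sum.lessThan_Suc[of _ "Suc n"] x[symmetric])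
        finally show ?thesis by simp
      qed
      have "p (2 * Suc n) y \<bullet> x = (\<Sum>k<Suc n. p (2 * Suc n) y \<bullet> p (2 * k) y)"
        by (subst x) (simp only: inner_sum_right)
      also have "\<dots> = (\<Sum>k<Suc n. (norm (p (Suc n + k) y))\<^sup>2)"
      proof (rule sum.cong[OF refl])
        fix k
        have "p (2 * Suc n) y \<bullet> p (2 * k) y = p (Suc n + k) y \<bullet> p (Suc n + k) y"
        proof -
          have "2 * Suc n + 2 * k = (Suc n + k) + (Suc n + k)" by simp
          then show ?thesis by (simp only: ph padd)
        qed
        then show "p (2 * Suc n) y \<bullet> p (2 * k) y = (norm (p (Suc n + k) y))\<^sup>2"
          by (simp add: power2_norm_eq_inner)
      qed
      finally have "0 \<le> p (2 * Suc n) y \<bullet> x" by (simp add: sum_nonneg del: sum.lessThan_Suc)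
      moreover have "(norm (C x))\<^sup>2 = C (C x) \<bullet> x"
        using hermitianD[OF C(1), of "C x" x] by (simp add: power2_norm_eq_inner)
      ultimately show ?thesis
        unfolding C2 y_def[symmetric] power2_norm_eq_inner[of x]
        by (simp add: inner_add_left inner_diff_left)
    qed
    have "(norm x)\<^sup>2 - (norm (C x))\<^sup>2 \<le> 0"
      by (rule LIMSEQ_le_const[OF lim0]) (use ineq in blast)
    then have "(norm x)\<^sup>2 \<le> (norm (C x))\<^sup>2" by simp
    then show ?thesis by (rule power2_le_imp_le) simp
  qed
  have PQ: "P x \<bullet> Q y = 0" for x y
    using hermitianD[OF Qh, of x y] hermitianD[OF Qh, of x "Q y"]
    by (simp add: Px inner_diff_left Qi)
  have QP: "Q (P x) = 0" for x by (simp add: Px blinfun.diff_right Qi)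
  have PC: "P (C x) = C (P x)" for x by (simp add: Px QCx blinfun.diff_right)
  \<comment> \<open>\<open>C'\<close> agrees with \<open>C\<close> on the complement of \<open>H\<close> and is the identity on \<open>H\<close>, hence expanding everywhere\<close>
  define C' where "C' = (C o\<^sub>L P) + Q"
  have C'x: "C' x = C (P x) + Q x" for x by (simp add: C'_def blinfun.add_left)
  have C'h: "hermitian C'"
    unfolding C'_def
    by (intro hermitian_intros hermitian_compose C Qh projection_op_hermitian[OF P])
       (auto intro!: blinfun_eqI simp: PC)
  have CPP: "C (P x) = P (C (P x))" for x by (simp add: PC projection_op_idem[OF P])
  have C'in: "C' x \<bullet> x = C (P x) \<bullet> P x + (norm (Q x))\<^sup>2" for x
  proof -
    have "C (P x) \<bullet> x = C (P x) \<bullet> P x"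
      by (metis CPP hermitianD[OF projection_op_hermitian[OF P]])
    then show ?thesis by (simp add: C'x inner_add_left projection_op_inner[OF Q])
  qed
  have C'ge: "(norm x)\<^sup>2 \<le> C' x \<bullet> x" for x
  proof (rule expanding_imp_ge_id[OF C'h])
    show "0 \<le> C' x \<bullet> x" for x using C(2) by (simp add: C'in)
    show "norm x \<le> norm (C' x)" for x
    proof (rule power2_le_imp_le)
      have "C (P x) \<bullet> Q x = 0" by (metis CPP PQ)
      then have "(norm (C' x))\<^sup>2 = (norm (C (P x)))\<^sup>2 + (norm (Q x))\<^sup>2"
        by (simp add: C'x power2_norm_eq_inner inner_add_left inner_add_right inner_commute)
      moreover have "norm (P x) \<le> norm (C (P x))" by (rule expand[OF QP])
      then have "(norm (P x))\<^sup>2 \<le> (norm (C (P x)))\<^sup>2" by (simp add: power_mono)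
      moreover have "(norm x)\<^sup>2 = (norm (P x))\<^sup>2 + (norm (Q x))\<^sup>2"
        using projection_op_pythagoras[OF Q, of x] by (simp add: Px)
      ultimately show "(norm x)\<^sup>2 \<le> (norm (C' x))\<^sup>2" by simp
    qed simp
  qed
  have "spectral_cut C 1 P"
    unfolding spectral_cut_def
  proof (intro conjI allI impI P)
    show "P o\<^sub>L C = C o\<^sub>L P" by (rule blinfun_eqI) (simp add: PC)
    show "C x \<bullet> x \<le> 1 * (norm x)\<^sup>2" if "P x = 0" for x
    proof -
      have "Q x = x" using that by (simp add: Px)
      then have "x \<in> H" using QH by blast
      then have "norm (C x) \<le> norm x" using HD[of x 1] by simp
      then have "norm (C x) * norm x \<le> norm x * norm x" by (intro mult_right_mono) auto
      then show ?thesis using norm_cauchy_schwarz[of "C x" x] by (simp add: power2_eq_square)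
    qed
    show "1 * (norm x)\<^sup>2 < C x \<bullet> x" if "P x = x" "x \<noteq> 0" for x
    proof -
      have Q0: "Q x = 0" using that by (simp add: Px)
      have ge: "(norm x)\<^sup>2 \<le> C x \<bullet> x" using C'ge[of x] that Q0 by (simp add: C'x)
      have "(norm x)\<^sup>2 \<noteq> C x \<bullet> x"
      proof
        assume eq: "(norm x)\<^sup>2 = C x \<bullet> x"
        define D where "D = C' - id_blinfun"
        have Dx: "D z = C' z - z" for z by (simp add: D_def blinfun.diff_left)
        have Dh: "hermitian D" unfolding D_def using C'h by auto
        have D0: "0 \<le> D z \<bullet> z" for z
          using C'ge[of z] by (simp add: Dx inner_diff_left power2_norm_eq_inner)
        have "D x \<bullet> x = 0" using eq that Q0 by (simp add: Dx C'x inner_diff_left power2_norm_eq_inner)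
        then have "D x \<bullet> D x = 0" using positive_Cauchy_Schwarz[OF Dh D0, of x "D x"] by simp
        then have Cx: "C x = x" using that Q0 by (simp add: Dx C'x)
        have "op_power C n x = x" for n by (induction n) (simp_all add: Cx)
        then have "x \<in> H" by (simp add: H_def)
        then show False using QH Q0 that by metis
      qed
      with ge show ?thesis by simp
    qed
  qed
  moreover have "P o\<^sub>L B = B o\<^sub>L P"
    if "B \<in> bounded_ops" "C o\<^sub>L B = B o\<^sub>L C" "C o\<^sub>L adj B = adj B o\<^sub>L C" for B
  proof (rule blinfun_eqI)
    fix x
    have "Q (B x) = B (Q x)" using Qcomm[OF that] by (metis blinfun_apply_blinfun_compose)
    then show "(P o\<^sub>L B) x = (B o\<^sub>L P) x" by (simp add: Px blinfun.diff_right)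
  qed
  ultimately show ?thesis using that by blast
qed

text \<open>
  Reduction to the positive operator \<open>(N + r) / (t + r)\<close> and to level \<open>1\<close>, for large \<open>r\<close>.
\<close>

lemma spectral_cut_exists:
  fixes N :: "'h::complex_hilbert_space \<Rightarrow>\<^sub>L 'h"
  assumes N: "hermitian N"
  obtains P where "spectral_cut N t P"
    "\<And>B. B \<in> bounded_ops \<Longrightarrow> N o\<^sub>L B = B o\<^sub>L N \<Longrightarrow> N o\<^sub>L adj B = adj B o\<^sub>L N \<Longrightarrow> P o\<^sub>L B = B o\<^sub>L P"
proof -
  \<comment> \<open>makes \<open>N + r\<close> positive and \<open>t + r\<close> strictly positive\<close>
  define r where "r = norm N + \<bar>t\<bar> + 1"
  define c where "c = t + r"
  have c: "c > 0" unfolding c_def r_def using norm_ge_zero[of N] by linarith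
  define C where "C = (1 / c) *\<^sub>R (N + r *\<^sub>R id_blinfun)"
  have Cx: "C x = (1 / c) *\<^sub>R (N x + r *\<^sub>R x)" for x by (simp add: C_def blinfun.bilinear_simps)
  have Cin: "C x \<bullet> x = (N x \<bullet> x + r * (norm x)\<^sup>2) / c" for x
    by (simp add: Cx inner_add_left power2_norm_eq_inner)
  have Ch: "hermitian C" unfolding C_def using N by auto
  have C0: "0 \<le> C x \<bullet> x" for x
  proof -
    have "\<bar>N x \<bullet> x\<bar> \<le> r * (norm x)\<^sup>2"
    proof -
      have "0 \<le> (\<bar>t\<bar> + 1) * (norm x)\<^sup>2" by simp
      then show ?thesis
        using inner_le_norm_blinfun[of N x] unfolding r_def distrib_right by linarith
    qed
    then show ?thesis unfolding Cin using c by simp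
  qed
  obtain P where P: "spectral_cut C 1 P"
    and comm: "\<And>B. B \<in> bounded_ops \<Longrightarrow> C o\<^sub>L B = B o\<^sub>L C \<Longrightarrow> C o\<^sub>L adj B = adj B o\<^sub>L C \<Longrightarrow> P o\<^sub>L B = B o\<^sub>L P"
    by (rule contraction_cut[of C, OF Ch C0]) blast
  have comm_iff: "C o\<^sub>L B = B o\<^sub>L C \<longleftrightarrow> N o\<^sub>L B = B o\<^sub>L N" for B
  proof -
    have "C (B x) = B (C x) \<longleftrightarrow> N (B x) = B (N x)" for x
      using c by (simp add: Cx blinfun.bilinear_simps)
    then show ?thesis by (metis blinfun_apply_blinfun_compose blinfun_eqI)
  qed
  have le_iff: "C x \<bullet> x \<le> 1 * (norm x)\<^sup>2 \<longleftrightarrow> N x \<bullet> x \<le> t * (norm x)\<^sup>2"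
    "1 * (norm x)\<^sup>2 < C x \<bullet> x \<longleftrightarrow> t * (norm x)\<^sup>2 < N x \<bullet> x" for x
    unfolding Cin using c by (auto simp: field_simps c_def)
  have "spectral_cut N t P"
    using P comm_iff[of P] unfolding spectral_cut_def le_iff by metis
  then show ?thesis using that comm comm_iff by metis
qed

text \<open>
  Two cuts need not commute a priori, but each commutes with the one constructed above, so each can be compared
  with that one.
\<close>

lemma spectral_cut_unique:
  assumes N: "hermitian N" and P: "spectral_cut N t P" and Q: "spectral_cut N t Q"
  shows "P = Q"
proof -
  obtain P0 where P0: "spectral_cut N t P0"
    and comm: "\<And>B. B \<in> bounded_ops \<Longrightarrow> N o\<^sub>L B = B o\<^sub>L N \<Longrightarrow> N o\<^sub>L adj B = adj B o\<^sub>L N \<Longrightarrow> P0 o\<^sub>L B = B o\<^sub>L P0"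
    by (rule spectral_cut_exists[OF N, of t]) blast
  have "R = P0" if R: "spectral_cut N t R" for R
  proof (rule blinfun_eqI)
    fix x
    have "adj R = R" "R \<in> bounded_ops"
      using R by (auto simp: spectral_cut_def projection_op_def)
    then have c: "P0 o\<^sub>L R = R o\<^sub>L P0"
      using comm[of R] R by (simp add: spectral_cut_def)
    have "R (P0 x) = P0 x" by (rule spectral_cut_mono[OF P0 R order_refl c])
    moreover have "P0 (R x) = R x" by (rule spectral_cut_mono[OF R P0 order_refl c[symmetric]])
    ultimately show "R x = P0 x" using c by (metis blinfun_apply_blinfun_compose)
  qed
  then show ?thesis using P Q by metis
qed

section \<open>The resolution of the identity\<close>

lemma spectral_cut_above_norm:
  assumes P: "spectral_cut N t P" and le: "\<And>x. N x \<bullet> x \<le> t * (norm x)\<^sup>2"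
  shows "P = 0"
proof (rule blinfun_eqI)
  fix x
  have "P (P x) = P x" using P by (simp add: spectral_cut_def projection_op_idem)
  then show "P x = blinfun_apply 0 x"
    using P le[of "P x"] unfolding spectral_cut_def by (metis blinfun.zero_left not_less)
qed

lemma spectral_cut_id:
  fixes N :: "'h::complex_hilbert_space \<Rightarrow>\<^sub>L 'h"
  assumes "\<And>x. x \<noteq> 0 \<Longrightarrow> t * (norm x)\<^sup>2 < N x \<bullet> x"
  shows "spectral_cut N t id_blinfun"
  using assms unfolding spectral_cut_def
  by (auto simp: projection_op_trivial intro: blinfun_eqI)

definition upper_projection :: "('h::complex_hilbert_space \<Rightarrow>\<^sub>L 'h) \<Rightarrow> real \<Rightarrow> ('h \<Rightarrow>\<^sub>L 'h)" where
  "upper_projection N t = (THE P. spectral_cut N t P)"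

lemma upper_projection_eqI: "hermitian N \<Longrightarrow> spectral_cut N t P \<Longrightarrow> upper_projection N t = P"
  unfolding upper_projection_def by (rule the_equality) (auto dest: spectral_cut_unique)

lemma spectral_cut_upper_projection: "hermitian N \<Longrightarrow> spectral_cut N t (upper_projection N t)"
  by (rule spectral_cut_exists[of N t]) (auto dest: upper_projection_eqI)

lemma upper_projection_commute:
  assumes "hermitian N" "B \<in> bounded_ops" "N o\<^sub>L B = B o\<^sub>L N" "N o\<^sub>L adj B = adj B o\<^sub>L N"
  shows "upper_projection N t o\<^sub>L B = B o\<^sub>L upper_projection N t"
  by (rule spectral_cut_exists[OF assms(1), of t]) (use assms in \<open>auto dest: upper_projection_eqI\<close>)

lemma projection_op_upper_projection: "hermitian N \<Longrightarrow> projection_op (upper_projection N t)"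
  using spectral_cut_upper_projection unfolding spectral_cut_def by blast

lemma upper_projection_self_commute:
  assumes "hermitian N"
  shows "upper_projection N t (N x) = N (upper_projection N t x)"
  using spectral_cut_upper_projection[OF assms, of t] unfolding spectral_cut_def
  by (metis blinfun_apply_blinfun_compose)

lemma upper_projections_commute:
  assumes "hermitian N"
  shows "upper_projection N t o\<^sub>L upper_projection N s = upper_projection N s o\<^sub>L upper_projection N t"
proof (rule upper_projection_commute[OF assms])
  have "adj (upper_projection N s) = upper_projection N s"
    using projection_op_upper_projection[OF assms, of s] by (simp add: projection_op_def)
  moreover show "N o\<^sub>L upper_projection N s = upper_projection N s o\<^sub>L N"
    by (rule blinfun_eqI) (simp add: upper_projection_self_commute assms)
  ultimately show "N o\<^sub>L adj (upper_projection N s) = adj (upper_projection N s) o\<^sub>L N" by simp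
  show "upper_projection N s \<in> bounded_ops" using projection_op_upper_projection[OF assms] by auto
qed

lemma upper_projection_absorb:
  assumes "hermitian N" "s \<le> t"
  shows "upper_projection N s (upper_projection N t x) = upper_projection N t x"
    and "upper_projection N t (upper_projection N s x) = upper_projection N t x"
proof -
  show "upper_projection N s (upper_projection N t x) = upper_projection N t x"
    by (rule spectral_cut_mono[OF _ _ assms(2)])
       (auto intro: assms spectral_cut_upper_projection upper_projections_commute)
  then show "upper_projection N t (upper_projection N s x) = upper_projection N t x"
    using upper_projections_commute[OF assms(1)] by (metis blinfun_apply_blinfun_compose)
qed

lemma upper_projection_eq_0:
  assumes N: "hermitian N" and t: "norm N \<le> t"
  shows "upper_projection N t = 0"
proof (rule spectral_cut_above_norm[OF spectral_cut_upper_projection[OF N]])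
  fix x
  show "N x \<bullet> x \<le> t * (norm x)\<^sup>2"
    using inner_le_norm_blinfun[of N x] mult_right_mono[OF t, of "(norm x)\<^sup>2"] by simp
qed

lemma upper_projection_eq_id:
  assumes N: "hermitian N" and t: "t < - norm N"
  shows "upper_projection N t = id_blinfun"
proof (rule upper_projection_eqI[OF N], rule spectral_cut_id)
  fix x :: 'a assume "x \<noteq> 0"
  then have "t * (norm x)\<^sup>2 < - norm N * (norm x)\<^sup>2" using t by (intro mult_strict_right_mono) auto
  then show "t * (norm x)\<^sup>2 < N x \<bullet> x" using inner_le_norm_blinfun[of N x] by simp
qed

lemma upper_projection_inner_antimono:
  assumes N: "hermitian N" and "s \<le> t"
  shows "upper_projection N t x \<bullet> x \<le> upper_projection N s x \<bullet> x"
proof -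
  have pr: "projection_op (upper_projection N u)" for u
    by (rule projection_op_upper_projection[OF N])
  have "norm (upper_projection N t (upper_projection N s x)) \<le> norm (upper_projection N s x)"
    by (rule projection_op_norm_le[OF pr])
  then show ?thesis
    by (simp add: projection_op_inner[OF pr] upper_projection_absorb[OF assms] power_mono)
qed

text \<open>
  The projections for \<open>t + 1 / (n + 1)\<close> increase to a projection which is again a cut at \<open>t\<close>.
\<close>

lemma upper_projection_right_continuous:
  assumes N: "hermitian N"
  shows "(\<lambda>n. upper_projection N (t + 1 / real (Suc n)) x \<bullet> x) \<longlonglongrightarrow> upper_projection N t x \<bullet> x"
proof -
  define P where "P n = upper_projection N (t + 1 / real (Suc n))" for n
  have cut: "spectral_cut N (t + 1 / real (Suc n)) (P n)" for n
    unfolding P_def by (rule spectral_cut_upper_projection[OF N])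
  have pr: "projection_op (P n)" for n using cut unfolding spectral_cut_def by blast
  have Ph: "hermitian (P n)" for n by (rule projection_op_hermitian[OF pr])
  obtain L where L: "hermitian L" and lim: "\<And>x. (\<lambda>n. P n x) \<longlonglongrightarrow> L x"
    and limi: "\<And>x. (\<lambda>n. P n x \<bullet> x) \<longlonglongrightarrow> L x \<bullet> x" and le: "\<And>n x. P n x \<bullet> x \<le> L x \<bullet> x"
  proof (rule increasing_operator_limit[of P])
    show "P n x \<bullet> x \<le> (norm x)\<^sup>2" for n x
      using projection_op_norm_le[OF pr[of n], of x] by (simp add: projection_op_inner[OF pr] power_mono)
    show "P m x \<bullet> x \<le> P n x \<bullet> x" if "m \<le> n" for m n x
      unfolding P_def using that by (intro upper_projection_inner_antimono[OF N]) (auto simp: frac_le)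
  qed (auto simp: Ph projection_op_inner[OF pr])
  have Lpr: "projection_op L" by (rule projection_op_limit[OF pr _ lim]) (use L in auto)
  have "spectral_cut N t L"
    unfolding spectral_cut_def
  proof (intro conjI allI impI Lpr)
    show "L o\<^sub>L N = N o\<^sub>L L"
      by (rule commute_limit[OF _ lim]) (use cut in \<open>simp add: spectral_cut_def\<close>)
    show "N x \<bullet> x \<le> t * (norm x)\<^sup>2" if "L x = 0" for x
    proof (rule LIMSEQ_le_const)
      have "(\<lambda>n. (t + inverse (real (Suc n))) * (norm x)\<^sup>2) \<longlonglongrightarrow> (t + 0) * (norm x)\<^sup>2"
        by (intro tendsto_intros LIMSEQ_inverse_real_of_nat)
      then show "(\<lambda>n. (t + 1 / real (Suc n)) * (norm x)\<^sup>2) \<longlonglongrightarrow> t * (norm x)\<^sup>2"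
        by (simp add: inverse_eq_divide)
      have "P n x = 0" for n
        using le[of n x] that projection_op_inner[OF pr, of n x] by simp
      then show "\<exists>N'. \<forall>n\<ge>N'. N x \<bullet> x \<le> (t + 1 / real (Suc n)) * (norm x)\<^sup>2"
        using cut unfolding spectral_cut_def by blast
    qed
    show "t * (norm x)\<^sup>2 < N x \<bullet> x" if "L x = x" "x \<noteq> 0" for x
    proof -
      have "(\<lambda>n. upper_projection N t (P n x)) \<longlonglongrightarrow> upper_projection N t x"
        using lim[of x] that by (intro blinfun.tendsto tendsto_const) simp
      moreover have "upper_projection N t (P n x) = P n x" for n
        unfolding P_def by (rule upper_projection_absorb[OF N]) simp
      ultimately have "upper_projection N t x = x"
        using lim[of x] that LIMSEQ_unique by simp
      then show ?thesis
        using spectral_cut_upper_projection[OF N, of t] \<open>x \<noteq> 0\<close> unfolding spectral_cut_def by blast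
    qed
  qed
  then have "upper_projection N t = L" by (rule upper_projection_eqI[OF N])
  then show ?thesis using limi[of x] by (simp add: P_def)
qed

text \<open>
  The positive part \<open>(N - t)\<^sub>+\<close>.
\<close>

definition excess_op :: "('h::complex_hilbert_space \<Rightarrow>\<^sub>L 'h) \<Rightarrow> real \<Rightarrow> ('h \<Rightarrow>\<^sub>L 'h)" where
  "excess_op N t = (N - t *\<^sub>R id_blinfun) o\<^sub>L upper_projection N t"

lemma excess_op_apply: "excess_op N t x = N (upper_projection N t x) - t *\<^sub>R upper_projection N t x"
  by (simp add: excess_op_def blinfun.bilinear_simps)

lemma hermitian_excess_op:
  assumes "hermitian N"
  shows "hermitian (excess_op N t)"
  unfolding excess_op_def
proof (rule hermitian_compose)
  show "hermitian (N - t *\<^sub>R id_blinfun)" using assms by auto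
  show "hermitian (upper_projection N t)"
    by (rule projection_op_hermitian[OF projection_op_upper_projection[OF assms]])
  show "(N - t *\<^sub>R id_blinfun) o\<^sub>L upper_projection N t = upper_projection N t o\<^sub>L (N - t *\<^sub>R id_blinfun)"
    by (rule blinfun_eqI) (simp add: blinfun.bilinear_simps upper_projection_self_commute assms)
qed

lemma excess_op_inner:
  assumes N: "hermitian N"
  shows "excess_op N t x \<bullet> x = N (upper_projection N t x) \<bullet> upper_projection N t x - t * (norm (upper_projection N t x))\<^sup>2"
proof -
  define P where "P = upper_projection N t"
  have pr: "projection_op P" unfolding P_def by (rule projection_op_upper_projection[OF N])
  have "N (P x) = P (N (P x))"
    unfolding P_def by (simp add: upper_projection_self_commute[OF N] upper_projection_absorb[OF N])
  then have "N (P x) \<bullet> x = N (P x) \<bullet> P x"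
    by (metis hermitianD[OF projection_op_hermitian[OF pr]])
  then show ?thesis
    using projection_op_inner[OF pr, of x] by (simp add: excess_op_apply inner_diff_left flip: P_def)
qed

text \<open>
  On the spectral subspace between \<open>a\<close> and \<open>b\<close> the difference of the positive parts lies between \<open>0\<close> and
  \<open>b - a\<close>, above \<open>b\<close> it equals \<open>b - a\<close>.
\<close>

lemma excess_op_sandwich:
  assumes N: "hermitian N" and ab: "a \<le> b"
  shows "(b - a) * (upper_projection N b x \<bullet> x) \<le> excess_op N a x \<bullet> x - excess_op N b x \<bullet> x"
    and "excess_op N a x \<bullet> x - excess_op N b x \<bullet> x \<le> (b - a) * (upper_projection N a x \<bullet> x)"
proof -
  define P where "P = upper_projection N a"
  define Q where "Q = upper_projection N b"
  define u where "u = P x - Q x"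
  note abs = upper_projection_absorb[OF N ab, folded P_def Q_def]
    upper_projection_absorb[OF N order_refl, of a, folded P_def]
    upper_projection_absorb[OF N order_refl, of b, folded Q_def]
  have cutP: "spectral_cut N a P" and cutQ: "spectral_cut N b Q"
    unfolding P_def Q_def by (rule spectral_cut_upper_projection[OF N])+
  have prP: "projection_op P" and prQ: "projection_op Q"
    using cutP cutQ unfolding spectral_cut_def by blast+
  have Pu: "P u = u" and Qu: "Q u = 0" unfolding u_def by (simp_all add: blinfun.diff_right abs)
  have Px: "P x = u + Q x" by (simp add: u_def)
  have NQ: "Q (N z) = N (Q z)" for z unfolding Q_def by (rule upper_projection_self_commute[OF N])
  have hQ: "Q y \<bullet> z = y \<bullet> Q z" for y z by (rule hermitianD[OF projection_op_hermitian[OF prQ]])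
  have uQ: "u \<bullet> Q z = 0" for z using hQ[of u z] Qu by simp
  have NuQ: "N u \<bullet> Q z = 0" for z using hQ[of "N u" z] by (simp add: NQ Qu)
  have NQu: "N (Q z) \<bullet> u = 0" for z using NuQ[of z] hermitianD[OF N, of "Q z" u] by (simp add: inner_commute)
  have "excess_op N a x \<bullet> x = (N u \<bullet> u - a * (norm u)\<^sup>2) + (N (Q x) \<bullet> Q x - a * (norm (Q x))\<^sup>2)"
    unfolding excess_op_inner[OF N] P_def[symmetric] Px power2_norm_eq_inner
    by (simp add: blinfun.add_right inner_add_left inner_add_right NuQ NQu uQ inner_commute[of "Q x" u]
        algebra_simps)
  moreover have "excess_op N b x \<bullet> x = N (Q x) \<bullet> Q x - b * (norm (Q x))\<^sup>2"
    by (simp add: excess_op_inner[OF N] Q_def)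
  ultimately have diff: "excess_op N a x \<bullet> x - excess_op N b x \<bullet> x
      = (N u \<bullet> u - a * (norm u)\<^sup>2) + (b - a) * (norm (Q x))\<^sup>2"
    by (simp add: algebra_simps)
  have "a * (norm u)\<^sup>2 \<le> N u \<bullet> u"
    using cutP Pu unfolding spectral_cut_def by (cases "u = 0") force+
  moreover have "N u \<bullet> u \<le> b * (norm u)\<^sup>2" using cutQ Qu unfolding spectral_cut_def by blast
  moreover have "P x \<bullet> x = (norm u)\<^sup>2 + (norm (Q x))\<^sup>2"
    unfolding projection_op_inner[OF prP, of x] unfolding Px
    by (simp add: power2_norm_eq_inner inner_add_left inner_add_right uQ inner_commute[of "Q x" u])
  moreover have "Q x \<bullet> x = (norm (Q x))\<^sup>2" by (rule projection_op_inner[OF prQ])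
  ultimately show "(b - a) * (upper_projection N b x \<bullet> x) \<le> excess_op N a x \<bullet> x - excess_op N b x \<bullet> x"
    and "excess_op N a x \<bullet> x - excess_op N b x \<bullet> x \<le> (b - a) * (upper_projection N a x \<bullet> x)"
    unfolding diff P_def[symmetric] Q_def[symmetric] by (simp_all add: algebra_simps)
qed

text \<open>
  The difference of two such functions changes by at most \<open>(y - x) (p x - p y)\<close> from \<open>x\<close> to \<open>y\<close>. Over a
  partition into \<open>n\<close> equal parts these bounds telescope to \<open>(b - a) (p a - p b) / n\<close>.
\<close>

lemma sandwich_increment_unique:
  fixes p f g :: "real \<Rightarrow> real"
  assumes f: "\<And>a b. a \<le> b \<Longrightarrow> (b - a) * p b \<le> f a - f b" "\<And>a b. a \<le> b \<Longrightarrow> f a - f b \<le> (b - a) * p a"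
    and g: "\<And>a b. a \<le> b \<Longrightarrow> (b - a) * p b \<le> g a - g b" "\<And>a b. a \<le> b \<Longrightarrow> g a - g b \<le> (b - a) * p a"
    and ab: "a \<le> b"
  shows "f a - f b = g a - g b"
proof -
  define d where "d x = f x - g x" for x
  have step: "\<bar>d x - d y\<bar> \<le> (y - x) * (p x - p y)" if "x \<le> y" for x y
    using f[OF that] g[OF that] by (simp add: d_def abs_le_iff algebra_simps)
  have iter: "\<bar>d a - d (a + real k * h)\<bar> \<le> h * (p a - p (a + real k * h))" if "h \<ge> 0" for k h
  proof (induction k)
    case (Suc k)
    have "\<bar>d (a + real k * h) - d (a + real (Suc k) * h)\<bar>
        \<le> (a + real (Suc k) * h - (a + real k * h)) * (p (a + real k * h) - p (a + real (Suc k) * h))"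
      by (rule step) (use that in \<open>simp add: mult_right_mono\<close>)
    also have "a + real (Suc k) * h - (a + real k * h) = h" by (simp add: algebra_simps)
    finally have "\<bar>d a - d (a + real (Suc k) * h)\<bar>
        \<le> h * (p a - p (a + real k * h)) + h * (p (a + real k * h) - p (a + real (Suc k) * h))"
      using Suc by linarith
    then show ?case by (simp add: algebra_simps)
  qed simp
  define c where "c = (b - a) * (p a - p b)"
  have "\<bar>d a - d b\<bar> \<le> c * inverse (real (Suc n))" for n
  proof -
    have e: "a + real (Suc n) * ((b - a) / real (Suc n)) = b" by simp
    show ?thesis
      using iter[of "(b - a) / real (Suc n)" "Suc n", unfolded e] ab
      by (simp add: c_def divide_inverse mult_ac)
  qed
  moreover have "(\<lambda>n. c * inverse (real (Suc n))) \<longlonglongrightarrow> c * 0"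
    by (intro tendsto_intros LIMSEQ_inverse_real_of_nat)
  ultimately have "\<bar>d a - d b\<bar> \<le> c * 0" by (intro LIMSEQ_le_const) auto
  then show ?thesis by (simp add: d_def)
qed

text \<open>
  The sets \<open>S t\<close> stand for \<open>{s. t < f s}\<close>, but the points with \<open>f s = t\<close> may be included or not. This freedom
  is needed for eigenvalue functions, whose level sets are known only up to such points.
\<close>

lemma integral_positive_part_sandwich:
  fixes f :: "'a \<Rightarrow> real"
  assumes M: "finite_measure M" and f: "integrable M f" and S: "\<And>t. S t \<in> sets M"
    and ge: "\<And>t s. s \<in> S t \<Longrightarrow> t \<le> f s" and le: "\<And>t s. s \<in> space M \<Longrightarrow> s \<notin> S t \<Longrightarrow> f s \<le> t"
    and mono: "\<And>a b. a \<le> b \<Longrightarrow> S b \<subseteq> S a"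
    and ab: "a \<le> b"
  shows "(b - a) * measure M (S b) \<le> (\<integral>s. max (f s - a) 0 \<partial>M) - (\<integral>s. max (f s - b) 0 \<partial>M)"
    and "(\<integral>s. max (f s - a) 0 \<partial>M) - (\<integral>s. max (f s - b) 0 \<partial>M) \<le> (b - a) * measure M (S a)"
proof -
  interpret finite_measure M by fact
  have int: "integrable M (\<lambda>s. max (f s - c) 0)" for c
    by (intro integrable_max Bochner_Integration.integrable_diff f integrable_const integrable_zero)
  have ind: "integrable M (\<lambda>s. (b - a) * indicator (S c) s :: real)" for c
    using S by (intro integrable_mult_right integrable_real_indicator) (auto simp: less_top[symmetric])
  have indi: "(\<integral>s. (b - a) * indicator (S c) s \<partial>M) = (b - a) * measure M (S c)" for c
    using S sets.sets_into_space[OF S, of c] by (simp add: Int_absorb2)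
  have diff: "(\<integral>s. max (f s - a) 0 \<partial>M) - (\<integral>s. max (f s - b) 0 \<partial>M)
      = (\<integral>s. max (f s - a) 0 - max (f s - b) 0 \<partial>M)"
    by (rule Bochner_Integration.integral_diff[symmetric, OF int int])
  show "(b - a) * measure M (S b) \<le> (\<integral>s. max (f s - a) 0 \<partial>M) - (\<integral>s. max (f s - b) 0 \<partial>M)"
    unfolding diff indi[symmetric]
    by (rule integral_mono[OF ind Bochner_Integration.integrable_diff[OF int int]])
       (use ge[of _ b] ab in \<open>fastforce simp: indicator_def max_def\<close>)
  show "(\<integral>s. max (f s - a) 0 \<partial>M) - (\<integral>s. max (f s - b) 0 \<partial>M) \<le> (b - a) * measure M (S a)"
    unfolding diff indi[symmetric]
    by (rule integral_mono[OF Bochner_Integration.integrable_diff[OF int int] ind])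
       (use le[of _ a] ab in \<open>fastforce simp: indicator_def max_def\<close>)
qed

section \<open>The spectral theorem\<close>

text \<open>
  The Stieltjes measure of \<open>t \<mapsto> |x|\<^sup>2 - \<langle>P\<^sub>t x, x\<rangle>\<close>, where \<open>P\<^sub>t\<close> is the spectral projection for the half-line
  above \<open>t\<close>.
\<close>

definition distribution_measure :: "('h::complex_hilbert_space \<Rightarrow>\<^sub>L 'h) \<Rightarrow> 'h \<Rightarrow> real measure" where
  "distribution_measure N x = interval_measure (\<lambda>t. (norm x)\<^sup>2 - upper_projection N t x \<bullet> x)"

lemma sets_distribution_measure [simp, measurable_cong]: "sets (distribution_measure N x) = sets borel"
  and space_distribution_measure [simp]: "space (distribution_measure N x) = UNIV"
  by (simp_all add: distribution_measure_def)

context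
  fixes N :: "'h::complex_hilbert_space \<Rightarrow>\<^sub>L 'h"
  assumes N: "hermitian N"
begin

lemma emeasure_distribution_measure_Ioc:
  assumes "a \<le> b"
  shows "emeasure (distribution_measure N x) {a<..b}
    = ennreal (upper_projection N a x \<bullet> x - upper_projection N b x \<bullet> x)"
proof -
  let ?F = "\<lambda>t. (norm x)\<^sup>2 - upper_projection N t x \<bullet> x"
  have mono: "?F s \<le> ?F t" if "s \<le> t" for s t
    using upper_projection_inner_antimono[OF N that, of x] by simp
  have "\<forall>e>0. \<exists>d>0. ?F (t + d) - ?F t < e" for t
  proof (intro allI impI)
    fix e :: real assume "e > 0"
    then obtain n where "\<bar>upper_projection N (t + 1 / real (Suc n)) x \<bullet> x - upper_projection N t x \<bullet> x\<bar> < e"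
      using LIMSEQ_D[OF upper_projection_right_continuous[OF N, of t x], of e]
      unfolding real_norm_def by blast
    then have "?F (t + 1 / real (Suc n)) - ?F t < e" by (simp add: abs_less_iff)
    then show "\<exists>d>0. ?F (t + d) - ?F t < e" by (intro exI[of _ "1 / real (Suc n)"]) simp
  qed
  then have "continuous (at_right t) ?F" for t
    using continuous_at_right_real_increasing[of ?F t] mono by blast
  then have "emeasure (interval_measure ?F) {a<..b} = ?F b - ?F a"
    using emeasure_interval_measure_Ioc[of a b ?F] assms mono by blast
  then show ?thesis by (simp add: distribution_measure_def)
qed

lemma emeasure_distribution_measure_above:
  assumes b: "norm N \<le> b"
  shows "emeasure (distribution_measure N x) {b<..} = 0"
proof -
  have "{b<..} = (\<Union>n. {b<..b + real n})"
  proof (intro equalityI subsetI)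
    fix s assume "s \<in> {b<..}"
    moreover obtain n where "s - b \<le> real n" using real_arch_simple by blast
    ultimately have "s \<in> {b<..b + real n}" by auto
    then show "s \<in> (\<Union>n. {b<..b + real n})" by auto
  qed auto
  moreover have "emeasure (distribution_measure N x) (\<Union>n. {b<..b + real n}) = 0"
  proof (rule emeasure_UN_eq_0)
    show "emeasure (distribution_measure N x) {b<..b + real n} = 0" for n
      using b by (simp add: emeasure_distribution_measure_Ioc upper_projection_eq_0[OF N])
  qed auto
  ultimately show ?thesis by simp
qed

lemma emeasure_distribution_measure_below:
  assumes a: "a < - norm N"
  shows "emeasure (distribution_measure N x) {..a} = 0"
proof -
  have "{..a} = (\<Union>n. {a - real (Suc n)<..a})"
  proof (intro equalityI subsetI)
    fix s assume "s \<in> {..a}"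
    moreover obtain n where "a - s \<le> real n" using real_arch_simple by blast
    ultimately have "s \<in> {a - real (Suc n)<..a}" by auto
    then show "s \<in> (\<Union>n. {a - real (Suc n)<..a})" by auto
  qed auto
  moreover have "emeasure (distribution_measure N x) (\<Union>n. {a - real (Suc n)<..a}) = 0"
  proof (rule emeasure_UN_eq_0)
    show "emeasure (distribution_measure N x) {a - real (Suc n)<..a} = 0" for n
      using a by (subst emeasure_distribution_measure_Ioc) (auto simp: upper_projection_eq_id[OF N])
  qed auto
  ultimately show ?thesis by simp
qed

lemma emeasure_distribution_measure_Ioi:
  "emeasure (distribution_measure N x) {t<..} = ennreal (upper_projection N t x \<bullet> x)"
proof -
  define b where "b = max t (norm N)"
  have "{t<..} = {t<..b} \<union> {b<..}" by (auto simp: b_def)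
  moreover have "emeasure (distribution_measure N x) ({t<..b} \<union> {b<..})
      = emeasure (distribution_measure N x) {t<..b} + emeasure (distribution_measure N x) {b<..}"
    by (rule plus_emeasure[symmetric]) auto
  ultimately have "emeasure (distribution_measure N x) {t<..}
      = emeasure (distribution_measure N x) {t<..b} + emeasure (distribution_measure N x) {b<..}"
    by metis
  then show ?thesis
    by (simp add: emeasure_distribution_measure_above emeasure_distribution_measure_Ioc b_def
        upper_projection_eq_0[OF N])
qed

lemma emeasure_distribution_measure_UNIV:
  "emeasure (distribution_measure N x) UNIV = ennreal ((norm x)\<^sup>2)"
proof -
  define a where "a = - norm N - 1"
  have "(UNIV :: real set) = {..a} \<union> {a<..}" by auto
  moreover have "emeasure (distribution_measure N x) ({..a} \<union> {a<..})
      = emeasure (distribution_measure N x) {..a} + emeasure (distribution_measure N x) {a<..}"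
    by (rule plus_emeasure[symmetric]) auto
  ultimately have "emeasure (distribution_measure N x) UNIV
      = emeasure (distribution_measure N x) {..a} + emeasure (distribution_measure N x) {a<..}"
    by metis
  then show ?thesis
    by (simp add: emeasure_distribution_measure_below emeasure_distribution_measure_Ioi a_def
        upper_projection_eq_id[OF N] power2_norm_eq_inner)
qed

lemma finite_measure_distribution: "finite_measure (distribution_measure N x)"
  by (rule finite_measureI) (simp add: emeasure_distribution_measure_UNIV)

lemma measure_distribution_measure:
  "measure (distribution_measure N x) {t<..} = upper_projection N t x \<bullet> x"
  "measure (distribution_measure N x) UNIV = (norm x)\<^sup>2"
  using projection_op_inner[OF projection_op_upper_projection[OF N], of t x]
  by (simp_all add: measure_def emeasure_distribution_measure_Ioi emeasure_distribution_measure_UNIV)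

lemma AE_distribution_measure:
  "AE s in distribution_measure N x. - norm N - 1 < s \<and> s \<le> norm N"
proof (rule AE_I)
  let ?a = "- norm N - 1"
  have "emeasure (distribution_measure N x) ({..?a} \<union> {norm N<..}) \<le>
     emeasure (distribution_measure N x) {..?a} + emeasure (distribution_measure N x) {norm N<..}"
    by (rule emeasure_subadditive) auto
  then show "emeasure (distribution_measure N x) ({..?a} \<union> {norm N<..}) = 0"
    by (simp add: emeasure_distribution_measure_below emeasure_distribution_measure_above)
qed auto

lemma integrable_distribution_measure: "integrable (distribution_measure N x) (\<lambda>s. s)"
proof (rule finite_measure.integrable_const_bound[OF finite_measure_distribution])
  show "AE s in distribution_measure N x. norm s \<le> norm N + 1"
    using AE_distribution_measure[of x] by eventually_elim auto
qed measurable

lemma integral_distribution_measure: "(\<integral>s. s \<partial>distribution_measure N x) = N x \<bullet> x"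
proof -
  let ?\<mu> = "distribution_measure N x"
  interpret finite_measure ?\<mu> by (rule finite_measure_distribution)
  define a where "a = - norm N - 1"
  define b where "b = norm N"
  have ab: "a \<le> b" using norm_ge_zero[of N] unfolding a_def b_def by linarith
  note sw = integral_positive_part_sandwich[OF finite_measure_distribution integrable_distribution_measure,
      of "\<lambda>t. {t<..}", unfolded measure_distribution_measure]
  have "excess_op N a x \<bullet> x - excess_op N b x \<bullet> x
      = (\<integral>s. max (s - a) 0 \<partial>?\<mu>) - (\<integral>s. max (s - b) 0 \<partial>?\<mu>)"
    by (rule sandwich_increment_unique[OF excess_op_sandwich[OF N] sw ab]) auto
  moreover have "(\<integral>s. max (s - b) 0 \<partial>?\<mu>) = (\<integral>s. 0 \<partial>?\<mu>)"
    by (rule integral_cong_AE) (use AE_distribution_measure[of x] in \<open>auto simp: b_def\<close>)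
  moreover have "(\<integral>s. max (s - a) 0 \<partial>?\<mu>) = (\<integral>s. s - a \<partial>?\<mu>)"
    by (rule integral_cong_AE) (use AE_distribution_measure[of x] in \<open>auto simp: a_def\<close>)
  moreover have "(\<integral>s. s - a \<partial>?\<mu>) = (\<integral>s. s \<partial>?\<mu>) - a * (norm x)\<^sup>2"
    by (subst Bochner_Integration.integral_diff[OF integrable_distribution_measure integrable_const])
       (simp add: measure_distribution_measure)
  moreover have "excess_op N b x \<bullet> x = 0"
    by (simp add: excess_op_apply upper_projection_eq_0[OF N] b_def)
  moreover have "excess_op N a x \<bullet> x = N x \<bullet> x - a * (norm x)\<^sup>2"
    by (simp add: excess_op_apply upper_projection_eq_id[OF N] a_def inner_diff_left power2_norm_eq_inner)
  ultimately show ?thesis by simp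
qed

text \<open>
  The Borel sets that are represented by a projection form a Dynkin system containing the half-lines. For a
  disjoint union, the sum of two of the projections is again at most \<open>1\<close>, so they are orthogonal, their partial
  sums are projections, and the increasing limit exists.
\<close>

lemma projection_representing:
  assumes B: "B \<in> sets borel"
  shows "\<exists>A. projection_op A \<and> (\<forall>x. A x \<bullet> x = measure (distribution_measure N x) B)"
proof -
  have Int: "Int_stable (range (greaterThan :: real \<Rightarrow> _))"
  proof (rule Int_stableI)
    fix a b :: "real set" assume "a \<in> range greaterThan" "b \<in> range greaterThan"
    then obtain s t where "a = {s<..}" "b = {t<..}" by auto
    then have "a \<inter> b = {max s t<..}" by auto
    then show "a \<inter> b \<in> range greaterThan" by simp
  qed
  have Bs: "B \<in> sigma_sets UNIV (range greaterThan)"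
    using B unfolding borel_Ioi by simp
  have sub: "range (greaterThan :: real \<Rightarrow> _) \<subseteq> Pow UNIV" by simp
  have sborel: "A \<in> sets borel" if "A \<in> sigma_sets UNIV (range (greaterThan :: real \<Rightarrow> _))" for A
    using that unfolding borel_Ioi by simp
  show ?thesis
    using Int sub Bs
  proof (induction rule: sigma_sets_induct_disjoint)
    case (basic A)
    then obtain t where "A = {t<..}" by auto
    then show ?case
      using projection_op_upper_projection[OF N] measure_distribution_measure(1) by metis
  next
    case empty
    show ?case by (intro exI[of _ 0]) (simp add: projection_op_trivial)
  next
    case (compl A)
    then obtain P where P: "projection_op P" "\<And>x. P x \<bullet> x = measure (distribution_measure N x) A"
      by blast
    have "(id_blinfun - P) x \<bullet> x = measure (distribution_measure N x) (UNIV - A)" for x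
      using finite_measure.finite_measure_Diff[OF finite_measure_distribution, of UNIV x A]
        sborel[OF compl(1)]
      by (simp add: blinfun.diff_left inner_diff_left P(2) measure_distribution_measure power2_norm_eq_inner)
    then show ?case using projection_op_complement[OF P(1)] by blast
  next
    case (union A)
    then have "\<exists>P. \<forall>i. projection_op (P i) \<and> (\<forall>x. P i x \<bullet> x = measure (distribution_measure N x) (A i))"
      by (intro choice) blast
    then obtain P where P: "\<And>i. projection_op (P i)"
      and Pm: "\<And>i x. P i x \<bullet> x = measure (distribution_measure N x) (A i)" by blast
    have Ab: "A i \<in> sets borel" for i using union sborel by auto
    define S where "S n = (\<Sum>i<n. P i)" for n
    have Sx: "S n x = (\<Sum>i<n. P i x)" for n x by (simp add: S_def blinfun.sum_left)
    have Sh: "hermitian (S n)" for n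
      unfolding S_def by (rule hermitian_sum) (rule projection_op_hermitian[OF P])
    have Sin: "S n x \<bullet> x = measure (distribution_measure N x) (\<Union>i<n. A i)" for n x
      unfolding Sx inner_sum_left Pm
      by (rule finite_measure.finite_measure_finite_Union[OF finite_measure_distribution, symmetric])
         (use union Ab in \<open>auto simp: disjoint_family_on_def\<close>)
    have meas: "measure (distribution_measure N x) C \<le> (norm x)\<^sup>2" for x C
      using finite_measure.bounded_measure[OF finite_measure_distribution, of x C]
      by (simp add: measure_distribution_measure)
    have orth: "P i (P j x) = 0" if "i \<noteq> j" for i j x
    proof -
      have "P i y \<bullet> y + P j y \<bullet> y = measure (distribution_measure N y) (A i \<union> A j)" for y
        unfolding Pm
        by (rule finite_measure.finite_measure_Union[OF finite_measure_distribution, symmetric])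
           (use union that Ab in \<open>auto simp: disjoint_family_on_def\<close>)
      then have "P i y \<bullet> y + P j y \<bullet> y \<le> (norm y)\<^sup>2" for y using meas by simp
      from this[of "P j x"] have "(norm (P i (P j x)))\<^sup>2 + (norm (P j x))\<^sup>2 \<le> (norm (P j x))\<^sup>2"
        by (simp add: projection_op_inner[OF P] projection_op_idem[OF P])
           (simp flip: power2_norm_eq_inner)
      then show ?thesis by (simp flip: power2_norm_eq_inner)
    qed
    have Sidem: "S n (S n x) = S n x" for n x
    proof -
      have "P i (S n x) = P i x" if "i < n" for i
      proof -
        have "P i (S n x) = (\<Sum>j<n. if j = i then P i x else 0)"
          unfolding Sx blinfun.sum_right
          by (rule sum.cong[OF refl]) (auto simp: orth projection_op_idem[OF P])
        then show ?thesis using that by simp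
      qed
      then have "(\<Sum>i<n. P i (S n x)) = (\<Sum>i<n. P i x)" by (intro sum.cong) auto
      then show ?thesis by (simp only: Sx[symmetric])
    qed
    have Spr: "projection_op (S n)" for n by (rule projection_opI[OF Sh Sidem])
    obtain L where L: "hermitian L" and lim: "\<And>x. (\<lambda>n. S n x) \<longlonglongrightarrow> L x"
      and limi: "\<And>x. (\<lambda>n. S n x \<bullet> x) \<longlonglongrightarrow> L x \<bullet> x"
    proof (rule increasing_operator_limit[of S])
      show "S m x \<bullet> x \<le> S n x \<bullet> x" if "m \<le> n" for m n x
        unfolding Sin
      proof (rule finite_measure.finite_measure_mono[OF finite_measure_distribution])
        show "(\<Union>i<m. A i) \<subseteq> (\<Union>i<n. A i)" using that by (intro UN_mono) auto
      qed (use Ab in auto)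
    qed (auto simp: Sh Sin meas)
    have Lpr: "projection_op L" by (rule projection_op_limit[OF Spr _ lim]) (use L in auto)
    have "L x \<bullet> x = measure (distribution_measure N x) (\<Union>i. A i)" for x
    proof (rule LIMSEQ_unique[OF limi])
      have "(\<lambda>n. measure (distribution_measure N x) (\<Union>i<n. A i))
          \<longlonglongrightarrow> measure (distribution_measure N x) (\<Union>n. \<Union>i<n. A i)"
      proof (rule finite_measure.finite_Lim_measure_incseq[OF finite_measure_distribution])
        show "incseq (\<lambda>n. \<Union>i<n. A i)" by (intro incseq_SucI) (auto simp: less_Suc_eq)
      qed (use Ab in auto)
      moreover have "(\<Union>n. \<Union>i<n. A i) = (\<Union>i. A i)" by auto
      ultimately show "(\<lambda>n. S n x \<bullet> x) \<longlonglongrightarrow> measure (distribution_measure N x) (\<Union>i. A i)"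
        by (simp add: Sin)
    qed
    then show ?case using Lpr by blast
  qed
qed

definition hermitian_spectral_measure :: "complex set \<Rightarrow> ('h \<Rightarrow>\<^sub>L 'h)" where
  "hermitian_spectral_measure B = (THE A. projection_op A \<and>
     (\<forall>x. A x \<bullet> x = measure (distribution_measure N x) (complex_of_real -` B)))"

lemma of_real_vimage_borel: "B \<in> sets borel \<Longrightarrow> complex_of_real -` B \<in> sets borel"
  using measurable_sets_borel[of complex_of_real borel B] by simp

lemma hermitian_spectral_measure:
  assumes B: "B \<in> sets borel"
  shows "projection_op (hermitian_spectral_measure B)"
    and "hermitian_spectral_measure B x \<bullet> x = measure (distribution_measure N x) (complex_of_real -` B)"
proof -
  have "\<exists>!A. projection_op A \<and> (\<forall>x. A x \<bullet> x = measure (distribution_measure N x) (complex_of_real -` B))"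
    using projection_representing[OF of_real_vimage_borel[OF B]]
    by (metis hermitian_eqI projection_op_hermitian)
  from theI'[OF this]
  show "projection_op (hermitian_spectral_measure B)"
    and "hermitian_spectral_measure B x \<bullet> x = measure (distribution_measure N x) (complex_of_real -` B)"
    unfolding hermitian_spectral_measure_def by blast+
qed

lemma hermitian_spectral_measure_Un:
  assumes "A \<in> sets borel" "B \<in> sets borel" "A \<inter> B = {}"
  shows "hermitian_spectral_measure (A \<union> B) = hermitian_spectral_measure A + hermitian_spectral_measure B"
proof (rule hermitian_eqI)
  fix x
  have "complex_of_real -` A \<inter> complex_of_real -` B = {}" using assms(3) by auto
  then show "hermitian_spectral_measure (A \<union> B) x \<bullet> x
      = (hermitian_spectral_measure A + hermitian_spectral_measure B) x \<bullet> x"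
    using finite_measure.finite_measure_Union[OF finite_measure_distribution,
        of "complex_of_real -` A" x "complex_of_real -` B"] assms
    by (simp add: blinfun.add_left inner_add_left hermitian_spectral_measure of_real_vimage_borel)
next
  show "hermitian (hermitian_spectral_measure A + hermitian_spectral_measure B)"
    by (rule hermitian_intros; rule projection_op_hermitian; rule hermitian_spectral_measure; fact)
qed (use assms in \<open>auto intro: projection_op_hermitian hermitian_spectral_measure\<close>)

lemma hermitian_spectral_measure_disjoint:
  assumes "A \<in> sets borel" "B \<in> sets borel" "A \<inter> B = {}"
  shows "hermitian_spectral_measure A (hermitian_spectral_measure B x) = 0"
proof -
  define P where "P = hermitian_spectral_measure A"
  define Q where "Q = hermitian_spectral_measure B"
  have P: "projection_op P" and Q: "projection_op Q" and PQ: "projection_op (P + Q)"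
    unfolding P_def Q_def using hermitian_spectral_measure(1)[of "A \<union> B"] assms
    by (simp_all add: hermitian_spectral_measure_Un hermitian_spectral_measure)
  have "(norm ((P + Q) (Q x)))\<^sup>2 \<le> (norm (Q x))\<^sup>2"
    using projection_op_norm_le[OF PQ] by (simp add: power_mono)
  then have "(norm (P (Q x)))\<^sup>2 + (norm (Q x))\<^sup>2 \<le> (norm (Q x))\<^sup>2"
    unfolding projection_op_inner[OF PQ, symmetric]
    by (simp add: blinfun.add_left inner_add_left projection_op_inner[OF P]
        projection_op_inner[OF Q] projection_op_idem[OF Q])
       (simp flip: power2_norm_eq_inner)
  then show ?thesis by (simp add: P_def Q_def flip: power2_norm_eq_inner)
qed

text \<open>
  Multiplicativity follows from additivity and the orthogonality of the projections of disjoint sets.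
\<close>

lemma hermitian_spectral_measure_Int:
  assumes A: "A \<in> sets borel" and B: "B \<in> sets borel"
  shows "hermitian_spectral_measure (A \<inter> B) = hermitian_spectral_measure A o\<^sub>L hermitian_spectral_measure B"
proof (rule blinfun_eqI)
  fix x
  let ?E = hermitian_spectral_measure
  have eA: "?E A = ?E (A \<inter> B) + ?E (A - B)"
    using hermitian_spectral_measure_Un[of "A \<inter> B" "A - B"] A B
    by (metis Int_Diff_Un Int_Diff_disjoint sets.Diff sets.Int)
  have eB: "?E B = ?E (A \<inter> B) + ?E (B - A)"
    using hermitian_spectral_measure_Un[of "A \<inter> B" "B - A"] A B
    by (metis Int_Diff_Un Int_Diff_disjoint Int_commute sets.Diff sets.Int)
  have d: "?E (A - B) (?E (A \<inter> B) x) = 0" "?E (A - B) (?E (B - A) x) = 0" "?E (A \<inter> B) (?E (B - A) x) = 0"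
    by (rule hermitian_spectral_measure_disjoint; use A B in auto)+
  have "?E (A \<inter> B) (?E (A \<inter> B) x) = ?E (A \<inter> B) x"
    by (rule projection_op_idem) (use A B in \<open>auto intro: hermitian_spectral_measure\<close>)
  with d show "?E (A \<inter> B) x = (?E A o\<^sub>L ?E B) x"
    by (simp add: eA eB blinfun.add_left blinfun.add_right)
qed

lemma hermitian_spectral_measure_UNIV: "hermitian_spectral_measure UNIV = id_blinfun"
  and hermitian_spectral_measure_empty: "hermitian_spectral_measure {} = 0"
  by (rule hermitian_eqI;
      auto intro: projection_op_hermitian hermitian_spectral_measure
        simp: hermitian_spectral_measure measure_distribution_measure power2_norm_eq_inner)+

text \<open>
  For projections, weak convergence of the partial sums from below is strong convergence.
\<close>

lemma hermitian_spectral_measure_sums: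
  assumes F: "range F \<subseteq> sets borel" and dis: "disjoint_family F"
  shows "(\<lambda>n. hermitian_spectral_measure (F n) x) sums hermitian_spectral_measure (\<Union>n. F n) x"
  unfolding sums_def
proof -
  let ?E = hermitian_spectral_measure
  define U where "U n = (\<Union>i<n. F i)" for n :: nat
  define V where "V = (\<Union>n. F n)"
  have Fb: "F i \<in> sets borel" for i using F by auto
  have Ub: "U n \<in> sets borel" for n unfolding U_def using Fb by auto
  have Vb: "V \<in> sets borel" unfolding V_def using Fb by auto
  have UV: "U n \<subseteq> V" for n by (auto simp: U_def V_def)
  have sumU: "(\<Sum>i<n. ?E (F i) x) = ?E (U n) x" for n
  proof (induction n)
    case 0
    then show ?case by (simp add: U_def hermitian_spectral_measure_empty)
  next
    case (Suc n)
    have "F i \<inter> F n = {}" if "i < n" for i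
      using dis that by (simp add: disjoint_family_on_def)
    then have "U n \<inter> F n = {}" by (auto simp: U_def)
    moreover have "U (Suc n) = U n \<union> F n" by (auto simp: U_def less_Suc_eq)
    ultimately have "?E (U (Suc n)) = ?E (U n) + ?E (F n)"
      using hermitian_spectral_measure_Un[OF Ub Fb] by simp
    then show ?case using Suc by (simp add: blinfun.add_left)
  qed
  have diff: "norm (?E V x - ?E (U n) x) = sqrt (?E V x \<bullet> x - ?E (U n) x \<bullet> x)" for n
  proof -
    have "V = U n \<union> (V - U n)" using UV by auto
    then have e: "?E V = ?E (U n) + ?E (V - U n)"
      using hermitian_spectral_measure_Un[OF Ub[of n], of "V - U n"] Ub Vb by auto
    have pr: "projection_op (?E (V - U n))" using Ub Vb by (auto intro: hermitian_spectral_measure)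
    have "?E V x - ?E (U n) x = ?E (V - U n) x" "?E V x \<bullet> x - ?E (U n) x \<bullet> x = ?E (V - U n) x \<bullet> x"
      by (simp_all add: e blinfun.add_left inner_add_left)
    then show ?thesis by (simp add: projection_op_inner[OF pr])
  qed
  have "(\<lambda>n. ?E (U n) x \<bullet> x) \<longlonglongrightarrow> ?E V x \<bullet> x"
  proof -
    have "(\<lambda>n. measure (distribution_measure N x) (complex_of_real -` U n))
        \<longlonglongrightarrow> measure (distribution_measure N x) (\<Union>n. complex_of_real -` U n)"
    proof (rule finite_measure.finite_Lim_measure_incseq[OF finite_measure_distribution])
      show "incseq (\<lambda>n. complex_of_real -` U n)"
        by (rule incseq_SucI) (auto simp: U_def intro: less_SucI)
    qed (use Ub of_real_vimage_borel in auto)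
    moreover have "(\<Union>n. complex_of_real -` U n) = complex_of_real -` V" by (auto simp: U_def V_def)
    ultimately show ?thesis using Ub Vb by (simp add: hermitian_spectral_measure)
  qed
  then have "(\<lambda>n. sqrt (?E V x \<bullet> x - ?E (U n) x \<bullet> x)) \<longlonglongrightarrow> sqrt (?E V x \<bullet> x - ?E V x \<bullet> x)"
    by (intro tendsto_real_sqrt tendsto_diff tendsto_const)
  then have "(\<lambda>n. norm (?E (U n) x - ?E V x)) \<longlonglongrightarrow> 0"
    by (simp add: norm_minus_commute diff)
  then show "(\<lambda>n. \<Sum>i<n. ?E (F i) x) \<longlonglongrightarrow> ?E (\<Union>n. F n) x"
    unfolding sumU V_def[symmetric] by (simp add: tendsto_norm_zero_iff LIM_zero_iff)
qed

lemma scalar_measure_hermitian_spectral_measure: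
  "scalar_measure hermitian_spectral_measure x = distr (distribution_measure N x) borel complex_of_real"
proof -
  let ?D = "distr (distribution_measure N x) borel complex_of_real"
  have "measure_of UNIV (sets borel)
      (\<lambda>B. ennreal (Re (cinner (hermitian_spectral_measure B x) x))) = measure_of UNIV (sets borel) (emeasure ?D)"
  proof (rule measure_of_eq)
    fix B :: "complex set" assume "B \<in> sigma_sets UNIV (sets borel)"
    then have B: "B \<in> sets borel" using sets.sigma_sets_eq[of "borel :: complex measure"] by simp
    then show "ennreal (Re (cinner (hermitian_spectral_measure B x) x)) = emeasure ?D B"
      by (simp add: Re_cinner hermitian_spectral_measure emeasure_distr
          finite_measure.emeasure_eq_measure[OF finite_measure_distribution])
  qed simp
  also have "\<dots> = ?D" using measure_of_of_measure[of ?D] by simp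
  finally show ?thesis by (simp add: scalar_measure_def)
qed

lemma is_spectral_measure_hermitian: "is_spectral_measure N hermitian_spectral_measure"
  unfolding is_spectral_measure_def projection_valued_measure_def
proof (intro conjI allI impI ballI)
  show "\<exists>r. hermitian_spectral_measure (cball 0 r) = id_blinfun"
  proof (intro exI hermitian_eqI)
    fix x
    let ?r = "norm N + 1"
    have "measure (distribution_measure N x) (complex_of_real -` cball 0 ?r)
        = measure (distribution_measure N x) UNIV"
    proof (rule finite_measure.finite_measure_eq_AE[OF finite_measure_distribution])
      show "AE s in distribution_measure N x. s \<in> complex_of_real -` cball 0 ?r \<longleftrightarrow> s \<in> UNIV"
        using AE_distribution_measure[of x] by eventually_elim (auto simp: abs_le_iff)
    qed (auto intro: of_real_vimage_borel)
    then show "hermitian_spectral_measure (cball 0 ?r) x \<bullet> x = id_blinfun x \<bullet> x"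
      by (simp add: hermitian_spectral_measure measure_distribution_measure power2_norm_eq_inner)
  next
    show "hermitian (hermitian_spectral_measure (cball 0 (norm N + 1)))"
      by (rule projection_op_hermitian[OF hermitian_spectral_measure(1)]) simp
  qed auto
  show "has_bochner_integral (scalar_measure hermitian_spectral_measure x) (\<lambda>z. z) (cinner (N x) x)" for x
    unfolding scalar_measure_hermitian_spectral_measure hermitian_cinner_real[OF N]
  proof -
    have "has_bochner_integral (distribution_measure N x) (\<lambda>s. complex_of_real s) (complex_of_real (N x \<bullet> x))"
      using has_bochner_integral_of_real[of "distribution_measure N x" "\<lambda>s. s" "N x \<bullet> x", where 'a=complex]
        integrable_distribution_measure integral_distribution_measure
      by (simp add: has_bochner_integral_iff)
    then show "has_bochner_integral (distr (distribution_measure N x) borel complex_of_real) (\<lambda>z. z)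
       (complex_of_real (N x \<bullet> x))"
      by (intro has_bochner_integral_distr) auto
  qed
qed (auto intro: hermitian_spectral_measure hermitian_spectral_measure_Int hermitian_spectral_measure_sums
      simp: hermitian_spectral_measure_UNIV hermitian_spectral_measure_empty)

end

section \<open>Values of an arbitrary spectral measure on half-lines\<close>

context
  fixes N :: "'h::complex_hilbert_space \<Rightarrow>\<^sub>L 'h" and E :: "complex set \<Rightarrow> 'h \<Rightarrow>\<^sub>L 'h"
  assumes N: "hermitian N" and E: "is_spectral_measure N E"
begin

lemma pvm_projection: "B \<in> sets borel \<Longrightarrow> projection_op (E B)"
  and pvm_empty: "E {} = 0" and pvm_UNIV: "E UNIV = id_blinfun"
  and pvm_Int: "A \<in> sets borel \<Longrightarrow> B \<in> sets borel \<Longrightarrow> E (A \<inter> B) = E A o\<^sub>L E B"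
  and pvm_sums: "range F \<subseteq> sets borel \<Longrightarrow> disjoint_family F \<Longrightarrow> (\<lambda>n. E (F n) x) sums E (\<Union>n. F n) x"
  and pvm_integral: "has_bochner_integral (scalar_measure E x) (\<lambda>z. z) (cinner (N x) x)"
  using E unfolding is_spectral_measure_def projection_valued_measure_def by blast+

lemma emeasure_scalar_measure:
  assumes "B \<in> sets borel"
  shows "emeasure (scalar_measure E x) B = ennreal (E B x \<bullet> x)"
proof -
  have nonneg: "0 \<le> E C x \<bullet> x" if "C \<in> sets borel" for C
    by (simp add: projection_op_inner[OF pvm_projection[OF that]])
  have "emeasure (scalar_measure E x) B = ennreal (Re (cinner (E B x) x))"
    unfolding scalar_measure_def
  proof (rule emeasure_measure_of_sigma[OF _ _ _ assms])
    show "sigma_algebra UNIV (sets (borel :: complex measure))"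
      using sets.sigma_algebra_axioms[of "borel :: complex measure"] by simp
    show "positive (sets borel) (\<lambda>B. ennreal (Re (cinner (E B x) x)))"
      by (simp add: positive_def Re_cinner pvm_empty)
    show "countably_additive (sets borel) (\<lambda>B. ennreal (Re (cinner (E B x) x)))"
      unfolding countably_additive_def Re_cinner
    proof (intro allI impI)
      fix F :: "nat \<Rightarrow> complex set"
      assume F: "range F \<subseteq> sets borel" "disjoint_family F"
      have "(\<lambda>n. E (F n) x \<bullet> x) sums (E (\<Union>n. F n) x \<bullet> x)"
        by (rule bounded_linear.sums[OF bounded_linear_inner_left pvm_sums[OF F]])
      moreover have "0 \<le> E (F n) x \<bullet> x" for n using F nonneg by auto
      ultimately show "(\<Sum>i. ennreal (E (F i) x \<bullet> x)) = ennreal (E (\<Union>n. F n) x \<bullet> x)"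
        by (intro suminf_ennreal_eq)
    qed
  qed
  then show ?thesis by (simp add: Re_cinner)
qed

lemma sets_scalar_measure [simp, measurable_cong]: "sets (scalar_measure E x) = sets borel"
  and space_scalar_measure [simp]: "space (scalar_measure E x) = UNIV"
  using sets.sigma_sets_eq[of "borel :: complex measure"]
  by (simp_all add: scalar_measure_def space_measure_of_conv)

lemma finite_measure_scalar: "finite_measure (scalar_measure E x)"
  by (rule finite_measureI) (simp add: emeasure_scalar_measure)

lemma measure_scalar_measure: "B \<in> sets borel \<Longrightarrow> measure (scalar_measure E x) B = E B x \<bullet> x"
  by (simp add: measure_def emeasure_scalar_measure projection_op_inner[OF pvm_projection])

text \<open>
  Passing from \<open>x\<close> to \<open>E B x\<close> restricts the scalar measure to \<open>B\<close>, so integrals of \<open>z\<close> over \<open>B\<close> are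
  values of the quadratic form of \<open>N\<close> on the range of \<open>E B\<close>.
\<close>

lemma scalar_measure_localized:
  assumes B: "B \<in> sets borel"
  shows "scalar_measure E (E B x) = density (scalar_measure E x) (indicator B)"
proof (rule measure_eqI)
  fix C assume "C \<in> sets (scalar_measure E (E B x))"
  then have C: "C \<in> sets borel" by simp
  have "E (B \<inter> C \<inter> B) = (E B o\<^sub>L E C) o\<^sub>L E B"
    using pvm_Int[of "B \<inter> C" B] pvm_Int[of B C] B C by simp
  then have "E C (E B x) \<bullet> E B x = E (B \<inter> C \<inter> B) x \<bullet> x"
    using hermitianD[OF projection_op_hermitian[OF pvm_projection[OF B]], of "E C (E B x)" x]
    by simp
  also have "B \<inter> C \<inter> B = B \<inter> C" by auto
  finally have "E C (E B x) \<bullet> E B x = E (B \<inter> C) x \<bullet> x" .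
  moreover have "emeasure (density (scalar_measure E x) (indicator B)) C = emeasure (scalar_measure E x) (B \<inter> C)"
    using B C by (simp add: emeasure_density flip: indicator_inter_arith)
  ultimately show "emeasure (scalar_measure E (E B x)) C = emeasure (density (scalar_measure E x) (indicator B)) C"
    using B C by (simp add: emeasure_scalar_measure)
qed simp

lemma integrable_scalar_measure:
  "integrable (scalar_measure E x) Re" "integrable (scalar_measure E x) Im"
  "(\<integral>z. Re z \<partial>scalar_measure E x) = N x \<bullet> x" "(\<integral>z. Im z \<partial>scalar_measure E x) = 0"
proof -
  have i: "integrable (scalar_measure E x) (\<lambda>z. z)"
    and e: "(\<integral>z. z \<partial>scalar_measure E x) = complex_of_real (N x \<bullet> x)"
    using pvm_integral[of x] by (auto simp: has_bochner_integral_iff hermitian_cinner_real[OF N])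
  show "integrable (scalar_measure E x) Re" "integrable (scalar_measure E x) Im"
    using integrable_bounded_linear[OF bounded_linear_Re i] integrable_bounded_linear[OF bounded_linear_Im i]
    by simp_all
  show "(\<integral>z. Re z \<partial>scalar_measure E x) = N x \<bullet> x" "(\<integral>z. Im z \<partial>scalar_measure E x) = 0"
    using integral_bounded_linear[OF bounded_linear_Re i] integral_bounded_linear[OF bounded_linear_Im i]
    by (simp_all add: e)
qed

lemma integral_localized:
  assumes B: "B \<in> sets borel"
  shows "(\<integral>z. indicator B z * Re z \<partial>scalar_measure E x) = N (E B x) \<bullet> E B x"
    and "(\<integral>z. indicator B z * Im z \<partial>scalar_measure E x) = 0"
    and "integrable (scalar_measure E x) (\<lambda>z. indicator B z * Re z)"
    and "integrable (scalar_measure E x) (\<lambda>z. indicator B z * Im z)"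
    and "(\<integral>z. indicator B z \<partial>scalar_measure E x) = E B x \<bullet> x"
    and "integrable (scalar_measure E x) (indicator B :: complex \<Rightarrow> real)"
proof -
  interpret finite_measure "scalar_measure E x" by (rule finite_measure_scalar)
  have ind: "(\<lambda>z. ennreal (indicator B z)) = indicator B" by (auto simp: indicator_def)
  have loc: "scalar_measure E (E B x) = density (scalar_measure E x) (\<lambda>z. ennreal (indicator B z))"
    unfolding ind by (rule scalar_measure_localized[OF B])
  have dens: "(\<integral>z. f z \<partial>scalar_measure E (E B x)) = (\<integral>z. indicator B z * f z \<partial>scalar_measure E x)"
    if "f \<in> borel_measurable borel" for f :: "complex \<Rightarrow> real"
    unfolding loc using that B by (subst integral_density) auto
  show "(\<integral>z. indicator B z * Re z \<partial>scalar_measure E x) = N (E B x) \<bullet> E B x"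
    using dens[of Re] by (simp add: integrable_scalar_measure)
  show "(\<integral>z. indicator B z * Im z \<partial>scalar_measure E x) = 0"
    using dens[of Im] by (simp add: integrable_scalar_measure)
  show "integrable (scalar_measure E x) (\<lambda>z. indicator B z * Re z)"
    "integrable (scalar_measure E x) (\<lambda>z. indicator B z * Im z)"
    using integrable_real_mult_indicator[of B "scalar_measure E x" Re]
      integrable_real_mult_indicator[of B "scalar_measure E x" Im] B
    by (simp_all add: integrable_scalar_measure mult.commute)
  show "(\<integral>z. indicator B z \<partial>scalar_measure E x) = E B x \<bullet> x"
    using B by (simp add: measure_scalar_measure)
  show "integrable (scalar_measure E x) (indicator B :: complex \<Rightarrow> real)"
    using B by (intro integrable_real_indicator) (auto simp: less_top[symmetric])
qed

text \<open>
  The quadratic form of \<open>N\<close> is real on the ranges of the projections for the upper and the lower half-plane.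
\<close>

lemma AE_scalar_measure_real: "AE z in scalar_measure E x. Im z = 0"
proof -
  have b: "{z. Im z > 0} \<in> sets borel" "{z. Im z < 0} \<in> sets borel" by measurable
  have "AE z in scalar_measure E x. 0 \<le> indicator {z. Im z > 0} z * Im z"
    by (rule AE_I2) (simp add: indicator_def)
  from integral_nonneg_eq_0_iff_AE[OF integral_localized(4)[OF b(1)] this]
  have 1: "AE z in scalar_measure E x. indicator {z. Im z > 0} z * Im z = 0"
    unfolding integral_localized(2)[OF b(1)] by blast
  have "AE z in scalar_measure E x. 0 \<le> - (indicator {z. Im z < 0} z * Im z)"
    by (rule AE_I2) (simp add: indicator_def)
  from integral_nonneg_eq_0_iff_AE[OF integrable_minus[OF integral_localized(4)[OF b(2)]] this]
  have 2: "AE z in scalar_measure E x. - (indicator {z. Im z < 0} z * Im z) = 0"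
    unfolding Bochner_Integration.integral_minus integral_localized(2)[OF b(2)] by (metis minus_zero)
  show ?thesis using 1 2 by eventually_elim (auto simp: indicator_def split: if_splits)
qed

text \<open>
  The bounds on the range and the kernel are estimates of \<open>\<integral> Re z\<close> over and outside the half-line. That the
  projection commutes with \<open>N\<close> is seen by splitting \<open>\<langle>N w, w\<rangle>\<close> into the two parts of the integral: the cross
  terms must vanish.
\<close>

lemma pvm_half_line_is_cut: "spectral_cut N t (E (complex_of_real ` {t<..}))"
proof -
  define S where "S = complex_of_real ` {t<..}"
  have S_eq: "S = {z. Im z = 0 \<and> t < Re z}"
    unfolding S_def by (auto simp: image_iff complex_eq_iff)
  have S: "S \<in> sets borel" unfolding S_eq by measurable
  have mS: "- S \<in> sets borel" using S by auto
  define P where "P = E S"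
  have pr: "projection_op P" unfolding P_def by (rule pvm_projection[OF S])
  have compl: "E (- S) x = x - P x" for x
  proof -
    \<comment> \<open>finite additivity from countable additivity\<close>
    define F where "F n = (if n = 0 then S else if n = 1 then - S else {})" for n :: nat
    have "(\<lambda>n. E (F n) x) sums E (\<Union>n. F n) x"
      by (rule pvm_sums) (auto simp: F_def S mS disjoint_family_on_def)
    moreover have "(\<Union>n. F n) = UNIV" by (auto simp: F_def split: if_splits)
    moreover have "(\<lambda>n. E (F n) x) sums (\<Sum>n\<in>{0,1}. E (F n) x)"
      by (rule sums_finite) (auto simp: F_def pvm_empty)
    ultimately have "x = E (F 0) x + E (F 1) x" using sums_unique2 by (force simp: pvm_UNIV)
    then show ?thesis by (simp add: F_def P_def algebra_simps)
  qed
  have split: "N w \<bullet> w = N (P w) \<bullet> P w + N (w - P w) \<bullet> (w - P w)" for w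
  proof -
    have "N w \<bullet> w = (\<integral>z. indicator S z * Re z + indicator (- S) z * Re z \<partial>scalar_measure E w)"
      unfolding integrable_scalar_measure(3)[symmetric]
      by (rule Bochner_Integration.integral_cong) (auto simp: indicator_def)
    also have "\<dots> = N (E S w) \<bullet> E S w + N (E (- S) w) \<bullet> E (- S) w"
      by (simp add: Bochner_Integration.integral_add integral_localized S mS)
    finally show ?thesis by (simp add: compl P_def[symmetric])
  qed
  have PP: "P (P x) = P x" for x by (rule projection_op_idem[OF pr])
  have cross: "N (P u) \<bullet> (v - P v) = 0" for u v
  proof -
    define w where "w = P u + (v - P v)"
    have Pw: "P w = P u" by (simp add: w_def blinfun.add_right blinfun.diff_right PP)
    have "w - P w = v - P v" unfolding Pw by (simp add: w_def)
    then have "N (P u) \<bullet> (v - P v) + N (v - P v) \<bullet> P u = 0"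
      using split[of w] unfolding Pw
      by (simp add: w_def blinfun.add_right inner_add_left inner_add_right)
    then show ?thesis using hermitianD[OF N, of "v - P v" "P u"] by (simp add: inner_commute)
  qed
  have "spectral_cut N t P"
    unfolding spectral_cut_def
  proof (intro conjI allI impI pr)
    have inv: "P (N x) = N x" if "P x = x" for x
    proof -
      have "(N x - P (N x)) \<bullet> v = 0" for v
        using cross[of x v] that hermitianD[OF projection_op_hermitian[OF pr], of "N x" v]
        by (simp add: inner_diff_left inner_diff_right)
      from this[of "N x - P (N x)"] show ?thesis by simp
    qed
    show "P o\<^sub>L N = N o\<^sub>L P"
      by (rule projection_commutes[OF pr]) (use N inv in \<open>auto simp: hermitian_iff_adj\<close>)
  next
    fix x assume "P x = 0"
    then have x: "E (- S) x = x" by (simp add: compl)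
    have "N x \<bullet> x = (\<integral>z. indicator (- S) z * Re z \<partial>scalar_measure E x)"
      using integral_localized(1)[OF mS, of x] x by simp
    also have "\<dots> \<le> (\<integral>z. t * indicator (- S) z \<partial>scalar_measure E x)"
    proof (rule integral_mono_AE)
      show "AE z in scalar_measure E x. indicator (- S) z * Re z \<le> t * indicator (- S) z"
        using AE_scalar_measure_real[of x] by eventually_elim (auto simp: indicator_def S_eq)
    qed (intro integral_localized integrable_mult_right mS)+
    also have "\<dots> = t * (norm x)\<^sup>2" by (simp add: integral_localized(5)[OF mS] x power2_norm_eq_inner del: Bochner_Integration.integral_indicator)
    finally show "N x \<bullet> x \<le> t * (norm x)\<^sup>2" .
  next
    fix x assume x: "P x = x" "x \<noteq> 0"
    define f where "f z = indicator S z * Re z - t * indicator S z" for z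
    have fi: "integrable (scalar_measure E x) f"
      unfolding f_def by (intro Bochner_Integration.integrable_diff integral_localized integrable_mult_right S)
    have "(\<integral>z. f z \<partial>scalar_measure E x) = N x \<bullet> x - t * (norm x)\<^sup>2"
      unfolding f_def using x
      by (subst Bochner_Integration.integral_diff)
         (auto simp: integral_localized S power2_norm_eq_inner P_def simp del: Bochner_Integration.integral_indicator)
    moreover have f0: "AE z in scalar_measure E x. 0 \<le> f z"
      by (auto simp: f_def S_eq indicator_def)
    then have "0 \<le> (\<integral>z. f z \<partial>scalar_measure E x)" by (rule integral_nonneg_AE)
    moreover have "(\<integral>z. f z \<partial>scalar_measure E x) \<noteq> 0"
    proof
      assume "(\<integral>z. f z \<partial>scalar_measure E x) = 0"
      then have "AE z in scalar_measure E x. f z = 0"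
        using integral_nonneg_eq_0_iff_AE[OF fi f0] by simp
      then have "AE z in scalar_measure E x. z \<notin> S"
        by eventually_elim (auto simp: f_def indicator_def S_eq split: if_splits)
      then have "emeasure (scalar_measure E x) S = 0"
        using S by (subst AE_iff_measurable[symmetric, of S _ "\<lambda>z. z \<notin> S"]) auto
      then have "x \<bullet> x \<le> 0" using x S by (simp add: emeasure_scalar_measure P_def)
      then show False using x(2) inner_gt_zero_iff[of x] by linarith
    qed
    ultimately show "t * (norm x)\<^sup>2 < N x \<bullet> x" by linarith
  qed
  then show ?thesis by (simp add: P_def S_def)
qed

end

lemma spectral_projection_half_line:
  assumes N: "hermitian N"
  shows "spectral_projection (complex_of_real ` {t<..}) N = upper_projection N t"
proof -
  have "\<exists>E. is_spectral_measure N E" using is_spectral_measure_hermitian[OF N] by blast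
  then have E: "is_spectral_measure N (SOME E. is_spectral_measure N E)" by (rule someI_ex)
  show ?thesis
    unfolding spectral_projection_def
    by (rule upper_projection_eqI[OF N pvm_half_line_is_cut[OF N E], symmetric])
qed

section \<open>The algebra and its trace\<close>

lemma adj_adj:
  assumes A: "A \<in> bounded_ops"
  shows "adj (adj A) = A"
  by (rule adj_eqI) (use adj_inner[OF A] in \<open>metis inner_commute\<close>)+

lemma adj_simps:
  assumes A: "A \<in> bounded_ops" and B: "B \<in> bounded_ops"
  shows "adj (A o\<^sub>L B) = adj B o\<^sub>L adj A" "adj (A + B) = adj A + adj B" "adj (r *\<^sub>R A) = r *\<^sub>R adj A"
  by (rule adj_eqI;
      auto simp: adj_inner[OF A] adj_inner[OF B] blinfun.bilinear_simps inner_add_left inner_add_right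
        intro: A B)+

lemma hermitian_adj_compose:
  assumes "A \<in> bounded_ops"
  shows "hermitian (adj A o\<^sub>L A)"
  using assms adj_inner(2)[OF assms] adj_simps(1)[of "adj A" A] adj_adj[OF assms]
  by (auto simp: hermitian_iff_adj)

lemma adj_compose_inner:
  assumes "A \<in> bounded_ops"
  shows "(adj A o\<^sub>L A) x \<bullet> x = (norm (A x))\<^sup>2"
  using adj_inner(1)[OF assms, of x "A x"] by (simp add: power2_norm_eq_inner inner_commute)

lemma scaleC_op_apply: "scaleC_op c A x = c *\<^sub>C A x"
proof -
  have "bounded_linear (\<lambda>x. c *\<^sub>C A x)"
    by (rule bounded_linear_compose[OF bounded_linear_scaleC blinfun.bounded_linear_right])
  then show ?thesis by (simp add: scaleC_op_def bounded_linear_Blinfun_apply)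
qed

lemma commutantI: "A \<in> bounded_ops \<Longrightarrow> (\<And>B. B \<in> S \<Longrightarrow> A o\<^sub>L B = B o\<^sub>L A) \<Longrightarrow> A \<in> commutant S"
  and commutantD: "A \<in> commutant S \<Longrightarrow> B \<in> S \<Longrightarrow> A o\<^sub>L B = B o\<^sub>L A"
  and commutant_bounded_ops: "A \<in> commutant S \<Longrightarrow> A \<in> bounded_ops"
  by (auto simp: commutant_def)

lemma commute_apply: "A o\<^sub>L B = B o\<^sub>L A \<Longrightarrow> A (B x) = B (A x)"
  by (metis blinfun_apply_blinfun_compose)

lemma commutant_iff: "A \<in> commutant S \<longleftrightarrow> A \<in> bounded_ops \<and> (\<forall>B\<in>S. \<forall>x. A (B x) = B (A x))"
  by (auto simp: commutant_def intro: blinfun_eqI dest: commute_apply)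

lemma commutant_intros:
  "0 \<in> commutant S" "id_blinfun \<in> commutant S"
  "A \<in> commutant S \<Longrightarrow> B \<in> commutant S \<Longrightarrow> A + B \<in> commutant S"
  "A \<in> commutant S \<Longrightarrow> B \<in> commutant S \<Longrightarrow> A - B \<in> commutant S"
  "A \<in> commutant S \<Longrightarrow> r *\<^sub>R A \<in> commutant S"
  "A \<in> commutant S \<Longrightarrow> B \<in> commutant S \<Longrightarrow> A o\<^sub>L B \<in> commutant S"
  unfolding commutant_iff by (auto simp: blinfun.bilinear_simps)

lemma scaleC_op_commutant: 
  assumes A: "A \<in> commutant S" and S: "S \<subseteq> bounded_ops"
  shows "scaleC_op c A \<in> commutant S"
proof (rule commutantI)
  have l: "A (d *\<^sub>C x) = d *\<^sub>C A x" for d x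
    using commutant_bounded_ops[OF A] by (simp add: bounded_ops_def)
  show "scaleC_op c A \<in> bounded_ops"
    by (simp add: bounded_ops_def scaleC_op_apply l scaleC_scaleC mult.commute)
  show "scaleC_op c A o\<^sub>L B = B o\<^sub>L scaleC_op c A" if "B \<in> S" for B
    using commutantD[OF A that, THEN commute_apply] S that
    by (auto intro!: blinfun_eqI simp: scaleC_op_apply bounded_ops_def)
qed

context tracial_von_neumann_algebra
begin

lemma M_bounded_ops: "A \<in> M \<Longrightarrow> A \<in> bounded_ops"
  and M_adj: "A \<in> M \<Longrightarrow> adj A \<in> M"
  and M_bicommutant: "commutant (commutant M) = M"
  using vN by (auto simp: von_neumann_algebra_def)

lemma M_intros:
  "0 \<in> M" "id_blinfun \<in> M" "A \<in> M \<Longrightarrow> B \<in> M \<Longrightarrow> A + B \<in> M" "A \<in> M \<Longrightarrow> B \<in> M \<Longrightarrow> A - B \<in> M"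
  "A \<in> M \<Longrightarrow> r *\<^sub>R A \<in> M" "A \<in> M \<Longrightarrow> B \<in> M \<Longrightarrow> A o\<^sub>L B \<in> M" "A \<in> M \<Longrightarrow> scaleC_op c A \<in> M"
proof -
  have sub: "commutant M \<subseteq> bounded_ops" by (auto dest: commutant_bounded_ops)
  show "0 \<in> M" "id_blinfun \<in> M" "A \<in> M \<Longrightarrow> B \<in> M \<Longrightarrow> A + B \<in> M" "A \<in> M \<Longrightarrow> B \<in> M \<Longrightarrow> A - B \<in> M"
    "A \<in> M \<Longrightarrow> r *\<^sub>R A \<in> M" "A \<in> M \<Longrightarrow> B \<in> M \<Longrightarrow> A o\<^sub>L B \<in> M"
    by (rule commutant_intros[where S="commutant M", unfolded M_bicommutant] | assumption)+
  show "A \<in> M \<Longrightarrow> scaleC_op c A \<in> M"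
    by (rule scaleC_op_commutant[OF _ sub, unfolded M_bicommutant])
qed

lemma commutant_M_adj:
  assumes B: "B \<in> commutant M"
  shows "adj B \<in> commutant M"
proof (rule commutantI)
  have Bb: "B \<in> bounded_ops" by (rule commutant_bounded_ops[OF B])
  then show "adj B \<in> bounded_ops" by (rule adj_inner)
  fix A assume A: "A \<in> M"
  have "adj (adj A o\<^sub>L B) = adj (B o\<^sub>L adj A)" using commutantD[OF B M_adj[OF A]] by simp
  then show "adj B o\<^sub>L A = A o\<^sub>L adj B"
    using Bb M_bounded_ops[OF A] M_bounded_ops[OF M_adj[OF A]] by (simp add: adj_simps adj_adj)
qed

lemma M_I:
  assumes "A \<in> bounded_ops" "\<And>B. B \<in> commutant M \<Longrightarrow> A o\<^sub>L B = B o\<^sub>L A"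
  shows "A \<in> M"
  using commutantI[of A "commutant M"] assms M_bicommutant by simp

lemma M_commute: "A \<in> M \<Longrightarrow> B \<in> commutant M \<Longrightarrow> A o\<^sub>L B = B o\<^sub>L A"
  using commutantD by metis

lemma M_limit:
  assumes "\<And>n. A n \<in> M" "L \<in> bounded_ops" "\<And>x. (\<lambda>n. blinfun_apply (A n) x) \<longlonglongrightarrow> L x"
  shows "L \<in> M"
  by (rule M_I[OF assms(2)], rule commute_limit[OF _ assms(3)], rule M_commute[OF assms(1)])

text \<open>
  By the bicommutant property, a projection belongs to \<open>M\<close> as soon as its range is invariant under the
  commutant.
\<close>

lemma projection_in_M:
  assumes P: "projection_op P" and inv: "\<And>B x. B \<in> commutant M \<Longrightarrow> P x = x \<Longrightarrow> P (B x) = B x"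
  shows "P \<in> M"
proof (rule M_I)
  show "P \<in> bounded_ops" using P by auto
  fix B assume B: "B \<in> commutant M"
  show "P o\<^sub>L B = B o\<^sub>L P"
    by (rule projection_commutes[OF P commutant_bounded_ops[OF B]])
       (auto intro: inv B commutant_M_adj)
qed

lemma upper_projection_in_M:
  assumes N: "hermitian N" "N \<in> M"
  shows "upper_projection N t \<in> M"
proof (rule M_I)
  show "upper_projection N t \<in> bounded_ops" using projection_op_upper_projection[OF N(1)] by auto
  show "upper_projection N t o\<^sub>L B = B o\<^sub>L upper_projection N t" if "B \<in> commutant M" for B
    using that by (intro upper_projection_commute N commutant_bounded_ops M_commute commutant_M_adj)
qed

lemma excess_op_in_M: "hermitian N \<Longrightarrow> N \<in> M \<Longrightarrow> excess_op N t \<in> M"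
  unfolding excess_op_def by (intro M_intros upper_projection_in_M)

lemma tau_scaleR: "A \<in> M \<Longrightarrow> \<tau> (r *\<^sub>R A) = of_real r * \<tau> A"
proof -
  assume A: "A \<in> M"
  have "r *\<^sub>R A = scaleC_op (of_real r) A"
    by (rule blinfun_eqI) (simp add: scaleC_op_apply blinfun.scaleR_left scaleC_of_real)
  then show ?thesis using scaleC[OF A] by simp
qed

lemma tau_0: "\<tau> 0 = 0"
  using tau_scaleR[OF M_intros(1), of 0] by simp

lemma tau_diff: "A \<in> M \<Longrightarrow> B \<in> M \<Longrightarrow> \<tau> (A - B) = \<tau> A - \<tau> B"
proof -
  assume AB: "A \<in> M" "B \<in> M"
  have "A - B = A + (-1) *\<^sub>R B" by simp
  also have "\<tau> \<dots> = \<tau> A + of_real (-1) * \<tau> B"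
    using AB by (simp only: add M_intros tau_scaleR)
  finally show ?thesis by simp
qed

lemma tau_sum: "(\<And>i. i \<in> I \<Longrightarrow> A i \<in> M) \<Longrightarrow> sum A I \<in> M \<and> \<tau> (sum A I) = (\<Sum>i\<in>I. \<tau> (A i))"
  by (induction I rule: infinite_finite_induct) (auto simp: M_intros tau_0 add)

lemma tau_nonneg:
  assumes "A \<in> M" "hermitian A" "\<And>x. 0 \<le> A x \<bullet> x"
  shows "0 \<le> Re (\<tau> A)" "Im (\<tau> A) = 0"
  using positive[OF assms(1) positive_op_hermitian[OF assms(2,3)]]
  by (auto simp: complex_nonneg_Reals_iff)

lemma tau_mono:
  assumes "A \<in> M" "hermitian A" "B \<in> M" "hermitian B" "\<And>x. A x \<bullet> x \<le> B x \<bullet> x"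
  shows "Re (\<tau> A) \<le> Re (\<tau> B)"
  using tau_nonneg(1)[of "B - A"] assms
  by (auto simp: M_intros tau_diff blinfun.diff_left inner_diff_left hermitian_intros)

text \<open>
  \<open>A + |A|\<close>, with the norm of \<open>A\<close> as a scalar, is positive and has a real trace.
\<close>

lemma tau_hermitian_real:
  assumes A: "A \<in> M" "hermitian A"
  shows "Im (\<tau> A) = 0"
proof -
  have "Im (\<tau> (A + norm A *\<^sub>R id_blinfun)) = 0"
  proof (rule tau_nonneg(2))
    show "0 \<le> (A + norm A *\<^sub>R id_blinfun) x \<bullet> x" for x
      using inner_le_norm_blinfun[of A x]
      by (simp add: blinfun.bilinear_simps inner_add_left power2_norm_eq_inner)
  qed (use A in \<open>auto intro: M_intros\<close>)
  then show ?thesis using A by (simp add: add tau_scaleR unital M_intros)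
qed

text \<open>
  \<open>\<i> (A - A\<^sup>*)\<close> is self-adjoint, so its trace is real.
\<close>

lemma Re_tau_adj:
  assumes A: "A \<in> M"
  shows "Re (\<tau> (adj A)) = Re (\<tau> A)"
proof -
  have Ab: "A \<in> bounded_ops" by (rule M_bounded_ops[OF A])
  define H where "H = scaleC_op \<i> (A - adj A)"
  have HM: "H \<in> M" unfolding H_def using A M_adj by (intro M_intros)
  have "H x \<bullet> y = x \<bullet> H y" for x y
  proof -
    have 1: "A (\<i> *\<^sub>C z) = \<i> *\<^sub>C A z" "adj A (\<i> *\<^sub>C z) = \<i> *\<^sub>C adj A z" for z
      using Ab adj_inner(2)[OF Ab] by (auto simp: bounded_ops_iff)
    have 2: "adj A x \<bullet> z = x \<bullet> A z" for z
      using adj_inner(1)[OF Ab, of z x] by (simp add: inner_commute)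
    show ?thesis
      by (simp add: H_def scaleC_op_apply inner_i_scaleC blinfun.diff_left scaleC_linear_simps
          inner_diff_left inner_diff_right adj_inner(1)[OF Ab] 1 2)
  qed
  then have "hermitian H" using M_bounded_ops[OF HM] by (simp add: hermitian_def)
  from tau_hermitian_real[OF HM this] show ?thesis
    unfolding H_def using A M_adj by (simp add: scaleC M_intros tau_diff)
qed

text \<open>
  Expand \<open>\<tau> (X\<^sup>* X) \<ge> 0\<close> for \<open>X = A\<^sup>* + t B\<close> with real \<open>t\<close>.
\<close>

lemma tau_Cauchy_Schwarz:
  assumes A: "A \<in> M" and B: "B \<in> M"
  shows "(Re (\<tau> (A o\<^sub>L B)))\<^sup>2 \<le> Re (\<tau> (A o\<^sub>L adj A)) * Re (\<tau> (adj B o\<^sub>L B))"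
proof (rule nonneg_quadratic_discriminant)
  fix t :: real
  note b = M_bounded_ops[OF A] M_bounded_ops[OF B] M_bounded_ops[OF M_adj[OF A]] M_bounded_ops[OF M_adj[OF B]]
  define X where "X = adj A + t *\<^sub>R B"
  have XM: "X \<in> M" unfolding X_def using A B by (intro M_intros M_adj)
  have Xb: "X \<in> bounded_ops" by (rule M_bounded_ops[OF XM])
  have aX: "adj X = A + t *\<^sub>R adj B" using b by (simp add: X_def adj_simps adj_adj bounded_ops_intros)
  have e: "adj X o\<^sub>L X = (A o\<^sub>L adj A) + (t *\<^sub>R ((A o\<^sub>L B) + adj (A o\<^sub>L B)) + t\<^sup>2 *\<^sub>R (adj B o\<^sub>L B))"
    unfolding aX unfolding X_def adj_simps(1)[OF b(1,2)]
    by (rule blinfun_eqI) (simp add: blinfun.bilinear_simps scaleR_add_right power2_eq_square)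
  have "0 \<le> Re (\<tau> (adj X o\<^sub>L X))"
    by (rule tau_nonneg(1)) (auto simp: XM M_adj M_intros hermitian_adj_compose[OF Xb]
        simp del: blinfun_apply_blinfun_compose simp: adj_compose_inner[OF Xb])
  also have "\<tau> (adj X o\<^sub>L X) = \<tau> (A o\<^sub>L adj A) + (t * (\<tau> (A o\<^sub>L B) + \<tau> (adj (A o\<^sub>L B))) + t\<^sup>2 * \<tau> (adj B o\<^sub>L B))"
    unfolding e using A B by (simp add: add tau_scaleR M_intros M_adj)
  finally show "0 \<le> Re (\<tau> (A o\<^sub>L adj A)) + 2 * t * Re (\<tau> (A o\<^sub>L B)) + t\<^sup>2 * Re (\<tau> (adj B o\<^sub>L B))"
    using Re_tau_adj[of "A o\<^sub>L B"] A B by (simp add: M_intros algebra_simps flip: of_real_power)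
qed

lemma tau_adj_compose_bound:
  assumes B: "B \<in> M"
  shows "0 \<le> Re (\<tau> (adj B o\<^sub>L B))" "Re (\<tau> (adj B o\<^sub>L B)) \<le> (norm B)\<^sup>2"
proof -
  have b: "B \<in> bounded_ops" by (rule M_bounded_ops[OF B])
  show "0 \<le> Re (\<tau> (adj B o\<^sub>L B))"
    by (rule tau_nonneg(1)) (auto simp: B M_adj M_intros hermitian_adj_compose[OF b]
        simp del: blinfun_apply_blinfun_compose simp: adj_compose_inner[OF b])
  have "Re (\<tau> (adj B o\<^sub>L B)) \<le> Re (\<tau> ((norm B)\<^sup>2 *\<^sub>R id_blinfun))"
  proof (rule tau_mono)
    show "(adj B o\<^sub>L B) x \<bullet> x \<le> ((norm B)\<^sup>2 *\<^sub>R id_blinfun) x \<bullet> x" for x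
      unfolding adj_compose_inner[OF b] using power_mono[OF norm_blinfun[of B x], of 2]
      by (simp add: blinfun.scaleR_left power2_norm_eq_inner power_mult_distrib)
  qed (auto simp: B M_adj M_intros hermitian_adj_compose[OF b])
  then show "Re (\<tau> (adj B o\<^sub>L B)) \<le> (norm B)\<^sup>2" by (simp add: tau_scaleR M_intros unital)
qed

text \<open>
  Faithfulness is stated for \<open>A\<^sup>* A\<close>; it applies because \<open>A\<^sup>2 \<le> |A| A\<close>, with the norm of \<open>A\<close> as a scalar.
\<close>

lemma tau_eq_0_imp_0:
  assumes A: "A \<in> M" "hermitian A" "\<And>x. 0 \<le> A x \<bullet> x" and 0: "Re (\<tau> A) \<le> 0"
  shows "A = 0"
proof -
  have adjA: "adj A = A" using A by (simp add: hermitian_iff_adj)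
  have "Re (\<tau> (adj A o\<^sub>L A)) \<le> Re (\<tau> (norm A *\<^sub>R A))"
  proof (rule tau_mono)
    show "(adj A o\<^sub>L A) x \<bullet> x \<le> (norm A *\<^sub>R A) x \<bullet> x" for x
      unfolding adj_compose_inner[OF M_bounded_ops[OF A(1)]]
      using positive_norm_bound[OF A(2,3), of "norm A" x] inner_le_norm_blinfun[of A]
      by (simp add: blinfun.scaleR_left abs_le_iff)
  qed (use A adjA in \<open>auto intro: M_intros\<close>)
  also have "\<dots> \<le> 0" using 0 A(1) by (simp add: tau_scaleR mult_nonneg_nonpos)
  finally have "Re (\<tau> (adj A o\<^sub>L A)) = 0" using tau_adj_compose_bound(1)[OF A(1)] by simp
  moreover have "Im (\<tau> (adj A o\<^sub>L A)) = 0"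
    by (rule tau_hermitian_real) (use A adjA in \<open>auto intro: M_intros\<close>)
  ultimately have "\<tau> (adj A o\<^sub>L A) = 0" by (simp add: complex_eq_iff)
  then show ?thesis using faithful A by blast
qed

text \<open>
  The strong limit of an increasing sequence is its least upper bound in \<open>M\<close>, so normality applies.
\<close>

lemma tau_increasing_limit_le:
  assumes A: "\<And>n. A n \<in> M" "\<And>n. hermitian (A n)" and L: "L \<in> M" "hermitian L"
    and mono: "\<And>m n x. m \<le> n \<Longrightarrow> A m x \<bullet> x \<le> A n x \<bullet> x"
    and lim: "\<And>x. (\<lambda>n. A n x) \<longlonglongrightarrow> L x" and le: "\<And>n. Re (\<tau> (A n)) \<le> c"
  shows "Re (\<tau> L) \<le> c"
proof -
  have limi: "(\<lambda>n. A n x \<bullet> x) \<longlonglongrightarrow> L x \<bullet> x" for x by (intro tendsto_intros lim)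
  have ub: "A n x \<bullet> x \<le> L x \<bullet> x" for n x
    by (rule LIMSEQ_le_const[OF limi]) (use mono in blast)
  have sa: "B \<in> selfadjoints M \<longleftrightarrow> B \<in> M \<and> hermitian B" for B
    by (auto simp: selfadjoints_def hermitian_iff_adj M_bounded_ops)
  have lub: "is_lub_in M (range A) L"
    unfolding is_lub_in_def
  proof (intro conjI ballI impI)
    show "L \<in> selfadjoints M" using L by (simp add: sa)
    show "op_le B L" if "B \<in> range A" for B
      using that A L ub by (auto intro!: op_le_hermitian)
    show "op_le L B" if B: "B \<in> selfadjoints M" "\<forall>A\<in>range A. op_le A B" for B
    proof (rule op_le_hermitian)
      show "L x \<bullet> x \<le> B x \<bullet> x" for x
        by (rule LIMSEQ_le_const2[OF limi]) (use B op_le_inner in blast)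
    qed (use B L in \<open>auto simp: sa\<close>)
  qed
  have "Re (\<tau> L) = (SUP B\<in>range A. Re (\<tau> B))"
  proof (rule normal[unfolded normal_functional_def, rule_format, OF _ _ _ lub])
    show "range A \<subseteq> selfadjoints M" using A by (auto simp: sa)
    show "\<exists>C\<in>range A. op_le B C \<and> op_le B' C" if "B \<in> range A" "B' \<in> range A" for B B'
    proof -
      from that obtain m n where mn: "B = A m" "B' = A n" by blast
      have "op_le (A m) (A (max m n))" "op_le (A n) (A (max m n))"
        by (intro op_le_hermitian A mono; simp)+
      then show ?thesis unfolding mn by blast
    qed
  qed auto
  also have "\<dots> \<le> c" by (rule cSUP_least) (use le in auto)
  finally show ?thesis .
qed

end

section \<open>Eigenvalue functions and majorization\<close>

definition unit_measure :: "real measure" where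
  "unit_measure = restrict_space lebesgue {0..<1}"

lemma space_unit_measure [simp]: "space unit_measure = {0..<1}"
  by (simp add: unit_measure_def space_restrict_space)

lemma measure_unit_measure:
  assumes "0 \<le> t" "t \<le> 1"
  shows "measure unit_measure {0..<t} = t" "{0..<t} \<in> sets unit_measure"
    "emeasure unit_measure {0..<t} = ennreal t"
proof -
  have "{0..<t} \<subseteq> {0..<1}" using assms by auto
  then show e: "emeasure unit_measure {0..<t} = ennreal t"
    using assms by (simp add: unit_measure_def emeasure_restrict_space)
  then show "measure unit_measure {0..<t} = t" using assms by (simp add: measure_def)
  show "{0..<t} \<in> sets unit_measure"
    using assms unfolding unit_measure_def
    by (subst sets_restrict_space_iff) auto
qed

lemma finite_unit_measure: "finite_measure unit_measure"
  by (rule finite_measureI) (simp add: measure_unit_measure(3))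

lemma bounded_antimono_integrable:
  assumes mono: "\<And>s t. 0 \<le> s \<Longrightarrow> s \<le> t \<Longrightarrow> t < 1 \<Longrightarrow> g t \<le> g s"
    and bnd: "\<And>s. 0 \<le> s \<Longrightarrow> s < 1 \<Longrightarrow> \<bar>g s\<bar> \<le> c"
  shows "integrable unit_measure (g :: real \<Rightarrow> real)"
proof (rule finite_measure.integrable_const_bound[OF finite_unit_measure])
  show "AE s in unit_measure. norm (g s) \<le> c" by (rule AE_I2) (use bnd in auto)
  have "mono_on {0..<1} (\<lambda>s. - g s)" by (rule mono_onI) (use mono in auto)
  then have "(\<lambda>s. - g s) \<in> borel_measurable (restrict_space borel {0..<1})"
    by (rule borel_measurable_mono_on_fnc)
  then have "(\<lambda>s. - (- g s)) \<in> borel_measurable (restrict_space borel {0..<1})"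
    by (rule borel_measurable_uminus)
  then have "g \<in> borel_measurable (restrict_space borel {0..<1})" by simp
  then have "(\<lambda>s. g s * indicator {0..<1} s) \<in> borel_measurable lborel"
    by (subst (asm) borel_measurable_restrict_space_iff) (auto simp: mult.commute)
  then have "(\<lambda>s. g s * indicator {0..<1} s) \<in> borel_measurable lebesgue"
    by (rule measurable_completion)
  then show "g \<in> borel_measurable unit_measure"
    unfolding unit_measure_def by (subst borel_measurable_restrict_space_iff) (auto simp: mult.commute)
qed

text \<open>
  The closed interval may contain the point \<open>1\<close>, where the eigenvalue function has no meaningful value. The
  integrals are moved to the half-open unit interval once and for all.
\<close>

lemma initial_integral_unit_measure:
  fixes g :: "real \<Rightarrow> real"
  assumes g: "integrable unit_measure g" and t: "0 \<le> t" "t \<le> 1"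
  shows "(LINT x:{0..t}|lebesgue. g x) = (\<integral>s. indicator {0..<t} s * g s \<partial>unit_measure)"
proof -
  let ?h = "\<lambda>s. indicator {0..<t} s * g s :: real"
  have "?h \<in> borel_measurable unit_measure"
    using borel_measurable_integrable[OF g] measure_unit_measure(2)[OF t] by measurable
  then have "(\<lambda>s. indicator {0..<1} s *\<^sub>R ?h s) \<in> borel_measurable lebesgue"
    unfolding unit_measure_def by (subst (asm) borel_measurable_restrict_space_iff) auto
  moreover have ind: "indicator {0..<1} s *\<^sub>R ?h s = ?h s" for s
    using t by (auto simp: indicator_def)
  ultimately have hm: "?h \<in> borel_measurable lebesgue" by (simp only: ind)
  have split: "indicator {0..t} s *\<^sub>R g s = ?h s + indicator {t} s * g t" for s
    using t by (auto simp: indicator_def)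
  have "(LINT x:{0..t}|lebesgue. g x) = (\<integral>s. ?h s + indicator {t} s * g t \<partial>lebesgue)"
    unfolding set_lebesgue_integral_def split ..
  also have "\<dots> = (\<integral>s. ?h s \<partial>lebesgue)"
  proof (rule integral_cong_AE)
    show "(\<lambda>s. ?h s + indicator {t} s * g t) \<in> borel_measurable lebesgue"
      by (intro borel_measurable_add hm) (rule measurable_completion, simp)
    have "AE s in lborel. s \<noteq> t" by (rule AE_lborel_singleton)
    then have "AE s in lebesgue. s \<noteq> t" by (rule AE_completion)
    then show "AE s in lebesgue. ?h s + indicator {t} s * g t = ?h s"
      by eventually_elim auto
  qed (rule hm)
  also have "\<dots> = (\<integral>s. ?h s \<partial>unit_measure)"
    unfolding unit_measure_def by (subst integral_restrict_space) (simp_all only: ind, auto)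
  finally show ?thesis .
qed

text \<open>
  Pointwise, \<open>h - a\<close> on the initial interval is at most the positive part of \<open>h - a\<close>, with equality when the
  interval is exactly where \<open>h\<close> exceeds \<open>a\<close>. So \<open>\<integral>\<^sub>0\<^sup>t h\<close> and \<open>\<integral> (h - a)\<^sub>+\<close> are related by Legendre duality.
\<close>

lemma initial_integral_le:
  fixes h :: "real \<Rightarrow> real"
  assumes h: "integrable unit_measure h" and t: "0 \<le> t" "t \<le> 1"
  shows "(\<integral>s. indicator {0..<t} s * h s \<partial>unit_measure) \<le> t * a + (\<integral>s. max (h s - a) 0 \<partial>unit_measure)"
    and "(\<And>s. 0 \<le> s \<Longrightarrow> s < t \<Longrightarrow> a \<le> h s) \<Longrightarrow> (\<And>s. t \<le> s \<Longrightarrow> s < 1 \<Longrightarrow> h s \<le> a) \<Longrightarrow>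
      (\<integral>s. indicator {0..<t} s * h s \<partial>unit_measure) = t * a + (\<integral>s. max (h s - a) 0 \<partial>unit_measure)"
proof -
  interpret finite_measure unit_measure by (rule finite_unit_measure)
  have sets: "{0..<t} \<in> sets unit_measure" by (rule measure_unit_measure(2)[OF t])
  have i1: "integrable unit_measure (\<lambda>s. indicator {0..<t} s * h s)"
    using integrable_real_mult_indicator[OF sets h] by (simp add: mult.commute)
  have i2: "integrable unit_measure (\<lambda>s. a * indicator {0..<t} s :: real)"
    using sets by (intro integrable_mult_right integrable_real_indicator) (auto simp: less_top[symmetric])
  have i3: "integrable unit_measure (\<lambda>s. max (h s - a) 0)"
    by (intro integrable_max Bochner_Integration.integrable_diff h integrable_const integrable_zero)
  have "(\<integral>s. a * indicator {0..<t} s \<partial>unit_measure) = a * t"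
    using t by (simp add: measure_unit_measure(1)[OF t] min_absorb1)
  then have e: "(\<integral>s. indicator {0..<t} s * h s - a * indicator {0..<t} s \<partial>unit_measure)
      = (\<integral>s. indicator {0..<t} s * h s \<partial>unit_measure) - t * a"
    unfolding Bochner_Integration.integral_diff[OF i1 i2] by (metis mult.commute)
  have "(\<integral>s. indicator {0..<t} s * h s - a * indicator {0..<t} s \<partial>unit_measure)
      \<le> (\<integral>s. max (h s - a) 0 \<partial>unit_measure)"
    by (rule integral_mono[OF Bochner_Integration.integrable_diff[OF i1 i2] i3])
       (simp add: indicator_def max_def)
  then show "(\<integral>s. indicator {0..<t} s * h s \<partial>unit_measure) \<le> t * a + (\<integral>s. max (h s - a) 0 \<partial>unit_measure)"
    unfolding e by simp
  assume c: "\<And>s. 0 \<le> s \<Longrightarrow> s < t \<Longrightarrow> a \<le> h s" "\<And>s. t \<le> s \<Longrightarrow> s < 1 \<Longrightarrow> h s \<le> a"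
  have "(\<integral>s. indicator {0..<t} s * h s - a * indicator {0..<t} s \<partial>unit_measure)
      = (\<integral>s. max (h s - a) 0 \<partial>unit_measure)"
    by (rule Bochner_Integration.integral_cong) (use c in \<open>auto simp: indicator_def max_def not_less antisym\<close>)
  then show "(\<integral>s. indicator {0..<t} s * h s \<partial>unit_measure) = t * a + (\<integral>s. max (h s - a) 0 \<partial>unit_measure)"
    unfolding e by simp
qed

text \<open>
  Hardy, Littlewood and Polya. For given \<open>t\<close>, equality in the duality holds for \<open>f\<close> at \<open>a = f t\<close> (and at any
  lower bound of \<open>f\<close> if \<open>t = 1\<close>); for given \<open>a\<close> it holds for \<open>g\<close> at a point where \<open>g\<close> crosses the level \<open>a\<close>.
\<close>

lemma majorized_by_iff_positive_parts:
  assumes f: "integrable unit_measure f" and g: "integrable unit_measure g"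
    and fmono: "\<And>s t. 0 \<le> s \<Longrightarrow> s \<le> t \<Longrightarrow> t < 1 \<Longrightarrow> f t \<le> f s"
    and fbnd: "\<And>s. 0 \<le> s \<Longrightarrow> s < 1 \<Longrightarrow> c \<le> f s"
    and gcut: "\<And>a. \<exists>t. 0 \<le> t \<and> t \<le> 1 \<and> (\<forall>s. 0 \<le> s \<longrightarrow> s < t \<longrightarrow> a \<le> g s) \<and> (\<forall>s. t \<le> s \<longrightarrow> s < 1 \<longrightarrow> g s \<le> a)"
  shows "majorized_by g f \<longleftrightarrow>
    (\<forall>a. (\<integral>s. max (g s - a) 0 \<partial>unit_measure) \<le> (\<integral>s. max (f s - a) 0 \<partial>unit_measure)) \<and>
    (\<integral>s. g s \<partial>unit_measure) = (\<integral>s. f s \<partial>unit_measure)"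
proof -
  define J where "J h t = (\<integral>s. indicator {0..<t} s * h s \<partial>unit_measure)" for h :: "real \<Rightarrow> real" and t
  define G where "G h a = (\<integral>s. max (h s - a) 0 \<partial>unit_measure)" for h :: "real \<Rightarrow> real" and a
  have J1: "J h 1 = (\<integral>s. h s \<partial>unit_measure)" for h
    unfolding J_def by (rule Bochner_Integration.integral_cong) auto
  have maj: "majorized_by g f \<longleftrightarrow> (\<forall>t\<in>{0..1}. J g t \<le> J f t) \<and> J g 1 = J f 1"
    unfolding majorized_by_def J_def
    by (simp add: initial_integral_unit_measure f g)
  have le: "J h t \<le> t * a + G h a" if "integrable unit_measure h" "0 \<le> t" "t \<le> 1" for h t a
    unfolding J_def G_def by (rule initial_integral_le(1)[OF that])
  have gcut': "\<exists>t. 0 \<le> t \<and> t \<le> 1 \<and> J g t = t * a + G g a" for a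
    using gcut[of a] initial_integral_le(2)[OF g, of _ a] unfolding J_def G_def by blast
  have fcut': "\<exists>a. J f t = t * a + G f a" if t: "0 \<le> t" "t \<le> 1" for t
  proof (cases "t = 1")
    case True
    have "J f t = t * c + G f c"
      unfolding J_def G_def by (rule initial_integral_le(2)[OF f t]) (use True fbnd in auto)
    then show ?thesis by blast
  next
    case False
    have "J f t = t * f t + G f (f t)"
      unfolding J_def G_def by (rule initial_integral_le(2)[OF f t]) (use False t fmono in auto)
    then show ?thesis by blast
  qed
  have "(\<forall>t\<in>{0..1}. J g t \<le> J f t) \<longleftrightarrow> (\<forall>a. G g a \<le> G f a)"
  proof
    assume *: "\<forall>t\<in>{0..1}. J g t \<le> J f t"
    show "\<forall>a. G g a \<le> G f a"
    proof
      fix a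
      obtain t where t: "0 \<le> t" "t \<le> 1" "J g t = t * a + G g a" using gcut' by blast
      then show "G g a \<le> G f a" using * le[OF f t(1,2), of a] by force
    qed
  next
    assume *: "\<forall>a. G g a \<le> G f a"
    show "\<forall>t\<in>{0..1}. J g t \<le> J f t"
    proof
      fix t :: real assume t: "t \<in> {0..1}"
      then obtain a where "J f t = t * a + G f a" using fcut' by auto
      then show "J g t \<le> J f t" using *[rule_format, of a] le[OF g, of t a] t by simp
    qed
  qed
  then show ?thesis unfolding maj J1 G_def by simp
qed

context tracial_von_neumann_algebra
begin

definition tail_trace :: "('h \<Rightarrow>\<^sub>L 'h) \<Rightarrow> real \<Rightarrow> real" where
  "tail_trace N t = Re (\<tau> (upper_projection N t))"

definition excess_trace :: "('h \<Rightarrow>\<^sub>L 'h) \<Rightarrow> real \<Rightarrow> real" where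
  "excess_trace N t = Re (\<tau> (excess_op N t))"

context
  fixes N :: "'h \<Rightarrow>\<^sub>L 'h"
  assumes N: "hermitian N" and NM: "N \<in> M"
begin

lemma hermitian_upper_projection: "hermitian (upper_projection N t)"
  by (rule projection_op_hermitian[OF projection_op_upper_projection[OF N]])

lemma tail_trace_antimono: "s \<le> t \<Longrightarrow> tail_trace N t \<le> tail_trace N s"
  unfolding tail_trace_def
  by (rule tau_mono)
     (auto intro: upper_projection_in_M N NM hermitian_upper_projection upper_projection_inner_antimono)

lemma tail_trace_above: "norm N \<le> t \<Longrightarrow> tail_trace N t = 0"
  by (simp add: tail_trace_def upper_projection_eq_0[OF N] tau_0)

lemma tail_trace_below: "t < - norm N \<Longrightarrow> tail_trace N t = 1"
  by (simp add: tail_trace_def upper_projection_eq_id[OF N] unital)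

lemma tail_trace_bounds: "0 \<le> tail_trace N t" "tail_trace N t \<le> 1"
  using tail_trace_antimono[of t "max t (norm N)"] tail_trace_antimono[of "min t (- norm N - 1)" t]
    tail_trace_above[of "max t (norm N)"] tail_trace_below[of "min t (- norm N - 1)"]
  by auto

lemma eigenvalue_function_eq: "eigenvalue_function \<tau> N s = Inf {t. tail_trace N t \<le> s}"
  by (simp add: eigenvalue_function_def spectral_projection_half_line[OF N] tail_trace_def)

lemma eigenvalue_function_set:
  assumes "0 \<le> s" "s < 1"
  shows "norm N \<in> {t. tail_trace N t \<le> s}" "\<And>t. t \<in> {t. tail_trace N t \<le> s} \<Longrightarrow> - norm N \<le> t"
    "bdd_below {t. tail_trace N t \<le> s}"
proof -
  show "norm N \<in> {t. tail_trace N t \<le> s}" using assms by (simp add: tail_trace_above)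
  show l: "- norm N \<le> t" if "t \<in> {t. tail_trace N t \<le> s}" for t
    using that tail_trace_below[of t] assms by (cases "t < - norm N") auto
  show "bdd_below {t. tail_trace N t \<le> s}" by (rule bdd_belowI[OF l])
qed

lemma eigenvalue_function_le:
  assumes "0 \<le> s" "s < 1" "tail_trace N a \<le> s"
  shows "eigenvalue_function \<tau> N s \<le> a"
  unfolding eigenvalue_function_eq
  by (rule cInf_lower[OF _ eigenvalue_function_set(3)]) (use assms in auto)

text \<open>
  Together with the preceding lemma: the eigenvalue function is at least \<open>t\<close> on \<open>{0..<tail_trace N t}\<close> and at
  most \<open>t\<close> on the rest of the unit interval.
\<close>

lemma eigenvalue_function_ge:
  assumes "0 \<le> s" "s < tail_trace N b"
  shows "b \<le> eigenvalue_function \<tau> N s"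
  unfolding eigenvalue_function_eq
proof (rule cInf_greatest)
  have s: "s < 1" using assms tail_trace_bounds(2)[of b] by simp
  show "{t. tail_trace N t \<le> s} \<noteq> {}" using eigenvalue_function_set(1)[OF assms(1) s] by blast
  show "b \<le> t" if "t \<in> {t. tail_trace N t \<le> s}" for t
    using that assms tail_trace_antimono[of t b] by (cases "t \<le> b") auto
qed

lemma eigenvalue_function_bounds:
  assumes "0 \<le> s" "s < 1"
  shows "\<bar>eigenvalue_function \<tau> N s\<bar> \<le> norm N"
proof -
  have "eigenvalue_function \<tau> N s \<le> norm N"
    by (rule eigenvalue_function_le) (use assms in \<open>simp_all add: tail_trace_above\<close>)
  moreover have "- norm N \<le> eigenvalue_function \<tau> N s"
    unfolding eigenvalue_function_eq
    by (rule cInf_greatest) (use eigenvalue_function_set[OF assms] in blast)+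
  ultimately show ?thesis by (simp add: abs_le_iff)
qed

lemma eigenvalue_function_antimono:
  assumes "0 \<le> s" "s \<le> t" "t < 1"
  shows "eigenvalue_function \<tau> N t \<le> eigenvalue_function \<tau> N s"
  unfolding eigenvalue_function_eq
proof (rule cInf_superset_mono)
  show "{u. tail_trace N u \<le> s} \<noteq> {}" using eigenvalue_function_set(1)[of s] assms by auto
  show "bdd_below {u. tail_trace N u \<le> t}" using eigenvalue_function_set(3)[of t] assms by auto
qed (use assms in auto)

lemma eigenvalue_function_integrable: "integrable unit_measure (eigenvalue_function \<tau> N)"
  by (rule bounded_antimono_integrable[OF eigenvalue_function_antimono eigenvalue_function_bounds])

lemma excess_trace_sandwich:
  assumes "a \<le> b"
  shows "(b - a) * tail_trace N b \<le> excess_trace N a - excess_trace N b"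
    and "excess_trace N a - excess_trace N b \<le> (b - a) * tail_trace N a"
proof -
  have e: "Re (\<tau> (excess_op N a - excess_op N b)) = excess_trace N a - excess_trace N b"
    by (simp add: excess_trace_def tau_diff excess_op_in_M N NM)
  have p: "Re (\<tau> ((b - a) *\<^sub>R upper_projection N c)) = (b - a) * tail_trace N c" for c
    by (simp add: tail_trace_def tau_scaleR upper_projection_in_M N NM)
  have dM: "excess_op N a - excess_op N b \<in> M" "hermitian (excess_op N a - excess_op N b)"
    by (intro M_intros excess_op_in_M hermitian_intros hermitian_excess_op N NM)+
  have pM: "(b - a) *\<^sub>R upper_projection N c \<in> M" "hermitian ((b - a) *\<^sub>R upper_projection N c)" for c
    by (intro M_intros upper_projection_in_M hermitian_intros hermitian_upper_projection N NM)+
  show "(b - a) * tail_trace N b \<le> excess_trace N a - excess_trace N b"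
    unfolding e[symmetric] p[symmetric]
    by (rule tau_mono[OF pM dM])
       (use excess_op_sandwich(1)[OF N assms] in \<open>simp add: blinfun.bilinear_simps inner_diff_left\<close>)
  show "excess_trace N a - excess_trace N b \<le> (b - a) * tail_trace N a"
    unfolding e[symmetric] p[symmetric]
    by (rule tau_mono[OF dM pM])
       (use excess_op_sandwich(2)[OF N assms] in \<open>simp add: blinfun.bilinear_simps inner_diff_left\<close>)
qed

lemma excess_trace_above: "norm N \<le> b \<Longrightarrow> excess_trace N b = 0"
  by (simp add: excess_trace_def excess_op_def upper_projection_eq_0[OF N] tau_0)

text \<open>
  Both sides satisfy the sandwich inequalities with the tail trace, and both vanish above the norm of \<open>N\<close>.
\<close>

lemma excess_trace_eq_integral:
  "excess_trace N a = (\<integral>s. max (eigenvalue_function \<tau> N s - a) 0 \<partial>unit_measure)"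
proof -
  let ?f = "eigenvalue_function \<tau> N"
  let ?S = "\<lambda>t. {0..<tail_trace N t}"
  have sw: "(b - a) * tail_trace N b \<le> (\<integral>s. max (?f s - a) 0 \<partial>unit_measure) - (\<integral>s. max (?f s - b) 0 \<partial>unit_measure)"
    "(\<integral>s. max (?f s - a) 0 \<partial>unit_measure) - (\<integral>s. max (?f s - b) 0 \<partial>unit_measure) \<le> (b - a) * tail_trace N a"
    if "a \<le> b" for a b
  proof -
    have S: "?S t \<in> sets unit_measure" "measure unit_measure (?S t) = tail_trace N t" for t
      by (intro measure_unit_measure tail_trace_bounds)+
    \<comment> \<open>the tail trace as a function of \<open>t\<close> and the eigenvalue function are generalized inverses of each other\<close>
    have ge: "t \<le> ?f s" if "s \<in> ?S t" for s t using that by (auto intro: eigenvalue_function_ge)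
    have le: "?f s \<le> t" if "s \<in> space unit_measure" "s \<notin> ?S t" for s t
      using that by (intro eigenvalue_function_le) auto
    have mono: "?S b \<subseteq> ?S a" if "a \<le> b" for a b using tail_trace_antimono[OF that] by auto
    show "(b - a) * tail_trace N b \<le> (\<integral>s. max (?f s - a) 0 \<partial>unit_measure) - (\<integral>s. max (?f s - b) 0 \<partial>unit_measure)"
      "(\<integral>s. max (?f s - a) 0 \<partial>unit_measure) - (\<integral>s. max (?f s - b) 0 \<partial>unit_measure) \<le> (b - a) * tail_trace N a"
      using integral_positive_part_sandwich[of unit_measure ?f ?S a b,
          OF finite_unit_measure eigenvalue_function_integrable S(1) ge le mono that]
      by (auto simp: S(2))
  qed
  have zero: "(\<integral>s. max (?f s - b) 0 \<partial>unit_measure) = 0" if "norm N \<le> b" for b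
  proof -
    have "(\<integral>s. max (?f s - b) 0 \<partial>unit_measure) = (\<integral>s. 0 \<partial>unit_measure)"
      by (rule Bochner_Integration.integral_cong) (use eigenvalue_function_bounds that in \<open>force simp: max_def\<close>)+
    then show ?thesis by simp
  qed
  show ?thesis
  proof (cases "norm N \<le> a")
    case True
    then show ?thesis by (simp add: zero excess_trace_above)
  next
    case False
    then have "excess_trace N a - excess_trace N (norm N)
      = (\<integral>s. max (?f s - a) 0 \<partial>unit_measure) - (\<integral>s. max (?f s - norm N) 0 \<partial>unit_measure)"
      by (intro sandwich_increment_unique[of "tail_trace N"] excess_trace_sandwich sw) auto
    then show ?thesis by (simp add: zero excess_trace_above)
  qed
qed

lemma integral_eigenvalue_function: "(\<integral>s. eigenvalue_function \<tau> N s \<partial>unit_measure) = Re (\<tau> N)"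
proof -
  interpret finite_measure unit_measure by (rule finite_unit_measure)
  define a where "a = - norm N - 1"
  have "excess_op N a = N - a *\<^sub>R id_blinfun"
    by (rule blinfun_eqI) (simp add: excess_op_apply a_def upper_projection_eq_id[OF N] blinfun.bilinear_simps)
  then have "excess_trace N a = Re (\<tau> N) - a"
    by (simp add: excess_trace_def tau_diff tau_scaleR M_intros NM unital)
  moreover have "(\<integral>s. max (eigenvalue_function \<tau> N s - a) 0 \<partial>unit_measure)
      = (\<integral>s. eigenvalue_function \<tau> N s - a \<partial>unit_measure)"
    by (rule Bochner_Integration.integral_cong)
       (use eigenvalue_function_bounds in \<open>force simp: max_def a_def abs_le_iff\<close>)+
  moreover have "\<dots> = (\<integral>s. eigenvalue_function \<tau> N s \<partial>unit_measure) - a"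
    by (subst Bochner_Integration.integral_diff[OF eigenvalue_function_integrable integrable_const])
       (simp add: measure_unit_measure)
  ultimately show ?thesis using excess_trace_eq_integral[of a] by simp
qed

end

lemma majorized_by_iff_excess:
  assumes X: "hermitian X" "X \<in> M" and C: "hermitian C" "C \<in> M"
  shows "majorized_by (eigenvalue_function \<tau> X) (eigenvalue_function \<tau> C) \<longleftrightarrow>
    (\<forall>a. excess_trace X a \<le> excess_trace C a) \<and> Re (\<tau> X) = Re (\<tau> C)"
  unfolding excess_trace_eq_integral[OF X] excess_trace_eq_integral[OF C]
    integral_eigenvalue_function[OF X, symmetric] integral_eigenvalue_function[OF C, symmetric]
proof (rule majorized_by_iff_positive_parts)
  show "- norm C \<le> eigenvalue_function \<tau> C s" if "0 \<le> s" "s < 1" for s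
    using eigenvalue_function_bounds[OF C that] by simp
  show "\<exists>t. 0 \<le> t \<and> t \<le> 1 \<and> (\<forall>s. 0 \<le> s \<longrightarrow> s < t \<longrightarrow> a \<le> eigenvalue_function \<tau> X s) \<and>
    (\<forall>s. t \<le> s \<longrightarrow> s < 1 \<longrightarrow> eigenvalue_function \<tau> X s \<le> a)" for a
  proof (intro exI[of _ "tail_trace X a"] conjI allI impI)
    fix s assume "tail_trace X a \<le> s" "s < 1"
    then show "eigenvalue_function \<tau> X s \<le> a"
      using tail_trace_bounds(1)[OF X, of a] by (intro eigenvalue_function_le[OF X]) auto
  qed (auto intro: tail_trace_bounds[OF X] eigenvalue_function_ge[OF X])
qed (auto intro: eigenvalue_function_integrable X C eigenvalue_function_antimono[OF C])

end

section \<open>Variational description of the admissible operators\<close>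

text \<open>
  Both \<open>0\<close> and \<open>N - a\<close> are below the positive part of \<open>N - a\<close>.
\<close>

lemma excess_op_dominates:
  assumes N: "hermitian N"
  shows "0 \<le> excess_op N a x \<bullet> x" "N x \<bullet> x - a * (norm x)\<^sup>2 \<le> excess_op N a x \<bullet> x"
proof -
  define P where "P = upper_projection N a"
  have cut: "spectral_cut N a P" unfolding P_def by (rule spectral_cut_upper_projection[OF N])
  have pr: "projection_op P" using cut unfolding spectral_cut_def by blast
  have PP: "P (P x) = P x" by (rule projection_op_idem[OF pr])
  have inner: "excess_op N a x \<bullet> x = N (P x) \<bullet> P x - a * (norm (P x))\<^sup>2"
    unfolding P_def by (rule excess_op_inner[OF N])
  show "0 \<le> excess_op N a x \<bullet> x"
    unfolding inner using cut PP unfolding spectral_cut_def by (cases "P x = 0") force+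
  define y where "y = x - P x"
  have x: "x = P x + y" by (simp add: y_def)
  have "P y = 0" by (simp add: y_def blinfun.diff_right PP)
  then have Ny: "N y \<bullet> y \<le> a * (norm y)\<^sup>2" using cut unfolding spectral_cut_def by blast
  have "P (N y) = N (P y)" unfolding P_def by (rule upper_projection_self_commute[OF N])
  then have "N y \<bullet> P x = 0"
    using hermitianD[OF projection_op_hermitian[OF pr], of "N y" x] \<open>P y = 0\<close> by simp
  then have cross: "N y \<bullet> P x = 0" "N (P x) \<bullet> y = 0"
    using hermitianD[OF N, of y "P x"] by (simp_all add: inner_commute)
  have "N x \<bullet> x = N (P x) \<bullet> P x + N y \<bullet> y"
    using cross by (subst (1 2) x) (simp add: blinfun.add_right inner_add_left inner_add_right)
  moreover have "(norm x)\<^sup>2 = (norm (P x))\<^sup>2 + (norm y)\<^sup>2"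
    using projection_op_pythagoras[OF pr, of x] by (simp add: y_def)
  ultimately show "N x \<bullet> x - a * (norm x)\<^sup>2 \<le> excess_op N a x \<bullet> x"
    unfolding inner using Ny by (simp add: algebra_simps)
qed

lemma hermitian_norm_le:
  assumes X: "hermitian X" and b: "\<And>x. \<bar>X x \<bullet> x\<bar> \<le> b * (norm x)\<^sup>2" "0 \<le> b"
  shows "norm X \<le> 3 * b"
proof (rule norm_blinfun_bound)
  fix x
  define B where "B = X + b *\<^sub>R id_blinfun"
  have Bx: "B y = X y + b *\<^sub>R y" for y by (simp add: B_def blinfun.bilinear_simps)
  have Bin: "B y \<bullet> y = X y \<bullet> y + b * (norm y)\<^sup>2" for y
    by (simp add: Bx inner_add_left power2_norm_eq_inner)
  have B2: "B y \<bullet> y \<le> (2 * b) * (norm y)\<^sup>2" for y using b(1)[of y] unfolding Bin by (simp add: abs_le_iff)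
  have "(norm (B x))\<^sup>2 \<le> (2 * b) * (B x \<bullet> x)"
  proof (rule positive_norm_bound[OF _ _ B2])
    show "hermitian B" unfolding B_def using X by auto
    show "0 \<le> B y \<bullet> y" for y using b(1)[of y] unfolding Bin by (simp add: abs_le_iff)
  qed (use b in simp)
  also have "\<dots> \<le> (2 * b) * ((2 * b) * (norm x)\<^sup>2)" using B2 b by (intro mult_left_mono) auto
  also have "\<dots> = (2 * b * norm x)\<^sup>2" by (simp add: power2_eq_square algebra_simps)
  finally have "norm (B x) \<le> 2 * b * norm x" by (rule power2_le_imp_le) (use b in simp)
  moreover have "norm (X x) \<le> norm (B x) + norm (b *\<^sub>R x)"
    using norm_triangle_ineq4[of "B x" "b *\<^sub>R x"] by (simp add: Bx)
  ultimately show "norm (X x) \<le> 3 * b * norm x" using b by (simp add: algebra_simps)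
qed (use b in simp)

context tracial_von_neumann_algebra
begin

lemma tau_compress:
  assumes "A \<in> M" "projection_op A" "B \<in> M"
  shows "\<tau> (B o\<^sub>L A) = \<tau> (A o\<^sub>L (B o\<^sub>L A))"
proof -
  have "B o\<^sub>L A = (B o\<^sub>L A) o\<^sub>L A"
    by (rule blinfun_eqI) (simp add: projection_op_idem[OF assms(2)])
  then show ?thesis using tracial[of "B o\<^sub>L A" A] assms by (simp add: M_intros)
qed

lemma hermitian_compress:
  assumes "projection_op A" "hermitian B"
  shows "hermitian (A o\<^sub>L (B o\<^sub>L A))" "(A o\<^sub>L (B o\<^sub>L A)) x \<bullet> x = B (A x) \<bullet> A x"
  using hermitianD[OF projection_op_hermitian[OF assms(1)]] hermitianD[OF assms(2)] assms
  by (auto simp: hermitian_def intro!: bounded_ops_intros)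

text \<open>
  Since \<open>A\<close> is a projection, \<open>\<tau> (B A) = \<tau> (A B A)\<close>, and compression preserves the order. This is
  the reason for testing with projections rather than with arbitrary positive contractions.
\<close>

lemma tau_compress_mono:
  assumes A: "A \<in> M" "projection_op A" and B: "B \<in> M" "hermitian B" and C: "C \<in> M" "hermitian C"
    and le: "\<And>x. B x \<bullet> x \<le> C x \<bullet> x"
  shows "Re (\<tau> (B o\<^sub>L A)) \<le> Re (\<tau> (C o\<^sub>L A))"
  unfolding tau_compress[OF A B(1)] tau_compress[OF A C(1)]
  by (rule tau_mono; (intro M_intros hermitian_compress A B C)?)
     (simp only: hermitian_compress(2)[OF A(2)] B C le)

text \<open>
  \<open>\<tau> ((X - a) A) \<le> \<tau> ((X - a)\<^sub>+ A) \<le> \<tau> ((X - a)\<^sub>+)\<close>.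
\<close>

lemma excess_trace_variational:
  assumes X: "hermitian X" "X \<in> M" and A: "A \<in> M" "projection_op A"
  shows "Re (\<tau> ((X - a *\<^sub>R id_blinfun) o\<^sub>L A)) \<le> excess_trace X a"
proof -
  have "Re (\<tau> ((X - a *\<^sub>R id_blinfun) o\<^sub>L A)) \<le> Re (\<tau> (excess_op X a o\<^sub>L A))"
  proof (rule tau_compress_mono[OF A])
    show "(X - a *\<^sub>R id_blinfun) x \<bullet> x \<le> excess_op X a x \<bullet> x" for x
      using excess_op_dominates(2)[OF X(1), of x a]
      by (simp add: blinfun.bilinear_simps inner_diff_left power2_norm_eq_inner)
  qed (use X in \<open>auto intro: M_intros excess_op_in_M hermitian_excess_op\<close>)
  moreover have "Re (\<tau> (0 o\<^sub>L (id_blinfun - A))) \<le> Re (\<tau> (excess_op X a o\<^sub>L (id_blinfun - A)))"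
    by (rule tau_compress_mono)
       (use X A in \<open>auto intro: M_intros excess_op_in_M hermitian_excess_op projection_op_complement
          excess_op_dominates(1)\<close>)
  moreover have "excess_op X a o\<^sub>L (id_blinfun - A) = excess_op X a - (excess_op X a o\<^sub>L A)"
    by (rule blinfun_eqI) (simp add: blinfun.bilinear_simps)
  ultimately show ?thesis
    using X A by (simp add: excess_trace_def tau_diff tau_0 M_intros excess_op_in_M)
qed

lemma excess_trace_attained:
  "excess_trace X a = Re (\<tau> ((X - a *\<^sub>R id_blinfun) o\<^sub>L upper_projection X a))"
  by (simp add: excess_trace_def excess_op_def)

text \<open>
  The set of admissible \<open>X\<close>, described by conditions that are affine in \<open>X\<close>; see \<open>majorized_set_eq\<close>.
\<close>

definition majorized_set :: "('h \<Rightarrow>\<^sub>L 'h) \<Rightarrow> ('h \<Rightarrow>\<^sub>L 'h) set" where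
  "majorized_set C = {X \<in> M. hermitian X \<and> Re (\<tau> X) = Re (\<tau> C) \<and>
     (\<forall>a. \<forall>A\<in>M. projection_op A \<longrightarrow> Re (\<tau> ((X - a *\<^sub>R id_blinfun) o\<^sub>L A)) \<le> excess_trace C a)}"

lemma selfadjoints_iff: "X \<in> selfadjoints M \<longleftrightarrow> hermitian X \<and> X \<in> M"
  by (auto simp: selfadjoints_def hermitian_iff_adj M_bounded_ops)

lemma majorized_set_eq:
  assumes C: "hermitian C" "C \<in> M"
  shows "{X \<in> selfadjoints M. majorized_by (eigenvalue_function \<tau> X) (eigenvalue_function \<tau> C)} = majorized_set C"
proof -
  have var: "(\<forall>a. excess_trace X a \<le> excess_trace C a) \<longleftrightarrow>
     (\<forall>a. \<forall>A\<in>M. projection_op A \<longrightarrow> Re (\<tau> ((X - a *\<^sub>R id_blinfun) o\<^sub>L A)) \<le> excess_trace C a)"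
    if X: "hermitian X" "X \<in> M" for X
  proof (intro iffI allI ballI impI)
    fix a A assume "\<forall>a. excess_trace X a \<le> excess_trace C a" "A \<in> M" "projection_op A"
    then show "Re (\<tau> ((X - a *\<^sub>R id_blinfun) o\<^sub>L A)) \<le> excess_trace C a"
      using excess_trace_variational[OF X, of A a] order_trans by blast
  next
    fix a
    assume "\<forall>a. \<forall>A\<in>M. projection_op A \<longrightarrow> Re (\<tau> ((X - a *\<^sub>R id_blinfun) o\<^sub>L A)) \<le> excess_trace C a"
    then show "excess_trace X a \<le> excess_trace C a"
      unfolding excess_trace_attained
      using upper_projection_in_M[OF X] projection_op_upper_projection[OF X(1)] by blast
  qed
  show ?thesis
  proof (rule set_eqI, cases)
    fix X assume X: "hermitian X \<and> X \<in> M"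
    then show "X \<in> {X \<in> selfadjoints M. majorized_by (eigenvalue_function \<tau> X) (eigenvalue_function \<tau> C)}
        \<longleftrightarrow> X \<in> majorized_set C"
      unfolding majorized_set_def mem_Collect_eq selfadjoints_iff
        majorized_by_iff_excess[OF conjunct1[OF X] conjunct2[OF X] C]
        var[OF conjunct1[OF X] conjunct2[OF X]] by (simp only: simp_thms conj_commute)
  next
    fix X assume "\<not> (hermitian X \<and> X \<in> M)"
    then show "X \<in> {X \<in> selfadjoints M. majorized_by (eigenvalue_function \<tau> X) (eigenvalue_function \<tau> C)}
        \<longleftrightarrow> X \<in> majorized_set C"
      unfolding majorized_set_def mem_Collect_eq selfadjoints_iff by (simp only: simp_thms) argo
  qed
qed

text \<open>
  Above the norm of \<open>C\<close> the positive parts of \<open>C\<close> vanish, hence those of \<open>X\<close>, by faithfulness. Below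
  minus that norm, \<open>g\<^sub>C(a) = \<tau> C - a = \<tau> X - a\<close>, and \<open>g\<^sub>X \<le> g\<^sub>C\<close> forces \<open>(X - a)\<^sub>+ = X - a\<close>. The constant is not
  optimal.
\<close>

lemma majorized_set_bounded:
  assumes C: "hermitian C" "C \<in> M" and X: "X \<in> majorized_set C"
  shows "norm X \<le> 3 * (norm C + 1)"
proof (rule hermitian_norm_le)
  show Xh: "hermitian X" using X by (simp add: majorized_set_def)
  have XM: "X \<in> M" and tr: "Re (\<tau> X) = Re (\<tau> C)" using X by (simp_all add: majorized_set_def)
  have ex: "excess_trace X a \<le> excess_trace C a" for a
    using X upper_projection_in_M[OF Xh XM] projection_op_upper_projection[OF Xh]
    unfolding majorized_set_def excess_trace_attained[of X] by blast
  have "excess_op X (norm C) = 0"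
  proof (rule tau_eq_0_imp_0)
    show "Re (\<tau> (excess_op X (norm C))) \<le> 0"
      using ex[of "norm C"] excess_trace_above[OF C order_refl] by (simp add: excess_trace_def[of X])
  qed (use Xh XM in \<open>auto intro: excess_op_in_M hermitian_excess_op excess_op_dominates\<close>)
  then have up: "X x \<bullet> x \<le> norm C * (norm x)\<^sup>2" for x
    using excess_op_dominates(2)[OF Xh, of x "norm C"] by simp
  \<comment> \<open>below the spectrum of \<open>C\<close>, where the positive part of \<open>C - a\<close> is \<open>C - a\<close> itself\<close>
  define a where "a = - norm C - 1"
  define D where "D = excess_op X a - (X - a *\<^sub>R id_blinfun)"
  have "D = 0"
  proof (rule tau_eq_0_imp_0)
    show "D \<in> M" "hermitian D"
      unfolding D_def using Xh XM by (auto intro!: M_intros hermitian_intros excess_op_in_M hermitian_excess_op)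
    show "0 \<le> D x \<bullet> x" for x
      using excess_op_dominates(2)[OF Xh, of x a]
      by (simp add: D_def blinfun.bilinear_simps inner_diff_left power2_norm_eq_inner)
    have "excess_op C a = C - a *\<^sub>R id_blinfun"
      by (intro blinfun_eqI)
         (simp add: excess_op_apply upper_projection_eq_id[OF C(1)] a_def blinfun.bilinear_simps)
    then have "excess_trace C a = Re (\<tau> C) - a"
      by (simp add: excess_trace_def tau_diff tau_scaleR M_intros C unital)
    then show "Re (\<tau> D) \<le> 0"
      using ex[of a] tr XM Xh
      by (simp add: D_def tau_diff tau_scaleR M_intros excess_op_in_M unital excess_trace_def[of X])
  qed
  then have lo: "a * (norm x)\<^sup>2 \<le> X x \<bullet> x" for x
    using excess_op_dominates(1)[OF Xh, of a x]
    by (simp add: D_def blinfun.bilinear_simps inner_diff_left power2_norm_eq_inner)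
  show "\<bar>X x \<bullet> x\<bar> \<le> (norm C + 1) * (norm x)\<^sup>2" for x
  proof -
    have "X x \<bullet> x \<le> (norm C + 1) * (norm x)\<^sup>2"
      using up[of x] zero_le_power2[of "norm x"] unfolding distrib_right by linarith
    moreover have "- ((norm C + 1) * (norm x)\<^sup>2) \<le> X x \<bullet> x"
      using lo[of x] by (simp add: a_def algebra_simps)
    ultimately show ?thesis by (simp add: abs_le_iff)
  qed
qed simp

section \<open>Completeness of bounded sets in the trace 2-norm\<close>

lemma Re_tau_compose_bound:
  assumes "A \<in> M" "B \<in> M"
  shows "\<bar>Re (\<tau> (A o\<^sub>L B))\<bar> \<le> norm (adj A) * norm B"
proof -
  have "(Re (\<tau> (A o\<^sub>L B)))\<^sup>2 \<le> Re (\<tau> (A o\<^sub>L adj A)) * Re (\<tau> (adj B o\<^sub>L B))"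
    by (rule tau_Cauchy_Schwarz[OF assms])
  also have "\<dots> \<le> (norm (adj A))\<^sup>2 * (norm B)\<^sup>2"
    using tau_adj_compose_bound[OF M_adj[OF assms(1)]] tau_adj_compose_bound[OF assms(2)]
    by (intro mult_mono) (simp_all add: adj_adj M_bounded_ops assms)
  also have "\<dots> = (norm (adj A) * norm B)\<^sup>2" by (simp add: power_mult_distrib)
  finally show ?thesis by (metis abs_le_square_iff abs_of_nonneg mult_nonneg_nonneg norm_ge_zero)
qed

text \<open>
  The regularizing operator for the scaled sequence \<open>\<surd>(e 2\<^sup>k) Z\<^sub>k\<close>. The scaling makes \<open>Z\<^sub>k R\<close> decay geometrically,
  while the traces of the scaled squares still add up to at most \<open>2 e\<close>; so \<open>1 - R\<close> has small trace.
\<close>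

lemma summable_squares_regularizer:
  assumes Z: "\<And>k. Z k \<in> M" "\<And>k. hermitian (Z k)"
    and small: "\<And>k. Re (\<tau> (Z k o\<^sub>L Z k)) \<le> (1/8) ^ k" and e: "0 < e"
  obtains R where "R \<in> M" "hermitian R" "\<And>x. 0 \<le> R x \<bullet> x" "\<And>x. R x \<bullet> x \<le> (norm x)\<^sup>2"
    "Re (\<tau> (id_blinfun - R)) \<le> 2 * e"
    "\<And>k x. norm (Z k (R x)) \<le> (1 / sqrt e) * (1 / sqrt 2) ^ k * norm x"
proof -
  define Y where "Y k = sqrt (e * 2 ^ k) *\<^sub>R Z k" for k
  have Yx: "Y k x = sqrt (e * 2 ^ k) *\<^sub>R Z k x" for k x by (simp add: Y_def blinfun.scaleR_left)
  have Yh: "hermitian (Y k)" and YM: "Y k \<in> M" for k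
    unfolding Y_def using Z by (auto intro: M_intros)
  obtain R :: "'h \<Rightarrow>\<^sub>L 'h" and r where Rh: "hermitian R" and rh: "\<And>n. hermitian (r n)"
    and lim: "\<And>x. (\<lambda>n. r n x) \<longlonglongrightarrow> R x"
    and r0: "\<And>n x. 0 \<le> r n x \<bullet> x" and r1: "\<And>n x. r n x \<bullet> x \<le> (norm x)\<^sup>2"
    and rmono: "\<And>m n x. m \<le> n \<Longrightarrow> r n x \<bullet> x \<le> r m x \<bullet> x"
    and YR: "\<And>k x. norm (Y k (R x)) \<le> norm x"
    and low: "\<And>n x. (norm x)\<^sup>2 - (\<Sum>k<n. (norm (Y k x))\<^sup>2) \<le> r n x \<bullet> x"
    and rcomm: "\<And>B n. (\<And>k. Y k o\<^sub>L B = B o\<^sub>L Y k) \<Longrightarrow> r n o\<^sub>L B = B o\<^sub>L r n"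
    by (rule regularizing_operator[of Y, OF Yh]) blast
  have rM: "r n \<in> M" for n
    by (rule M_I) (use rh in auto, rule rcomm, rule M_commute[OF YM])
  have RM: "R \<in> M" by (rule M_limit[OF rM _ lim]) (use Rh in auto)
  have limi: "(\<lambda>n. r n x \<bullet> x) \<longlonglongrightarrow> R x \<bullet> x" for x by (intro tendsto_intros lim)
  have tr: "Re (\<tau> (id_blinfun - r n)) \<le> 2 * e" for n
  proof -
    define S where "S = (\<Sum>k<n. Y k o\<^sub>L Y k)"
    have SM: "S \<in> M" and tS: "\<tau> S = (\<Sum>k<n. \<tau> (Y k o\<^sub>L Y k))"
      unfolding S_def using tau_sum[of "{..<n}" "\<lambda>k. Y k o\<^sub>L Y k"] YM by (auto intro: M_intros)
    have Sh: "hermitian S" unfolding S_def by (rule hermitian_sum) (use Yh in auto)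
    have Sin: "S x \<bullet> x = (\<Sum>k<n. (norm (Y k x))\<^sup>2)" for x
      by (simp add: S_def blinfun.sum_left inner_sum_left hermitianD[OF Yh] power2_norm_eq_inner)
    have "Re (\<tau> (id_blinfun - r n)) \<le> Re (\<tau> S)"
    proof (rule tau_mono)
      show "(id_blinfun - r n) x \<bullet> x \<le> S x \<bullet> x" for x
        using low[of x n] by (simp add: Sin blinfun.diff_left inner_diff_left power2_norm_eq_inner)
    qed (use SM Sh rM rh in \<open>auto intro: M_intros\<close>)
    also have "\<dots> = (\<Sum>k<n. e * 2 ^ k * Re (\<tau> (Z k o\<^sub>L Z k)))"
    proof -
      have "Y k o\<^sub>L Y k = (e * 2 ^ k) *\<^sub>R (Z k o\<^sub>L Z k)" for k
        by (rule blinfun_eqI) (use e in \<open>simp add: Yx blinfun.bilinear_simps\<close>)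
      then have "Re (\<tau> (Y k o\<^sub>L Y k)) = e * 2 ^ k * Re (\<tau> (Z k o\<^sub>L Z k))" for k
        using Z by (simp add: tau_scaleR M_intros flip: of_real_mult of_real_power)
      then show ?thesis by (simp add: tS)
    qed
    also have "\<dots> \<le> (\<Sum>k<n. e * (1/4) ^ k)"
    proof (rule sum_mono)
      fix k
      have "e * 2 ^ k * Re (\<tau> (Z k o\<^sub>L Z k)) \<le> e * 2 ^ k * (1/8) ^ k"
        using e small[of k] by (intro mult_left_mono) auto
      also have "\<dots> = e * (1/4) ^ k" by (simp add: mult.assoc flip: power_mult_distrib)
      finally show "e * 2 ^ k * Re (\<tau> (Z k o\<^sub>L Z k)) \<le> e * (1/4) ^ k" .
    qed
    also have "\<dots> = e * (\<Sum>k<n. (1/4) ^ k)" by (simp only: sum_distrib_left)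
    also have "\<dots> \<le> e * 2"
    proof (rule mult_left_mono)
      have "(\<Sum>k<n. (1/4::real) ^ k) = (1 - (1/4) ^ n) / (1 - 1/4)"
        by (subst sum_gp_strict) simp
      also have "\<dots> \<le> 2"
      proof -
        have "(1 - y) / (1 - 1/4) \<le> 2" if "0 \<le> y" for y :: real
          using that by (simp add: field_simps)
        then show ?thesis by this (rule zero_le_power, simp)
      qed
      finally show "(\<Sum>k<n. (1/4::real) ^ k) \<le> 2" .
    qed (use e in simp)
    finally show ?thesis by simp
  qed
  show ?thesis
  proof (rule that[OF RM Rh])
    show "0 \<le> R x \<bullet> x" for x by (rule LIMSEQ_le_const[OF limi]) (use r0 in blast)
    show "R x \<bullet> x \<le> (norm x)\<^sup>2" for x by (rule LIMSEQ_le_const2[OF limi]) (use r1 in blast)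
    show "Re (\<tau> (id_blinfun - R)) \<le> 2 * e"
    proof (rule tau_increasing_limit_le[where A="\<lambda>n. id_blinfun - r n"])
      show "(\<lambda>n. (id_blinfun - r n) x) \<longlonglongrightarrow> (id_blinfun - R) x" for x
        by (simp add: blinfun.diff_left) (intro tendsto_intros lim)
      show "(id_blinfun - r m) x \<bullet> x \<le> (id_blinfun - r n) x \<bullet> x" if "m \<le> n" for m n x
        using rmono[OF that, of x] by (simp add: blinfun.diff_left inner_diff_left)
    qed (use rM rh RM Rh tr in \<open>auto intro: M_intros\<close>)
    show "norm (Z k (R x)) \<le> (1 / sqrt e) * (1 / sqrt 2) ^ k * norm x" for k x
    proof -
      have "sqrt e * sqrt 2 ^ k * norm (Z k (R x)) \<le> norm x"
        using YR[of k x] e by (simp add: Yx real_sqrt_mult real_sqrt_power)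
      then show ?thesis using e by (simp add: field_simps)
    qed
  qed
qed

text \<open>
  The vectors \<open>x\<close> for which \<open>Y\<^sub>n x\<close> converges form a closed subspace invariant under the commutant, so the
  projection \<open>Q\<close> onto its complement is in \<open>M\<close>. The subspace contains the range of every regularizing operator \<open>R\<close>, so
  \<open>\<tau> Q \<le> \<tau> (1 - R) \<le> 2 e\<close> for every \<open>e\<close>, and \<open>Q = 0\<close>. This gives the strong limit \<open>L\<close>. The traces converge because
  in \<open>T (Y\<^sub>n - L) = T (Y\<^sub>n - L) R + T (Y\<^sub>n - L) (1 - R)\<close> the first term tends to \<open>0\<close> in norm and the trace of the
  second is small by Cauchy-Schwarz.
\<close>

lemma bounded_Cauchy_limit:
  assumes Y: "\<And>n. Y n \<in> M" "\<And>n. hermitian (Y n)" and bnd: "\<And>n. norm (Y n) \<le> c"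
    and small: "\<And>k. Re (\<tau> ((Y (Suc k) - Y k) o\<^sub>L (Y (Suc k) - Y k))) \<le> (1/8) ^ k"
  obtains L where "L \<in> M" "hermitian L" "\<And>T. T \<in> M \<Longrightarrow> (\<lambda>n. Re (\<tau> (T o\<^sub>L Y n))) \<longlonglongrightarrow> Re (\<tau> (T o\<^sub>L L))"
proof -
  define Z where "Z k = Y (Suc k) - Y k" for k
  \<comment> \<open>the decay rate in \<open>summable_squares_regularizer\<close>\<close>
  define q where "q = 1 / sqrt (2::real)"
  have q: "0 < q" "q < 1" by (simp_all add: q_def)
  have ZM: "Z k \<in> M" and Zh: "hermitian (Z k)" for k unfolding Z_def using Y by (auto intro: M_intros)
  have reg: "\<exists>R. R \<in> M \<and> hermitian R \<and> (\<forall>x. 0 \<le> R x \<bullet> x) \<and> (\<forall>x. R x \<bullet> x \<le> (norm x)\<^sup>2) \<and>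
      Re (\<tau> (id_blinfun - R)) \<le> 2 * e \<and> (\<forall>k x. norm (Z k (R x)) \<le> (1 / sqrt e) * q ^ k * norm x)"
    if "0 < e" for e
    unfolding q_def
    by (rule summable_squares_regularizer[of Z e, OF ZM Zh _ that]) (use small in \<open>auto simp: Z_def\<close>)
  \<comment> \<open>geometric series bound for vectors on which the increments decay geometrically\<close>
  have tele: "norm (Y m y - Y n y) \<le> b * q ^ n / (1 - q)"
    if b: "\<And>k. norm (Z k y) \<le> b * q ^ k" and "n \<le> m" for m n y b
  proof -
    have b0: "0 \<le> b" using order_trans[OF norm_ge_zero b[of 0]] by simp
    have "norm (Y (n + j) y - Y n y) \<le> b * q ^ n * (\<Sum>i<j. q ^ i)" for j
    proof (induction j)
      case (Suc j)
      have "Y (n + Suc j) y - Y n y = Z (n + j) y + (Y (n + j) y - Y n y)"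
        by (simp add: Z_def blinfun.diff_left)
      then have "norm (Y (n + Suc j) y - Y n y) \<le> norm (Z (n + j) y) + norm (Y (n + j) y - Y n y)"
        by (simp only: norm_triangle_ineq)
      also have "\<dots> \<le> b * q ^ (n + j) + b * q ^ n * (\<Sum>i<j. q ^ i)"
        using b[of "n + j"] Suc by (intro add_mono)
      finally show ?case by (simp add: power_add algebra_simps)
    qed simp
    from this[of "m - n"] have "norm (Y m y - Y n y) \<le> b * q ^ n * (\<Sum>i<m-n. q ^ i)"
      using \<open>n \<le> m\<close> by simp
    also have "\<dots> \<le> b * q ^ n * (1 / (1 - q))"
    proof (rule mult_left_mono)
      have "(\<Sum>i<m-n. q ^ i) = (1 - q ^ (m - n)) / (1 - q)" using q by (subst sum_gp_strict) simp
      also have "\<dots> \<le> 1 / (1 - q)" using q by (intro divide_right_mono) auto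
      finally show "(\<Sum>i<m-n. q ^ i) \<le> 1 / (1 - q)" .
    qed (use b0 q in simp)
    finally show ?thesis by simp
  qed
  have q0: "(\<lambda>n. b * q ^ n / (1 - q)) \<longlonglongrightarrow> 0" for b
  proof -
    have "(\<lambda>n. b * q ^ n / (1 - q)) \<longlonglongrightarrow> b * 0 / (1 - q)"
      using q by (intro tendsto_intros LIMSEQ_realpow_zero) auto
    then show ?thesis by simp
  qed
  define W where "W = {x. Cauchy (\<lambda>n. Y n x)}"
  have WI: "y \<in> W" if b: "\<And>k. norm (Z k y) \<le> b * q ^ k" for y b
    unfolding W_def mem_Collect_eq
  proof (rule CauchyI)
    fix e :: real assume "e > 0"
    then obtain N where N: "\<bar>b * q ^ N / (1 - q)\<bar> < e / 2"
      using LIMSEQ_D[OF q0[of b], of "e/2"] by auto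
    have "norm (Y m y - Y n y) < e" if "m \<ge> N" "n \<ge> N" for m n
    proof -
      have "norm (Y m y - Y n y) \<le> norm (Y m y - Y N y) + norm (Y n y - Y N y)"
        using norm_triangle_ineq4[of "Y m y - Y N y" "Y n y - Y N y"] by simp
      then show ?thesis
        using tele[OF b that(1)] tele[OF b that(2)] order_le_less_trans[OF abs_ge_self N] by argo
    qed
    then show "\<exists>N. \<forall>m\<ge>N. \<forall>n\<ge>N. norm (Y m y - Y n y) < e" by blast
  qed
  have c0: "0 \<le> c" using bnd[of 0] norm_ge_zero order_trans by blast
  have Yc: "norm (Y n x) \<le> c * norm x" for n x
    using norm_blinfun[of "Y n" x] mult_right_mono[OF bnd[of n], of "norm x"] by simp
  have Winv: "B x \<in> W" if "B \<in> commutant M" "x \<in> W" for B x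
  proof -
    have "(\<lambda>n. Y n (B x)) = (\<lambda>n. B (Y n x))"
      using M_commute[OF Y(1) that(1), THEN commute_apply] by simp
    then show ?thesis
      using that(2) bounded_linear.Cauchy[OF blinfun.bounded_linear_right, of "\<lambda>n. Y n x" B]
      by (simp add: W_def)
  qed
  have Wi: "\<i> *\<^sub>C x \<in> W" if "x \<in> W" for x
    using that bounded_linear.Cauchy[OF bounded_linear_scaleC, of "\<lambda>n. Y n x" \<i>] Y(2)
    by (simp add: W_def hermitian_def bounded_ops_iff)
  have Wsub: "subspace W"
    unfolding subspace_def W_def
    by (auto simp: blinfun.add_right blinfun.scaleR_right Cauchy_convergent_iff
        intro: convergent_add convergent_const bounded_linear.convergent[OF bounded_linear_scaleR_right])
  have Wclosed: "closed W"
    unfolding closed_sequential_limits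
  proof (intro allI impI, elim conjE)
    fix w x assume w: "\<forall>j. w j \<in> W" and lim: "w \<longlonglongrightarrow> x"
    show "x \<in> W"
      unfolding W_def mem_Collect_eq
    proof (rule CauchyI)
      fix e :: real assume e: "e > 0"
      have "0 < e / (4 * (c + 1))" using e c0 by simp
      then obtain j where j: "norm (w j - x) < e / (4 * (c + 1))" using LIMSEQ_D[OF lim] by blast
      have cx: "norm (Y n x - Y n (w j)) \<le> e / 4" for n
      proof -
        have "norm (Y n x - Y n (w j)) \<le> c * norm (w j - x)"
          using Yc[of n "x - w j"] by (simp add: blinfun.diff_right norm_minus_commute)
        also have "\<dots> \<le> (c + 1) * (e / (4 * (c + 1)))" using j c0 by (intro mult_mono) auto
        also have "\<dots> = e / 4"
        proof -
          have "y * (e / (4 * y)) = e / 4" if "y \<noteq> 0" for y :: real using that by simp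
          then show ?thesis using c0 by (metis add_nonneg_pos less_irrefl zero_less_one)
        qed
        finally show ?thesis .
      qed
      obtain N where N: "\<forall>m\<ge>N. \<forall>n\<ge>N. norm (Y m (w j) - Y n (w j)) < e / 2"
        using w e CauchyD[of "\<lambda>n. Y n (w j)" "e/2"] unfolding W_def by auto
      have "norm (Y m x - Y n x) < e" if "m \<ge> N" "n \<ge> N" for m n
      proof -
        have "Y m x - Y n x = (Y m x - Y m (w j)) + ((Y m (w j) - Y n (w j)) - (Y n x - Y n (w j)))"
          by simp
        from arg_cong[OF this, of norm] have "norm (Y m x - Y n x) \<le> norm (Y m x - Y m (w j)) +
            (norm (Y m (w j) - Y n (w j)) + norm (Y n x - Y n (w j)))"
          using norm_triangle_ineq[of "Y m x - Y m (w j)" "(Y m (w j) - Y n (w j)) - (Y n x - Y n (w j))"]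
            norm_triangle_ineq4[of "Y m (w j) - Y n (w j)" "Y n x - Y n (w j)"] by linarith
        then show ?thesis using cx[of m] cx[of n] N[rule_format, OF that] by linarith
      qed
      then show "\<exists>N. \<forall>m\<ge>N. \<forall>n\<ge>N. norm (Y m x - Y n x) < e" by blast
    qed
  qed
  obtain P where P: "projection_op P" and PW: "\<And>x. P x = x \<longleftrightarrow> x \<in> W"
    by (rule closed_complex_subspace_projection[OF Wsub Wclosed]) (erule Wi, rule that, auto)
  have Ph: "hermitian P" by (rule projection_op_hermitian[OF P])
  have PM: "P \<in> M" by (rule projection_in_M[OF P]) (simp add: PW Winv)
  define Q where "Q = id_blinfun - P"
  have Qpr: "projection_op Q" unfolding Q_def by (rule projection_op_complement[OF P])
  have QM: "Q \<in> M" unfolding Q_def by (intro M_intros PM)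
  have Qle: "Re (\<tau> Q) \<le> 2 * e" if e: "0 < e" for e
  proof -
    obtain R where R: "R \<in> M" "hermitian R" "\<And>x. R x \<bullet> x \<le> (norm x)\<^sup>2"
      "Re (\<tau> (id_blinfun - R)) \<le> 2 * e" "\<And>k x. norm (Z k (R x)) \<le> (1 / sqrt e) * q ^ k * norm x"
      using reg[OF e] by blast
    have "R x \<in> W" for x
      by (rule WI[of _ "(1 / sqrt e) * norm x"]) (use R(5) in \<open>simp add: mult_ac\<close>)
    then have PR: "P (R x) = R x" for x using PW by blast
    have RP: "R (P x) = R x" for x
    proof (subst vector_eq_rdot[symmetric], intro allI)
      fix y
      have "R (P x) \<bullet> y = x \<bullet> P (R y)" by (simp add: hermitianD[OF R(2)] hermitianD[OF Ph])
      then show "R (P x) \<bullet> y = R x \<bullet> y" by (simp add: PR hermitianD[OF R(2)])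
    qed
    have "Re (\<tau> Q) \<le> Re (\<tau> (id_blinfun - R))"
    proof (rule tau_mono[OF QM projection_op_hermitian[OF Qpr]])
      fix x
      have "R x \<bullet> x = R (P x) \<bullet> P x"
        using hermitianD[OF Ph, of "R x" x] by (simp add: PR RP)
      also have "\<dots> \<le> P x \<bullet> x" using R(3)[of "P x"] by (simp add: projection_op_inner[OF P])
      finally show "Q x \<bullet> x \<le> (id_blinfun - R) x \<bullet> x"
        by (simp add: Q_def blinfun.diff_left inner_diff_left)
    qed (use R in \<open>auto intro: M_intros\<close>)
    then show ?thesis using R(4) by simp
  qed
  have "Q = 0"
  proof (rule tau_eq_0_imp_0[OF QM projection_op_hermitian[OF Qpr]])
    show "Re (\<tau> Q) \<le> 0"
    proof (rule field_le_epsilon)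
      fix e :: real assume "0 < e"
      then show "Re (\<tau> Q) \<le> 0 + e" using Qle[of "e/2"] by simp
    qed
  qed (simp add: projection_op_inner[OF Qpr])
  then have "P x = x" for x using blinfun.diff_left[of id_blinfun P x] by (simp add: Q_def)
  then have conv: "convergent (\<lambda>n. Y n x)" for x
    using PW[of x] by (simp add: W_def Cauchy_convergent_iff)
  obtain L where Lb: "L \<in> bounded_ops" and Lc: "norm L \<le> c" and lim: "\<And>x. (\<lambda>n. Y n x) \<longlonglongrightarrow> L x"
    by (rule pointwise_limit_operator[of Y c, OF M_bounded_ops[OF Y(1)] bnd conv]) blast
  have LM: "L \<in> M" by (rule M_limit[OF Y(1) Lb lim])
  have Lh: "hermitian L" by (rule hermitian_limit[OF Y(2) Lb lim])
  show ?thesis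
  proof (rule that[OF LM Lh])
    fix T assume T: "T \<in> M"
    define a where "a = norm (adj T)"
    define U where "U n = Y n - L" for n
    have UM: "U n \<in> M" and Uh: "hermitian (U n)" for n
      unfolding U_def using Y LM Lh by (auto intro: M_intros)
    have Un: "norm (U n) \<le> 2 * c" for n
      using norm_triangle_ineq4[of "Y n" L] bnd[of n] Lc by (simp add: U_def)
    have "(\<lambda>n. Re (\<tau> (T o\<^sub>L U n))) \<longlonglongrightarrow> 0"
    proof (rule LIMSEQ_I)
      fix d :: real assume d: "d > 0"
      \<comment> \<open>the second term of the splitting will be at most \<open>2 a c s \<le> d / 2\<close>\<close>
      define s where "s = d / (2 * (2 * a * c + 1))"
      have a0: "0 \<le> a" by (simp add: a_def)
      have ac: "0 < 2 * a * c + 1" using a0 c0 by (simp add: add_nonneg_pos)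
      have s: "0 < s" unfolding s_def using d ac by simp
      obtain R where R: "R \<in> M" "hermitian R" "\<And>x. 0 \<le> R x \<bullet> x" "\<And>x. R x \<bullet> x \<le> (norm x)\<^sup>2"
        "Re (\<tau> (id_blinfun - R)) \<le> 2 * (s\<^sup>2 / 2)"
        "\<And>k x. norm (Z k (R x)) \<le> (1 / sqrt (s\<^sup>2 / 2)) * q ^ k * norm x"
        using reg[of "s\<^sup>2 / 2"] s by auto
      define b where "b = 1 / sqrt (s\<^sup>2 / 2)"
      have UR: "norm (U n o\<^sub>L R) \<le> b * q ^ n / (1 - q)" for n
      proof (rule norm_blinfun_bound)
        show "0 \<le> b * q ^ n / (1 - q)" using q by (simp add: b_def)
        fix x
        have "norm (L (R x) - Y n (R x)) \<le> (b * norm x) * q ^ n / (1 - q)"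
        proof (rule LIMSEQ_le_const2)
          show "(\<lambda>m. norm (Y m (R x) - Y n (R x))) \<longlonglongrightarrow> norm (L (R x) - Y n (R x))"
            by (intro tendsto_intros lim)
          show "\<exists>N. \<forall>m\<ge>N. norm (Y m (R x) - Y n (R x)) \<le> (b * norm x) * q ^ n / (1 - q)"
            by (intro exI[of _ n] allI impI tele) (use R(6) in \<open>simp_all add: b_def mult_ac\<close>)
        qed
        then show "norm ((U n o\<^sub>L R) x) \<le> b * q ^ n / (1 - q) * norm x"
          by (simp add: U_def blinfun.diff_left norm_minus_commute mult_ac)
      qed
      define V where "V = id_blinfun - R"
      have VM: "V \<in> M" and Vh: "hermitian V" unfolding V_def using R by (auto intro: M_intros)
      have Vx: "V x \<bullet> x = (norm x)\<^sup>2 - R x \<bullet> x" for x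
        by (simp add: V_def blinfun.diff_left inner_diff_left power2_norm_eq_inner)
      have VV: "Re (\<tau> (adj V o\<^sub>L V)) \<le> s\<^sup>2"
      proof -
        have "Re (\<tau> (adj V o\<^sub>L V)) \<le> Re (\<tau> V)"
        proof (rule tau_mono)
          show "(adj V o\<^sub>L V) x \<bullet> x \<le> V x \<bullet> x" for x
            unfolding adj_compose_inner[OF M_bounded_ops[OF VM]]
            using positive_norm_bound[OF Vh, of 1 x] R(3,4) by (simp add: Vx)
        qed (use VM Vh in \<open>auto intro: M_intros M_adj hermitian_adj_compose M_bounded_ops\<close>)
        then show ?thesis using R(5) by (simp add: V_def)
      qed
      have second: "\<bar>Re (\<tau> ((T o\<^sub>L U n) o\<^sub>L V))\<bar> \<le> (2 * a * c) * s" for n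
      proof -
        have TU: "T o\<^sub>L U n \<in> M" by (intro M_intros T UM)
        have "norm (adj (T o\<^sub>L U n)) \<le> norm (U n) * a"
          using Uh[of n] norm_blinfun_compose[of "U n" "adj T"] M_bounded_ops[OF T] M_bounded_ops[OF UM]
          by (simp add: adj_simps a_def hermitian_iff_adj)
        also have "\<dots> \<le> 2 * c * a" using Un a0 by (intro mult_right_mono)
        finally have n1: "norm (adj (T o\<^sub>L U n)) \<le> 2 * a * c" by (simp add: mult_ac)
        have "(Re (\<tau> ((T o\<^sub>L U n) o\<^sub>L V)))\<^sup>2
            \<le> Re (\<tau> ((T o\<^sub>L U n) o\<^sub>L adj (T o\<^sub>L U n))) * Re (\<tau> (adj V o\<^sub>L V))"
          by (rule tau_Cauchy_Schwarz[OF TU VM])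
        also have "\<dots> \<le> (norm (adj (T o\<^sub>L U n)))\<^sup>2 * s\<^sup>2"
          using tau_adj_compose_bound[OF M_adj[OF TU]] tau_adj_compose_bound(1)[OF VM] VV
          by (intro mult_mono) (simp_all add: adj_adj M_bounded_ops[OF TU])
        also have "\<dots> \<le> (2 * a * c)\<^sup>2 * s\<^sup>2" using n1 by (intro mult_right_mono power_mono) auto
        also have "\<dots> = ((2 * a * c) * s)\<^sup>2" by (simp add: power_mult_distrib)
        finally show ?thesis using a0 c0 s by (metis abs_le_square_iff abs_of_nonneg mult_nonneg_nonneg less_imp_le zero_le_numeral)
      qed
      have first: "\<bar>Re (\<tau> (T o\<^sub>L (U n o\<^sub>L R)))\<bar> \<le> a * (b * q ^ n / (1 - q))" for n
      proof -
        have "\<bar>Re (\<tau> (T o\<^sub>L (U n o\<^sub>L R)))\<bar> \<le> a * norm (U n o\<^sub>L R)"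
          unfolding a_def by (rule Re_tau_compose_bound) (intro M_intros T UM R)+
        also have "\<dots> \<le> a * (b * q ^ n / (1 - q))" using UR a0 by (intro mult_left_mono)
        finally show ?thesis .
      qed
      have split: "Re (\<tau> (T o\<^sub>L U n)) = Re (\<tau> (T o\<^sub>L (U n o\<^sub>L R))) + Re (\<tau> ((T o\<^sub>L U n) o\<^sub>L V))" for n
      proof -
        have "T o\<^sub>L U n = (T o\<^sub>L (U n o\<^sub>L R)) + ((T o\<^sub>L U n) o\<^sub>L V)"
          by (rule blinfun_eqI) (simp add: V_def blinfun.bilinear_simps)
        then have "\<tau> (T o\<^sub>L U n) = \<tau> (T o\<^sub>L (U n o\<^sub>L R)) + \<tau> ((T o\<^sub>L U n) o\<^sub>L V)"
          using add[of "T o\<^sub>L (U n o\<^sub>L R)" "(T o\<^sub>L U n) o\<^sub>L V"] T UM R VM by (simp add: M_intros)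
        then show ?thesis by simp
      qed
      have acs: "(2 * a * c) * s \<le> d / 2"
      proof -
        have "(2 * a * c) * s \<le> (2 * a * c + 1) * s" using s by simp
        also have "\<dots> = d / 2"
        proof -
          have "y * (d / (2 * y)) = d / 2" if "y \<noteq> 0" for y :: real using that by simp
          then show ?thesis unfolding s_def using ac by (metis less_irrefl)
        qed
        finally show ?thesis .
      qed
      have "(\<lambda>n. a * (b * q ^ n / (1 - q))) \<longlonglongrightarrow> a * 0" by (intro tendsto_intros q0)
      then obtain N where N: "\<forall>n\<ge>N. norm (a * (b * q ^ n / (1 - q)) - a * 0) < d / 2"
        using LIMSEQ_D[of _ "a * 0" "d/2"] d by force
      show "\<exists>N. \<forall>n\<ge>N. norm (Re (\<tau> (T o\<^sub>L U n)) - 0) < d"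
      proof (intro exI[of _ N] allI impI)
        fix n assume "n \<ge> N"
        then have "\<bar>a * (b * q ^ n / (1 - q)) - a * 0\<bar> < d / 2" using N unfolding real_norm_def by blast
        then have "a * (b * q ^ n / (1 - q)) < d / 2" by (simp only: mult_zero_right diff_zero abs_less_iff)
        then show "norm (Re (\<tau> (T o\<^sub>L U n)) - 0) < d"
          using first[of n] second[of n] acs unfolding split real_norm_def by linarith
      qed
    qed
    moreover have "Re (\<tau> (T o\<^sub>L U n)) = Re (\<tau> (T o\<^sub>L Y n)) - Re (\<tau> (T o\<^sub>L L))" for n
    proof -
      have "T o\<^sub>L U n = (T o\<^sub>L Y n) - (T o\<^sub>L L)"
        by (rule blinfun_eqI) (simp add: U_def blinfun.bilinear_simps)
      then show ?thesis using T Y LM by (simp add: tau_diff M_intros)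
    qed
    ultimately show "(\<lambda>n. Re (\<tau> (T o\<^sub>L Y n))) \<longlonglongrightarrow> Re (\<tau> (T o\<^sub>L L))"
      by (simp add: LIM_zero_iff)
  qed
qed

end

section \<open>Compactness of the numerical range\<close>

context tracial_von_neumann_algebra
begin

text \<open>
  The parallelogram law for the trace 2-norm.
\<close>

lemma tau_square_midpoint:
  assumes "X \<in> M" "Y \<in> M"
  shows "Re (\<tau> ((X - Y) o\<^sub>L (X - Y)))
      + 4 * Re (\<tau> (((1/2) *\<^sub>R (X + Y)) o\<^sub>L ((1/2) *\<^sub>R (X + Y))))
    = 2 * Re (\<tau> (X o\<^sub>L X)) + 2 * Re (\<tau> (Y o\<^sub>L Y))"
proof -
  let ?S = "((1/2) *\<^sub>R (X + Y)) o\<^sub>L ((1/2) *\<^sub>R (X + Y))"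
  have "((X - Y) o\<^sub>L (X - Y)) + 4 *\<^sub>R ?S = 2 *\<^sub>R (X o\<^sub>L X) + 2 *\<^sub>R (Y o\<^sub>L Y)"
    by (rule blinfun_eqI) (simp add: blinfun.bilinear_simps scaleR_add_right scaleR_2)
  then have "\<tau> (((X - Y) o\<^sub>L (X - Y)) + 4 *\<^sub>R ?S) = \<tau> (2 *\<^sub>R (X o\<^sub>L X) + 2 *\<^sub>R (Y o\<^sub>L Y))"
    by simp
  then have "\<tau> ((X - Y) o\<^sub>L (X - Y)) + of_real 4 * \<tau> ?S = of_real 2 * \<tau> (X o\<^sub>L X) + of_real 2 * \<tau> (Y o\<^sub>L Y)"
    using assms by (simp only: add tau_scaleR M_intros)
  from arg_cong[OF this, of Re] show ?thesis by simp
qed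

lemma majorized_set_midpoint:
  assumes X: "X \<in> majorized_set C" and Y: "Y \<in> majorized_set C"
  shows "(1/2) *\<^sub>R (X + Y) \<in> majorized_set C"
proof -
  have M: "X \<in> M" "Y \<in> M" and h: "hermitian X" "hermitian Y"
    and t: "Re (\<tau> X) = Re (\<tau> C)" "Re (\<tau> Y) = Re (\<tau> C)"
    using X Y by (simp_all add: majorized_set_def)
  have ineq: "Re (\<tau> (((1/2) *\<^sub>R (X + Y) - a *\<^sub>R id_blinfun) o\<^sub>L A)) \<le> excess_trace C a"
    if A: "A \<in> M" "projection_op A" for a A
  proof -
    let ?X = "(X - a *\<^sub>R id_blinfun) o\<^sub>L A" and ?Y = "(Y - a *\<^sub>R id_blinfun) o\<^sub>L A"
    have "((1/2) *\<^sub>R (X + Y) - a *\<^sub>R id_blinfun) o\<^sub>L A = (1/2) *\<^sub>R (?X + ?Y)"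
    proof (rule blinfun_eqI)
      fix x
      have half: "- (a *\<^sub>R A x) = - ((a/2) *\<^sub>R A x) - (a/2) *\<^sub>R A x"
        using scaleR_add_left[of "a/2" "a/2" "A x"] by simp
      show "(((1/2) *\<^sub>R (X + Y) - a *\<^sub>R id_blinfun) o\<^sub>L A) x = ((1/2) *\<^sub>R (?X + ?Y)) x"
        by (simp add: blinfun.bilinear_simps scaleR_diff_right scaleR_add_right) (rule half)
    qed
    moreover have "?X \<in> M" "?Y \<in> M" using M A by (auto intro!: M_intros)
    ultimately have "Re (\<tau> (((1/2) *\<^sub>R (X + Y) - a *\<^sub>R id_blinfun) o\<^sub>L A)) = (Re (\<tau> ?X) + Re (\<tau> ?Y)) / 2"
      by (simp add: tau_scaleR M_intros add)
    moreover have "Re (\<tau> ?X) \<le> excess_trace C a" "Re (\<tau> ?Y) \<le> excess_trace C a"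
      using X Y A unfolding majorized_set_def by blast+
    ultimately show ?thesis by simp
  qed
  show ?thesis
    unfolding majorized_set_def mem_Collect_eq
  proof (intro conjI allI ballI impI ineq)
    show "Re (\<tau> ((1/2) *\<^sub>R (X + Y))) = Re (\<tau> C)"
      using M t by (simp add: tau_scaleR add M_intros)
  qed (use M h in \<open>auto intro: M_intros\<close>)
qed

lemma majorized_set_limit:
  assumes Y: "\<And>n. Y n \<in> majorized_set C" and L: "L \<in> M" "hermitian L"
    and lim: "\<And>T. T \<in> M \<Longrightarrow> (\<lambda>n. Re (\<tau> (T o\<^sub>L Y n))) \<longlonglongrightarrow> Re (\<tau> (T o\<^sub>L L))"
  shows "L \<in> majorized_set C"
  unfolding majorized_set_def mem_Collect_eq
proof (intro conjI allI ballI impI L)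
  have YM: "Y n \<in> M" for n using Y[of n] by (simp add: majorized_set_def)
  show "Re (\<tau> L) = Re (\<tau> C)"
  proof (rule LIMSEQ_unique)
    show "(\<lambda>n. Re (\<tau> (Y n))) \<longlonglongrightarrow> Re (\<tau> L)" 
    proof -
      have "id_blinfun o\<^sub>L X = X" for X :: "'h \<Rightarrow>\<^sub>L 'h" by (rule blinfun_eqI) simp
      then show ?thesis using lim[OF M_intros(2)] by (simp only:)
    qed
    show "(\<lambda>n. Re (\<tau> (Y n))) \<longlonglongrightarrow> Re (\<tau> C)" using Y by (simp add: majorized_set_def)
  qed
  fix a A assume A: "A \<in> M" "projection_op A"
  have e: "Re (\<tau> ((X - a *\<^sub>R id_blinfun) o\<^sub>L A)) = Re (\<tau> (A o\<^sub>L X)) - a * Re (\<tau> A)" if "X \<in> M" for X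
  proof -
    have "(X - a *\<^sub>R id_blinfun) o\<^sub>L A = (X o\<^sub>L A) - a *\<^sub>R A"
      by (rule blinfun_eqI) (simp add: blinfun.bilinear_simps)
    then show ?thesis using that A tracial[of X A] by (simp add: tau_diff tau_scaleR M_intros)
  qed
  show "Re (\<tau> ((L - a *\<^sub>R id_blinfun) o\<^sub>L A)) \<le> excess_trace C a"
  proof (rule LIMSEQ_le_const2)
    show "(\<lambda>n. Re (\<tau> ((Y n - a *\<^sub>R id_blinfun) o\<^sub>L A))) \<longlonglongrightarrow> Re (\<tau> ((L - a *\<^sub>R id_blinfun) o\<^sub>L A))"
      unfolding e[OF YM] e[OF L(1)] by (intro tendsto_intros lim A)
    show "\<exists>N. \<forall>n\<ge>N. Re (\<tau> ((Y n - a *\<^sub>R id_blinfun) o\<^sub>L A)) \<le> excess_trace C a"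
      using Y A unfolding majorized_set_def by blast
  qed
qed

lemma tau_compose_scaleC:
  assumes "T \<in> M" "X \<in> M"
  shows "\<tau> (scaleC_op c T o\<^sub>L X) = c * \<tau> (T o\<^sub>L X)"
proof -
  have "scaleC_op c T o\<^sub>L X = scaleC_op c (T o\<^sub>L X)"
    by (rule blinfun_eqI) (simp add: scaleC_op_apply)
  then show ?thesis using assms by (simp add: scaleC M_intros)
qed

text \<open>
  Imaginary parts of traces are real parts of traces, so convergence of real parts for all \<open>T\<close> suffices.
\<close>

lemma Im_tau_compose:
  assumes "T \<in> M" "X \<in> M"
  shows "Im (\<tau> (T o\<^sub>L X)) = Re (\<tau> (scaleC_op (- \<i>) T o\<^sub>L X))"
  using tau_compose_scaleC[OF assms, of "- \<i>"] by simp

lemma tau_image_bounded: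
  assumes C: "hermitian C" "C \<in> M" and T: "T \<in> M"
  shows "bounded ((\<lambda>X. \<tau> (T o\<^sub>L X)) ` majorized_set C)"
proof -
  define b where "b = (norm (adj T) + norm (adj (scaleC_op (- \<i>) T))) * (3 * (norm C + 1))"
  have "cmod (\<tau> (T o\<^sub>L X)) \<le> b" if X: "X \<in> majorized_set C" for X
  proof -
    have XM: "X \<in> M" using X by (simp add: majorized_set_def)
    have n: "norm X \<le> 3 * (norm C + 1)" by (rule majorized_set_bounded[OF C X])
    have "cmod (\<tau> (T o\<^sub>L X)) \<le> \<bar>Re (\<tau> (T o\<^sub>L X))\<bar> + \<bar>Im (\<tau> (T o\<^sub>L X))\<bar>" by (rule cmod_le)
    also have "\<dots> \<le> norm (adj T) * norm X + norm (adj (scaleC_op (- \<i>) T)) * norm X"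
      unfolding Im_tau_compose[OF T XM]
      by (intro add_mono Re_tau_compose_bound T XM M_intros)
    also have "\<dots> \<le> b"
      unfolding b_def using n by (simp add: mult_left_mono flip: distrib_right)
    finally show ?thesis .
  qed
  then show ?thesis unfolding bounded_iff by blast
qed

text \<open>
  For \<open>z\<close> in the closure, almost minimal elements \<open>y\<^sub>n\<close> of the convex sets \<open>S n\<close> are Cauchy in the trace 2-norm. A
  subsequence \<open>Y\<^sub>k\<close> with increments of squared trace 2-norm at most \<open>8\<^bsup>-k\<^esup>\<close> has a limit in the sense of
  \<open>bounded_Cauchy_limit\<close>; the limit is admissible and \<open>\<tau> (T L) = z\<close>.
\<close>

lemma tau_image_closed:
  assumes C: "hermitian C" "C \<in> M" and T: "T \<in> M"
  shows "closed ((\<lambda>X. \<tau> (T o\<^sub>L X)) ` majorized_set C)"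
proof -
  have "z \<in> (\<lambda>X. \<tau> (T o\<^sub>L X)) ` majorized_set C"
    if z: "z \<in> closure ((\<lambda>X. \<tau> (T o\<^sub>L X)) ` majorized_set C)" for z
  proof -
    define S where "S n = {X \<in> majorized_set C. cmod (\<tau> (T o\<^sub>L X) - z) \<le> 1 / real (Suc n)}" for n
    define q where "q X = Re (\<tau> (X o\<^sub>L X))" for X
    define c where "c = 3 * (norm C + 1)"
    have SM: "X \<in> M" "hermitian X" "norm X \<le> c" "X \<in> majorized_set C" if "X \<in> S n" for X n
      using that majorized_set_bounded[OF C] by (auto simp: S_def majorized_set_def c_def)
    have qX: "0 \<le> q X" "q X \<le> c\<^sup>2" if "X \<in> S n" for X n
    proof -
      have "adj X = X" using SM(2)[OF that] by (simp add: hermitian_iff_adj)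
      then show "0 \<le> q X" "q X \<le> c\<^sup>2"
        using tau_adj_compose_bound[OF SM(1)[OF that]] power_mono[OF SM(3)[OF that], of 2]
        by (auto simp: q_def)
    qed
    have ne: "\<exists>X. X \<in> S n" for n
    proof -
      obtain w where "w \<in> (\<lambda>X. \<tau> (T o\<^sub>L X)) ` majorized_set C" "dist w z < 1 / real (Suc n)"
        using z unfolding closure_approachable by (metis zero_less_divide_1_iff of_nat_0_less_iff zero_less_Suc)
      then show ?thesis by (auto simp: S_def dist_norm)
    qed
    obtain y where yS: "\<And>n. y n \<in> S n"
      and yC: "\<And>e. e > 0 \<Longrightarrow> \<exists>N. \<forall>m\<ge>N. \<forall>n\<ge>N. q (y m - y n) < e"
    proof (rule minimizing_sequence_Cauchy[of S q "c\<^sup>2"])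
      show "S n \<subseteq> S m" if "m \<le> n" for m n
      proof -
        have "1 / real (Suc n) \<le> 1 / real (Suc m)" using that by (simp add: frac_le)
        then show ?thesis unfolding S_def by (auto intro: order_trans)
      qed
      show "(1/2) *\<^sub>R (X + Y) \<in> S n" if X: "X \<in> S n" and Y: "Y \<in> S n" for n X Y
      proof -
        have M: "X \<in> M" "Y \<in> M" using SM X Y by blast+
        have "T o\<^sub>L ((1/2) *\<^sub>R (X + Y)) = (1/2) *\<^sub>R ((T o\<^sub>L X) + (T o\<^sub>L Y))"
          by (rule blinfun_eqI) (simp add: blinfun.bilinear_simps)
        then have "\<tau> (T o\<^sub>L ((1/2) *\<^sub>R (X + Y))) = of_real (1/2) * (\<tau> (T o\<^sub>L X) + \<tau> (T o\<^sub>L Y))"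
          using M T by (simp only: tau_scaleR add M_intros)
        then have "\<tau> (T o\<^sub>L ((1/2) *\<^sub>R (X + Y))) - z
            = of_real (1/2) * ((\<tau> (T o\<^sub>L X) - z) + (\<tau> (T o\<^sub>L Y) - z))"
          by (simp add: algebra_simps)
        then have "cmod (\<tau> (T o\<^sub>L ((1/2) *\<^sub>R (X + Y))) - z)
            = cmod ((\<tau> (T o\<^sub>L X) - z) + (\<tau> (T o\<^sub>L Y) - z)) / 2"
          by (simp only: norm_mult norm_of_real)
        also have "\<dots> \<le> (cmod (\<tau> (T o\<^sub>L X) - z) + cmod (\<tau> (T o\<^sub>L Y) - z)) / 2"
          by (intro divide_right_mono norm_triangle_ineq) simp
        also have "\<dots> \<le> 1 / real (Suc n)" using X Y unfolding S_def by simp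
        finally show ?thesis using majorized_set_midpoint X Y unfolding S_def by blast
      qed
      show "\<exists>X\<in>S n. q X \<le> c\<^sup>2" for n using ne[of n] qX by blast
      show "q (X - Y) + 4 * q ((1 / 2) *\<^sub>R (X + Y)) = 2 * q X + 2 * q Y" if "X \<in> S 0" "Y \<in> S 0" for X Y
        unfolding q_def by (rule tau_square_midpoint) (use SM that in blast)+
    qed (use qX in blast)+
    have "\<exists>N. \<forall>m\<ge>N. \<forall>n\<ge>N. q (y m - y n) < (1/8) ^ k" for k by (rule yC) simp
    then obtain N where N: "\<And>k m n. m \<ge> N k \<Longrightarrow> n \<ge> N k \<Longrightarrow> q (y m - y n) < (1/8) ^ k" by metis
    \<comment> \<open>both \<open>g k\<close> and \<open>g (Suc k)\<close> are at least \<open>N k\<close>, and \<open>g k \<ge> k\<close>\<close>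
    define g where "g k = k + (\<Sum>i\<le>k. N i)" for k
    have gk: "k \<le> g k" for k by (simp add: g_def)
    have gN: "N k \<le> g k" "N k \<le> g (Suc k)" for k
    proof -
      have "N k \<le> (\<Sum>i\<le>k. N i)" by (rule member_le_sum) auto
      then show "N k \<le> g k" "N k \<le> g (Suc k)" by (simp_all add: g_def)
    qed
    define Y where "Y k = y (g k)" for k
    have YS: "Y k \<in> S (g k)" for k unfolding Y_def by (rule yS)
    have small: "Re (\<tau> ((Y (Suc k) - Y k) o\<^sub>L (Y (Suc k) - Y k))) \<le> (1/8) ^ k" for k
      using N[OF gN(2) gN(1), of k] by (simp add: q_def Y_def)
    obtain L where L: "L \<in> M" "hermitian L"
      and lim: "\<And>T. T \<in> M \<Longrightarrow> (\<lambda>n. Re (\<tau> (T o\<^sub>L Y n))) \<longlonglongrightarrow> Re (\<tau> (T o\<^sub>L L))"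
      by (rule bounded_Cauchy_limit[of Y c, OF SM(1)[OF YS] SM(2)[OF YS] SM(3)[OF YS] small]) blast
    have LC: "L \<in> majorized_set C" by (rule majorized_set_limit[OF SM(4)[OF YS] L lim])
    have "(\<lambda>n. \<tau> (T o\<^sub>L Y n)) \<longlonglongrightarrow> \<tau> (T o\<^sub>L L)"
    proof (rule tendsto_complex_iff[THEN iffD2, OF conjI])
      show "(\<lambda>n. Re (\<tau> (T o\<^sub>L Y n))) \<longlonglongrightarrow> Re (\<tau> (T o\<^sub>L L))" by (rule lim[OF T])
      show "(\<lambda>n. Im (\<tau> (T o\<^sub>L Y n))) \<longlonglongrightarrow> Im (\<tau> (T o\<^sub>L L))"
        unfolding Im_tau_compose[OF T SM(1)[OF YS]] Im_tau_compose[OF T L(1)]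
        by (rule lim) (intro M_intros T)
    qed
    moreover have "(\<lambda>n. \<tau> (T o\<^sub>L Y n)) \<longlonglongrightarrow> z"
    proof (rule LIM_zero_cancel, rule Lim_null_comparison)
      show "\<forall>\<^sub>F n in sequentially. norm (\<tau> (T o\<^sub>L Y n) - z) \<le> inverse (real (Suc n))"
      proof (rule always_eventually, rule allI)
        fix n
        have "norm (\<tau> (T o\<^sub>L Y n) - z) \<le> 1 / real (Suc (g n))" using YS[of n] by (simp add: S_def)
        also have "\<dots> \<le> inverse (real (Suc n))" using gk[of n] by (simp add: inverse_eq_divide frac_le)
        finally show "norm (\<tau> (T o\<^sub>L Y n) - z) \<le> inverse (real (Suc n))" .
      qed
    qed (rule LIMSEQ_inverse_real_of_nat)
    ultimately have "z = \<tau> (T o\<^sub>L L)" using LIMSEQ_unique by blast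
    then show ?thesis using LC by blast
  qed
  then have "closure ((\<lambda>X. \<tau> (T o\<^sub>L X)) ` majorized_set C) \<subseteq> (\<lambda>X. \<tau> (T o\<^sub>L X)) ` majorized_set C"
    by (rule subsetI)
  then show ?thesis by (simp only: closure_subset_eq)
qed

end

theorem corollary2p16:
  fixes M :: "('h::complex_hilbert_space \<Rightarrow>\<^sub>L 'h) set"
    and \<tau> :: "('h \<Rightarrow>\<^sub>L 'h) \<Rightarrow> complex"
    and T C :: "'h \<Rightarrow>\<^sub>L 'h"
  assumes "tracial_von_neumann_algebra M \<tau>"
    and "T \<in> M"
    and "C \<in> selfadjoints M"
  shows "compact (C_numerical_range M \<tau> C T)"
proof -
  interpret tracial_von_neumann_algebra M \<tau> by fact
  have C: "hermitian C" "C \<in> M" using assms(3) by (simp_all add: selfadjoints_iff)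
  have "C_numerical_range M \<tau> C T = (\<lambda>X. \<tau> (T o\<^sub>L X)) ` majorized_set C"
    unfolding C_numerical_range_def majorized_set_eq[OF C, symmetric] by blast
  then show ?thesis
    using tau_image_bounded[OF C assms(2)] tau_image_closed[OF C assms(2)]
    by (simp add: compact_eq_bounded_closed)
qed

end
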